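(* Let $a, b \geq 0$ satisfy $\sqrt{a} - \sqrt{b} > \sqrt{2}$, and for even $n$ let $p = \frac{a\log n}{n}$ and $q = \frac{b \log n}{n}$. Let $z \in \{\pm 1\}^n$ with $\langle z, \mathbf{1}\rangle = 0$, and let $A$ be the adjacency matrix of a random graph on $\{1,\dots,n\}$ drawn from the binary symmetric stochastic block model with label vector $z$: $A$ is symmetric with zero diagonal, and its entries $A_{ij}$, $i<j$, are independent Bernoulli random variables with $$\mathbf{P}(A_{ij}=1) = \begin{cases} p & \text{if } z_i = z_j,\\ q & \text{if } z_i\neq z_j.\end{cases}$$ Then there exists a constant $r_0$, depending only on $a$ and $b$, such that, with probability $\to 1$ as $n\to\infty$, the following holds: if the cost matrix $C$ is chosen according to $$C = A - \frac{1}{n^2}\langle A, \mathbf{1}\mathbf{1}^\top\rangle \mathbf{1}\mathbf{1}^\top \qquad\text{or}\qquad C = A - \frac{p+q}{2}\mathbf{1}\mathbf{1}^\top,$$ then, for all integers $r\geq r_0$, every second-order critical point $Y\in\mathbf{R}^{n\times r}$ of the problem $$\max_{Y \in \mathbf{R}^{n\times r}}~\langle C, YY^\top\rangle \quad \text{s.t. } \mathrm{ddiag}(YY^\top) = I_n$$ satisfies $Y = zu^\top$ for some unit-norm $u\in\mathbf{R}^r$.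
   Context: $\mathbf{1}$ is the all-ones vector in $\mathbf{R}^n$. $\langle \cdot,\cdot\rangle$ is the Euclidean inner product for vectors and the Frobenius inner product $\langle A,B\rangle = \mathrm{trace}(A^\top B)$ for matrices; $\mathrm{ddiag}\colon \mathbf{R}^{n\times n}\to\mathbf{R}^{n\times n}$ keeps the diagonal of a matrix and sets the off-diagonal entries to zero. (For the asymptotic statement only $n$ large enough that $p,q\le 1$ matters.) The constraint $\mathrm{ddiag}(YY^\top)=I_n$ says that every row of $Y$ is a unit vector in $\mathbf{R}^r$, so the feasible set is a Riemannian manifold (a product of $n$ unit spheres embedded in $\mathbf{R}^r$). A second-order critical point is a feasible $Y$ at which the Riemannian gradient of the objective is zero and the Riemannian Hessian is negative semidefinite. Explicitly, for symmetric $C$, put $S(Y) = \mathrm{ddiag}(CYY^\top) - C$; a feasible $Y$ is second-order critical if and only if (i) $S(Y)Y = 0$, and (ii) $\langle S(Y), \dot Y \dot Y^\top\rangle \ge 0$ for every $\dot Y\in\mathbf{R}^{n\times r}$ such that $\mathrm{ddiag}(Y\dot Y^\top)=0$. *)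

theory Defs
  imports "HOL-Probability.Probability" "Jordan_Normal_Form.Matrix"
begin

(* The symbols $ and \<bullet> refer to the vectors of Jordan_Normal_Form below. *)
unbundle no vec_syntax
no_notation inner (infix "\<bullet>" 70)
hide_type (open) Finite_Cartesian_Product.vec
hide_const (open) Finite_Cartesian_Product.vec Finite_Cartesian_Product.transpose

section \<open>Matrices\<close>

definition ones_vec :: "nat \<Rightarrow> real vec" where
  "ones_vec n = vec n (\<lambda>_. 1)"

definition outer :: "real vec \<Rightarrow> real vec \<Rightarrow> real mat" where
  "outer x y = mat (dim_vec x) (dim_vec y) (\<lambda>(i, j). x $ i * y $ j)"

definition mtrace :: "real mat \<Rightarrow> real" where
  "mtrace A = (\<Sum>i<dim_row A. A $$ (i, i))"

definition frob :: "real mat \<Rightarrow> real mat \<Rightarrow> real" where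
  "frob A B = mtrace (A\<^sup>T * B)"

definition ddiag :: "real mat \<Rightarrow> real mat" where
  "ddiag A = mat_diag (dim_row A) (\<lambda>i. A $$ (i, i))"

section \<open>The stochastic block model\<close>

text \<open>
  One independent coin per unordered pair of vertices.  The vertices are \<open>0, \<dots>, n - 1\<close>.
  \<^const>\<open>bernoulli_pmf\<close> clips its parameter to \<open>[0, 1]\<close>, so this is the intended
  distribution whenever \<open>p\<close> and \<open>q\<close> lie in \<open>[0, 1]\<close>.
\<close>

definition edge_slots :: "nat \<Rightarrow> (nat \<times> nat) set" where
  "edge_slots n = {(i, j). i < j \<and> j < n}"

definition adjacency :: "nat \<Rightarrow> (nat \<times> nat \<Rightarrow> bool) \<Rightarrow> real mat" where
  "adjacency n e =
     mat n n (\<lambda>(i, j). if i \<noteq> j \<and> e (min i j, max i j) then 1 else 0)"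

definition sbm :: "nat \<Rightarrow> real \<Rightarrow> real \<Rightarrow> real vec \<Rightarrow> real mat pmf" where
  "sbm n p q z =
     map_pmf (adjacency n)
       (Pi_pmf (edge_slots n) False
         (\<lambda>(i, j). bernoulli_pmf (if z $ i = z $ j then p else q)))"

lemma prob_sbm_entry:
  assumes "0 \<le> p" "p \<le> 1" "0 \<le> q" "q \<le> 1" "i < j" "j < n"
  shows "measure_pmf.prob (sbm n p q z) {A. A $$ (i, j) = 1} = (if z $ i = z $ j then p else q)"
proof -
  let ?b = "\<lambda>(i, j). bernoulli_pmf (if z $ i = z $ j then p else q)"
  have fin: "finite (edge_slots n)"
    by (rule finite_subset[of _ "{..<n} \<times> {..<n}"]) (auto simp: edge_slots_def)
  have "measure_pmf.prob (sbm n p q z) {A. A $$ (i, j) = 1} =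
      measure_pmf.prob (map_pmf (\<lambda>e. e (i, j)) (Pi_pmf (edge_slots n) False ?b)) {True}"
    using assms by (auto simp: sbm_def adjacency_def vimage_def min_def max_def
       intro!: arg_cong[where f = "measure_pmf.prob _"])
  also have "map_pmf (\<lambda>e. e (i, j)) (Pi_pmf (edge_slots n) False ?b) = ?b (i, j)"
    using assms by (subst Pi_pmf_component[OF fin]) (auto simp: edge_slots_def)
  finally show ?thesis using assms by (simp add: measure_pmf_single)
qed

lemma indep_vars_map_pmf:
  assumes indep: "prob_space.indep_vars (measure_pmf P) (\<lambda>_. count_space UNIV) (\<lambda>i x. X i (f x)) I"
  shows "prob_space.indep_vars (measure_pmf (map_pmf f P)) (\<lambda>_. count_space UNIV) X I"
proof -
  note ps = measure_pmf.prob_space_axioms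
  have *: "measure_pmf.prob (map_pmf f P) (\<Inter>j\<in>J. A j) = (\<Prod>j\<in>J. measure_pmf.prob (map_pmf f P) (A j))"
    if J: "J \<subseteq> I" "J \<noteq> {}" "finite J" and A: "\<forall>j\<in>J. \<exists>B. A j = X j -` B" for J A
  proof -
    from bchoice[OF A] obtain B where B: "\<And>j. j \<in> J \<Longrightarrow> A j = X j -` B j" by blast
    have "measure_pmf.prob P (\<Inter>j\<in>J. (\<lambda>x. X j (f x)) -` B j \<inter> space P) =
        (\<Prod>j\<in>J. measure_pmf.prob P ((\<lambda>x. X j (f x)) -` B j \<inter> space P))"
      by (rule prob_space.indep_varsD[OF ps indep]) (use J in auto)
    moreover have "f -` (\<Inter>j\<in>J. A j) = (\<Inter>j\<in>J. (\<lambda>x. X j (f x)) -` B j)"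
      using B J by auto
    moreover have "f -` A j = (\<lambda>x. X j (f x)) -` B j" if "j \<in> J" for j
      using B that by auto
    ultimately show ?thesis by simp
  qed
  show ?thesis
    unfolding prob_space.indep_vars_def2[OF ps] prob_space.indep_sets_def[OF ps]
  proof (intro conjI ballI allI impI)
    fix J A
    assume "J \<subseteq> I" "J \<noteq> {}" "finite J"
      and A: "A \<in> (\<Pi> j\<in>J. {X j -` B \<inter> space (map_pmf f P) |B. B \<in> sets (count_space UNIV)})"
    moreover have "\<forall>j\<in>J. \<exists>B. A j = X j -` B" using A by (simp add: Pi_iff)
    ultimately show "measure_pmf.prob (map_pmf f P) (\<Inter>j\<in>J. A j) =
        (\<Prod>j\<in>J. measure_pmf.prob (map_pmf f P) (A j))"
      using * by blast
  qed auto
qed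

lemma indep_sbm_entries:
  "prob_space.indep_vars (measure_pmf (sbm n p q z)) (\<lambda>_. count_space UNIV)
     (\<lambda>(i, j) A. A $$ (i, j)) (edge_slots n)"
proof -
  note ps = measure_pmf.prob_space_axioms
  let ?P = "Pi_pmf (edge_slots n) False (\<lambda>(i, j). bernoulli_pmf (if z $ i = z $ j then p else q))"
  let ?g = "\<lambda>b. if b then 1 else 0 :: real"
  have fin: "finite (edge_slots n)"
    by (rule finite_subset[of _ "{..<n} \<times> {..<n}"]) (auto simp: edge_slots_def)
  have "prob_space.indep_vars (measure_pmf ?P) (\<lambda>_. count_space UNIV) (\<lambda>x e. ?g (e x)) (edge_slots n)"
    by (rule prob_space.indep_vars_compose2[OF ps indep_vars_Pi_pmf[OF fin]]) auto
  also have "?this \<longleftrightarrow> prob_space.indep_vars (measure_pmf ?P) (\<lambda>_. count_space UNIV)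
      (\<lambda>x e. (case x of (i, j) \<Rightarrow> \<lambda>A. A $$ (i, j)) (adjacency n e)) (edge_slots n)"
    by (rule prob_space.indep_vars_cong[OF ps refl _ refl])
       (simp add: edge_slots_def adjacency_def split: prod.splits)
  finally show ?thesis unfolding sbm_def by (rule indep_vars_map_pmf)
qed

section \<open>Optimization on a product of spheres\<close>

definition feasible :: "nat \<Rightarrow> nat \<Rightarrow> real mat set" where
  "feasible n r = {Y \<in> carrier_mat n r. ddiag (Y * Y\<^sup>T) = 1\<^sub>m n}"

text \<open>
  The tangent space at \<open>Y\<close> is the kernel of the differential
  \<open>V \<mapsto> ddiag (Y V\<^sup>T + V Y\<^sup>T) = 2 ddiag (Y V\<^sup>T)\<close> of the constraint, and
  \<open>tangent_proj Y\<close> is the orthogonal projection onto it.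
\<close>

definition tangent_space :: "real mat \<Rightarrow> real mat set" where
  "tangent_space Y =
     {V \<in> carrier_mat (dim_row Y) (dim_col Y).
        ddiag (Y * V\<^sup>T) = 0\<^sub>m (dim_row Y) (dim_row Y)}"

definition tangent_proj :: "real mat \<Rightarrow> real mat \<Rightarrow> real mat" where
  "tangent_proj Y Z = Z - ddiag (Z * Y\<^sup>T) * Y"

definition unit_matrix :: "nat \<Rightarrow> nat \<Rightarrow> nat \<Rightarrow> nat \<Rightarrow> real mat" where
  "unit_matrix n r i j = mat n r (\<lambda>(k, l). if k = i \<and> l = j then 1 else 0)"

text \<open>
  The next definitions are meant for functions and fields that are smooth on the whole space of
  matrices.
\<close>

definition eucl_grad :: "(real mat \<Rightarrow> real) \<Rightarrow> real mat \<Rightarrow> real mat" where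
  "eucl_grad f Y =
     mat (dim_row Y) (dim_col Y)
       (\<lambda>(i, j). deriv (\<lambda>t. f (Y + t \<cdot>\<^sub>m unit_matrix (dim_row Y) (dim_col Y) i j)) 0)"

definition field_deriv :: "(real mat \<Rightarrow> real mat) \<Rightarrow> real mat \<Rightarrow> real mat \<Rightarrow> real mat" where
  "field_deriv F Y V =
     mat (dim_row Y) (dim_col Y) (\<lambda>(i, j). deriv (\<lambda>t. F (Y + t \<cdot>\<^sub>m V) $$ (i, j)) 0)"

definition riem_grad :: "(real mat \<Rightarrow> real) \<Rightarrow> real mat \<Rightarrow> real mat" where
  "riem_grad f Y = tangent_proj Y (eucl_grad f Y)"

text \<open>
  The Levi-Civita connection of an embedded submanifold is the tangential part of the ambient
  derivative of a smooth extension of the field.  The formula for \<^const>\<open>riem_grad\<close> makes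
  sense off the manifold too, and so provides such an extension of the gradient field.
\<close>

definition riem_hess :: "(real mat \<Rightarrow> real) \<Rightarrow> real mat \<Rightarrow> real mat \<Rightarrow> real mat" where
  "riem_hess f Y V = tangent_proj Y (field_deriv (riem_grad f) Y V)"

definition second_order_critical :: "nat \<Rightarrow> nat \<Rightarrow> (real mat \<Rightarrow> real) \<Rightarrow> real mat \<Rightarrow> bool" where
  "second_order_critical n r f Y \<longleftrightarrow>
     Y \<in> feasible n r \<and>
     riem_grad f Y = 0\<^sub>m n r \<and>
     (\<forall>V \<in> tangent_space Y. frob V (riem_hess f Y V) \<le> 0)"

definition objective :: "real mat \<Rightarrow> real mat \<Rightarrow> real" where
  "objective C Y = frob C (Y * Y\<^sup>T)"

subsection \<open>Criticality for the quadratic objective\<close>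

lemma ddiag_index [simp]:
  "i < dim_row A \<Longrightarrow> j < dim_row A \<Longrightarrow> ddiag A $$ (i, j) = (if i = j then A $$ (i, i) else 0)"
  "dim_row (ddiag A) = dim_row A" "dim_col (ddiag A) = dim_row A"
  by (auto simp: ddiag_def mat_diag_def)

lemma ddiag_mult_index:
  assumes "A \<in> carrier_mat n n" "Y \<in> carrier_mat n r" "i < n" "j < r"
  shows "(ddiag A * Y) $$ (i, j) = A $$ (i, i) * Y $$ (i, j)"
  using assms by (auto simp: ddiag_def mat_diag_mult_left)

lemma mult_transpose_index:
  assumes "X \<in> carrier_mat n r" "Y \<in> carrier_mat n r" "i < n" "k < n"
  shows "(X * Y\<^sup>T) $$ (i, k) = (\<Sum>j<r. X $$ (i, j) * Y $$ (k, j))"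
  using assms by (auto simp: scalar_prod_def atLeast0LessThan)

lemma mult_mat_index:
  assumes "C \<in> carrier_mat n n" "Y \<in> carrier_mat n r" "i < n" "j < r"
  shows "(C * Y) $$ (i, j) = (\<Sum>k<n. C $$ (i, k) * Y $$ (k, j))"
  using assms by (auto simp: scalar_prod_def atLeast0LessThan)

lemma frob_eq_sum:
  assumes "A \<in> carrier_mat n r" "B \<in> carrier_mat n r"
  shows "frob A B = (\<Sum>i<n. \<Sum>j<r. A $$ (i, j) * B $$ (i, j))"
proof -
  have "frob A B = (\<Sum>j<r. \<Sum>i<n. A $$ (i, j) * B $$ (i, j))"
    using assms by (auto simp: frob_def mtrace_def scalar_prod_def atLeast0LessThan)
  also have "\<dots> = (\<Sum>i<n. \<Sum>j<r. A $$ (i, j) * B $$ (i, j))" by (rule sum.swap)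
  finally show ?thesis .
qed

lemma tangent_proj_index:
  assumes "Y \<in> carrier_mat n r" "Z \<in> carrier_mat n r" "i < n" "j < r"
  shows "tangent_proj Y Z $$ (i, j) = Z $$ (i, j) - (\<Sum>l<r. Z $$ (i, l) * Y $$ (i, l)) * Y $$ (i, j)"
proof -
  have Z: "Z * Y\<^sup>T \<in> carrier_mat n n" using assms by (intro mult_carrier_mat[of _ n r]) auto
  have "tangent_proj Y Z $$ (i, j) = Z $$ (i, j) - (ddiag (Z * Y\<^sup>T) * Y) $$ (i, j)"
    unfolding tangent_proj_def using assms Z by (intro index_minus_mat) auto
  also have "(ddiag (Z * Y\<^sup>T) * Y) $$ (i, j) = (Z * Y\<^sup>T) $$ (i, i) * Y $$ (i, j)"
    by (rule ddiag_mult_index[OF Z assms(1,3,4)])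
  also have "(Z * Y\<^sup>T) $$ (i, i) = (\<Sum>l<r. Z $$ (i, l) * Y $$ (i, l))"
    by (rule mult_transpose_index[OF assms(2,1,3,3)])
  finally show ?thesis .
qed

lemma tangent_proj_carrier:
  "Y \<in> carrier_mat n r \<Longrightarrow> Z \<in> carrier_mat n r \<Longrightarrow> tangent_proj Y Z \<in> carrier_mat n r"
  by (auto simp: tangent_proj_def)

lemma tangent_space_iff:
  assumes "Y \<in> carrier_mat n r"
  shows "V \<in> tangent_space Y \<longleftrightarrow>
    V \<in> carrier_mat n r \<and> (\<forall>i<n. (\<Sum>j<r. Y $$ (i, j) * V $$ (i, j)) = 0)"
proof (cases "V \<in> carrier_mat n r")
  case True
  have "ddiag (Y * V\<^sup>T) = 0\<^sub>m n n \<longleftrightarrow> (\<forall>i<n. (Y * V\<^sup>T) $$ (i, i) = 0)"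
  proof
    assume *: "ddiag (Y * V\<^sup>T) = 0\<^sub>m n n"
    show "\<forall>i<n. (Y * V\<^sup>T) $$ (i, i) = 0"
    proof (intro allI impI)
      fix i assume "i < n"
      then have "(Y * V\<^sup>T) $$ (i, i) = ddiag (Y * V\<^sup>T) $$ (i, i)"
        using assms by (subst ddiag_index) auto
      then show "(Y * V\<^sup>T) $$ (i, i) = 0" using * \<open>i < n\<close> by simp
    qed
  next
    assume "\<forall>i<n. (Y * V\<^sup>T) $$ (i, i) = 0"
    then show "ddiag (Y * V\<^sup>T) = 0\<^sub>m n n"
      using assms by (intro eq_matI) (auto simp del: index_mult_mat(1))
  qed
  then show ?thesis using True assms
    by (auto simp: tangent_space_def mult_transpose_index[of _ n r] simp del: index_mult_mat(1))
qed (use assms in \<open>auto simp: tangent_space_def\<close>)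

lemma feasible_iff:
  "Y \<in> feasible n r \<longleftrightarrow> Y \<in> carrier_mat n r \<and> (\<forall>i<n. (\<Sum>j<r. (Y $$ (i, j))\<^sup>2) = 1)"
proof (cases "Y \<in> carrier_mat n r")
  case True
  have "ddiag (Y * Y\<^sup>T) = 1\<^sub>m n \<longleftrightarrow> (\<forall>i<n. (Y * Y\<^sup>T) $$ (i, i) = 1)"
  proof
    assume *: "ddiag (Y * Y\<^sup>T) = 1\<^sub>m n"
    show "\<forall>i<n. (Y * Y\<^sup>T) $$ (i, i) = 1"
    proof (intro allI impI)
      fix i assume "i < n"
      then have "(Y * Y\<^sup>T) $$ (i, i) = ddiag (Y * Y\<^sup>T) $$ (i, i)"
        using True by (subst ddiag_index) auto
      then show "(Y * Y\<^sup>T) $$ (i, i) = 1" using * \<open>i < n\<close> by simp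
    qed
  next
    assume "\<forall>i<n. (Y * Y\<^sup>T) $$ (i, i) = 1"
    then show "ddiag (Y * Y\<^sup>T) = 1\<^sub>m n"
      using True by (intro eq_matI) (auto simp del: index_mult_mat(1))
  qed
  then show ?thesis using True
    by (auto simp: feasible_def mult_transpose_index[of _ n r] power2_eq_square simp del: index_mult_mat(1))
qed (auto simp: feasible_def)

lemma tangent_proj_mem:
  assumes "Y \<in> feasible n r" "Z \<in> carrier_mat n r"
  shows "tangent_proj Y Z \<in> tangent_space Y"
proof -
  have Y: "Y \<in> carrier_mat n r" using assms by (simp add: feasible_iff)
  have "(\<Sum>j<r. Y $$ (i, j) * tangent_proj Y Z $$ (i, j)) = 0" if i: "i < n" for i
  proof -
    let ?s = "\<Sum>l<r. Z $$ (i, l) * Y $$ (i, l)"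
    have "(\<Sum>j<r. Y $$ (i, j) * tangent_proj Y Z $$ (i, j)) =
        (\<Sum>j<r. Z $$ (i, j) * Y $$ (i, j) - ?s * (Y $$ (i, j))\<^sup>2)"
      by (rule sum.cong)
        (use Y assms i in \<open>auto simp: tangent_proj_index[of _ n r] power2_eq_square algebra_simps\<close>)
    also have "\<dots> = ?s - ?s * (\<Sum>j<r. (Y $$ (i, j))\<^sup>2)"
      by (simp add: sum_subtractf sum_distrib_left)
    finally show ?thesis using assms i by (simp add: feasible_iff)
  qed
  then show ?thesis using tangent_proj_carrier[OF Y assms(2)] by (simp add: tangent_space_iff[OF Y])
qed

lemma frob_tangent_proj:
  assumes "Y \<in> carrier_mat n r" "V \<in> tangent_space Y" "Z \<in> carrier_mat n r"
  shows "frob V (tangent_proj Y Z) = frob V Z"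
proof -
  have V: "V \<in> carrier_mat n r" "\<And>i. i < n \<Longrightarrow> (\<Sum>j<r. Y $$ (i, j) * V $$ (i, j)) = 0"
    using assms by (auto simp: tangent_space_iff[OF assms(1)])
  have "(\<Sum>j<r. V $$ (i, j) * tangent_proj Y Z $$ (i, j)) = (\<Sum>j<r. V $$ (i, j) * Z $$ (i, j))"
    if i: "i < n" for i
  proof -
    let ?s = "\<Sum>l<r. Z $$ (i, l) * Y $$ (i, l)"
    have "(\<Sum>j<r. V $$ (i, j) * tangent_proj Y Z $$ (i, j)) =
        (\<Sum>j<r. V $$ (i, j) * Z $$ (i, j) - ?s * (Y $$ (i, j) * V $$ (i, j)))"
      by (rule sum.cong)
        (use V assms i in \<open>auto simp: tangent_proj_index[of _ n r] algebra_simps\<close>)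
    then show ?thesis using V(2)[OF i] by (simp add: sum_subtractf flip: sum_distrib_left)
  qed
  then show ?thesis using assms V
    by (simp add: frob_eq_sum[of _ n r] tangent_proj_carrier)
qed

lemma frob_mult_eq:
  assumes "C \<in> carrier_mat n n" "X \<in> carrier_mat n r" "Y \<in> carrier_mat n r"
  shows "frob (C * X) Y = (\<Sum>i<n. \<Sum>k<n. C $$ (i, k) * (\<Sum>j<r. Y $$ (i, j) * X $$ (k, j)))"
proof -
  have "C * X \<in> carrier_mat n r" by (rule mult_carrier_mat[OF assms(1,2)])
  then have "frob (C * X) Y = (\<Sum>i<n. \<Sum>j<r. (C * X) $$ (i, j) * Y $$ (i, j))"
    by (rule frob_eq_sum[OF _ assms(3)])
  also have "\<dots> = (\<Sum>i<n. \<Sum>k<n. C $$ (i, k) * (\<Sum>j<r. Y $$ (i, j) * X $$ (k, j)))"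
  proof (rule sum.cong[OF refl])
    fix i assume "i \<in> {..<n}"
    then have "(\<Sum>j<r. (C * X) $$ (i, j) * Y $$ (i, j)) =
        (\<Sum>j<r. \<Sum>k<n. C $$ (i, k) * (Y $$ (i, j) * X $$ (k, j)))"
      by (intro sum.cong refl)
        (simp add: mult_mat_index[OF assms(1,2)] sum_distrib_left sum_distrib_right mult_ac
          del: index_mult_mat(1))
    also have "\<dots> = (\<Sum>k<n. C $$ (i, k) * (\<Sum>j<r. Y $$ (i, j) * X $$ (k, j)))"
      unfolding sum_distrib_left by (rule sum.swap)
    finally show "(\<Sum>j<r. (C * X) $$ (i, j) * Y $$ (i, j)) =
        (\<Sum>k<n. C $$ (i, k) * (\<Sum>j<r. Y $$ (i, j) * X $$ (k, j)))" .
  qed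
  finally show ?thesis .
qed

lemma objective_eq:
  assumes "C \<in> carrier_mat n n" "Y \<in> carrier_mat n r"
  shows "objective C Y = frob (C * Y) Y"
proof -
  have "Y * Y\<^sup>T \<in> carrier_mat n n" using assms by auto
  from frob_eq_sum[OF assms(1) this] show ?thesis
    unfolding objective_def frob_mult_eq[OF assms assms(2)]
    by (simp add: mult_transpose_index[OF assms(2,2)] del: index_mult_mat(1))
qed

lemma frob_symmetric_form:
  assumes C: "C \<in> carrier_mat n n" "C\<^sup>T = C" and X: "X \<in> carrier_mat n r" and Y: "Y \<in> carrier_mat n r"
  shows "frob (C * X) Y = frob (C * Y) X"
proof -
  have sym: "C $$ (k, i) = C $$ (i, k)" if "i < n" "k < n" for i k
  proof -
    have "C\<^sup>T $$ (i, k) = C $$ (k, i)" using C(1) that by simp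
    then show ?thesis by (simp only: C(2))
  qed
  have "frob (C * X) Y = (\<Sum>k<n. \<Sum>i<n. C $$ (i, k) * (\<Sum>j<r. Y $$ (i, j) * X $$ (k, j)))"
    unfolding frob_mult_eq[OF C(1) X Y] by (rule sum.swap)
  also have "\<dots> = (\<Sum>k<n. \<Sum>i<n. C $$ (k, i) * (\<Sum>j<r. X $$ (k, j) * Y $$ (i, j)))"
  proof (rule sum.cong[OF refl], rule sum.cong[OF refl])
    fix k i assume "k \<in> {..<n}" "i \<in> {..<n}"
    then have "C $$ (i, k) = C $$ (k, i)" using sym by blast
    then show "C $$ (i, k) * (\<Sum>j<r. Y $$ (i, j) * X $$ (k, j)) =
        C $$ (k, i) * (\<Sum>j<r. X $$ (k, j) * Y $$ (i, j))"
      by (simp only: mult.commute)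
  qed
  also have "\<dots> = frob (C * Y) X" by (rule frob_mult_eq[OF C(1) Y X, symmetric])
  finally show ?thesis .
qed

lemma frob_add_right:
  "A \<in> carrier_mat n r \<Longrightarrow> B \<in> carrier_mat n r \<Longrightarrow> B' \<in> carrier_mat n r \<Longrightarrow>
   frob A (B + B') = frob A B + frob A B'"
  by (simp add: frob_eq_sum[of _ n r] algebra_simps sum.distrib)

lemma frob_commute:
  "A \<in> carrier_mat n r \<Longrightarrow> B \<in> carrier_mat n r \<Longrightarrow> frob A B = frob B A"
  by (simp add: frob_eq_sum[of _ n r] algebra_simps)

lemma frob_smult_right:
  "A \<in> carrier_mat n r \<Longrightarrow> B \<in> carrier_mat n r \<Longrightarrow> frob A (c \<cdot>\<^sub>m B) = c * frob A B"
  by (simp add: frob_eq_sum[of _ n r] sum_distrib_left algebra_simps)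

lemma objective_line:
  assumes C: "C \<in> carrier_mat n n" "C\<^sup>T = C" and Y: "Y \<in> carrier_mat n r" and V: "V \<in> carrier_mat n r"
  shows "objective C (Y + t \<cdot>\<^sub>m V) = objective C Y + 2 * frob (C * Y) V * t + objective C V * t\<^sup>2"
proof -
  have c [simp]: "C * X \<in> carrier_mat n r" if "X \<in> carrier_mat n r" for X
    using that C by auto
  let ?W = "Y + t \<cdot>\<^sub>m V"
  have W: "?W \<in> carrier_mat n r" using Y V by auto
  have "objective C ?W = frob (C * ?W) Y + t * frob (C * ?W) V"
    using W Y V by (simp add: objective_eq[OF C(1) W] frob_add_right[of _ n r] frob_smult_right[of _ n r])
  also have "frob (C * ?W) Y = frob (C * Y) Y + t * frob (C * Y) V"
    using W Y V
    by (simp add: frob_symmetric_form[OF C W Y] frob_add_right[of _ n r] frob_smult_right[of _ n r])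
  also have "frob (C * ?W) V = frob (C * V) Y + t * frob (C * V) V"
    using W Y V
    by (simp add: frob_symmetric_form[OF C W V] frob_add_right[of _ n r] frob_smult_right[of _ n r])
  also have "frob (C * V) Y = frob (C * Y) V" by (rule frob_symmetric_form[OF C V Y])
  finally show ?thesis
    by (simp add: objective_eq[OF C(1) Y] objective_eq[OF C(1) V] power2_eq_square algebra_simps)
qed

lemma eucl_grad_objective:
  assumes C: "C \<in> carrier_mat n n" "C\<^sup>T = C" and Y: "Y \<in> carrier_mat n r"
  shows "eucl_grad (objective C) Y = 2 \<cdot>\<^sub>m (C * Y)"
proof (rule eq_matI)
  fix i j assume "i < dim_row (2 \<cdot>\<^sub>m (C * Y))" "j < dim_col (2 \<cdot>\<^sub>m (C * Y))"
  then have ij: "i < n" "j < r" using C Y by auto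
  let ?E = "unit_matrix n r i j"
  have E: "?E \<in> carrier_mat n r" by (simp add: unit_matrix_def)
  have "((\<lambda>t. objective C (Y + t \<cdot>\<^sub>m ?E)) has_field_derivative 2 * frob (C * Y) ?E) (at 0)"
    unfolding objective_line[OF C Y E] by (auto intro!: derivative_eq_intros)
  then have "eucl_grad (objective C) Y $$ (i, j) = 2 * frob (C * Y) ?E"
    using Y ij by (auto simp: eucl_grad_def DERIV_imp_deriv)
  also have "frob (C * Y) ?E =
      (\<Sum>k<n. \<Sum>l<r. (C * Y) $$ (k, l) * (if k = i \<and> l = j then 1 else 0))"
    using C Y E by (subst frob_eq_sum[of _ n r]) (auto simp: unit_matrix_def)
  also have "\<dots> = (\<Sum>k<n. if k = i then (C * Y) $$ (k, j) else 0)"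
  proof (rule sum.cong[OF refl])
    fix k
    have "(\<Sum>l<r. (C * Y) $$ (k, l) * (if k = i \<and> l = j then 1 else 0)) =
        (\<Sum>l<r. if l = j then (if k = i then (C * Y) $$ (k, l) else 0) else 0)"
      by (rule sum.cong) (simp_all del: index_mult_mat(1))
    also have "\<dots> = (if k = i then (C * Y) $$ (k, j) else 0)"
      using ij by (subst sum.delta) auto
    finally show "(\<Sum>l<r. (C * Y) $$ (k, l) * (if k = i \<and> l = j then 1 else 0)) =
        (if k = i then (C * Y) $$ (k, j) else 0)" .
  qed
  also have "\<dots> = (C * Y) $$ (i, j)"
    using ij by (subst sum.delta) auto
  finally show "eucl_grad (objective C) Y $$ (i, j) = (2 \<cdot>\<^sub>m (C * Y)) $$ (i, j)"
    using C Y ij by (simp del: index_mult_mat(1))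
qed (use C Y in \<open>auto simp: eucl_grad_def\<close>)

definition slack :: "real mat \<Rightarrow> real mat \<Rightarrow> real mat" where
  "slack C Y = ddiag (C * Y * Y\<^sup>T) - C"

lemma slack_mult_index:
  assumes C: "C \<in> carrier_mat n n" and Y: "Y \<in> carrier_mat n r" and X: "X \<in> carrier_mat n r"
    and ij: "i < n" "j < r"
  shows "(slack C Y * X) $$ (i, j) =
    (\<Sum>l<r. (C * Y) $$ (i, l) * Y $$ (i, l)) * X $$ (i, j) - (C * X) $$ (i, j)"
proof -
  have D: "ddiag (C * Y * Y\<^sup>T) \<in> carrier_mat n n" using C by auto
  have "slack C Y * X = ddiag (C * Y * Y\<^sup>T) * X - C * X"
    unfolding slack_def by (rule minus_mult_distrib_mat[OF D C X])
  moreover have "(ddiag (C * Y * Y\<^sup>T) * X) $$ (i, j) = (C * Y * Y\<^sup>T) $$ (i, i) * X $$ (i, j)"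
    using C Y by (intro ddiag_mult_index[OF _ X ij]) auto
  moreover have "(C * Y * Y\<^sup>T) $$ (i, i) = (\<Sum>l<r. (C * Y) $$ (i, l) * Y $$ (i, l))"
    using C Y ij by (intro mult_transpose_index) auto
  ultimately show ?thesis using C X ij by (simp del: index_mult_mat(1))
qed

lemma riem_grad_objective:
  assumes C: "C \<in> carrier_mat n n" "C\<^sup>T = C" and Y: "Y \<in> carrier_mat n r"
  shows "riem_grad (objective C) Y = (- 2) \<cdot>\<^sub>m (slack C Y * Y)"
proof (rule eq_matI)
  fix i j assume "i < dim_row ((- 2) \<cdot>\<^sub>m (slack C Y * Y))" "j < dim_col ((- 2) \<cdot>\<^sub>m (slack C Y * Y))"
  then have ij: "i < n" "j < r" using C Y by (auto simp: slack_def)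
  have S: "dim_row (slack C Y) = n" using C by (simp add: slack_def)
  have *: "(2 \<cdot>\<^sub>m (C * Y)) $$ (i, l) = 2 * (C * Y) $$ (i, l)" if "l < r" for l
    using C Y ij that by (simp del: index_mult_mat(1))
  have "riem_grad (objective C) Y $$ (i, j) =
      2 * (C * Y) $$ (i, j) - (\<Sum>l<r. 2 * (C * Y) $$ (i, l) * Y $$ (i, l)) * Y $$ (i, j)"
    unfolding riem_grad_def eucl_grad_objective[OF C Y]
    using C Y ij by (subst tangent_proj_index[of _ n r]) (auto simp: * simp del: index_mult_mat(1) index_smult_mat(1))
  also have "\<dots> = - 2 * (slack C Y * Y) $$ (i, j)"
    unfolding slack_mult_index[OF C(1) Y Y ij]
    by (simp add: sum_distrib_left sum_negf algebra_simps)
  finally show "riem_grad (objective C) Y $$ (i, j) = ((- 2) \<cdot>\<^sub>m (slack C Y * Y)) $$ (i, j)"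
    using Y ij S by (simp del: index_mult_mat(1))
qed (use C Y in \<open>auto simp: riem_grad_def slack_def tangent_proj_def eucl_grad_def\<close>)

lemma field_deriv_riem_grad_objective:
  assumes C: "C \<in> carrier_mat n n" "C\<^sup>T = C" and Y: "Y \<in> carrier_mat n r" and V: "V \<in> carrier_mat n r"
    and ij: "i < n" "j < r"
  shows "field_deriv (riem_grad (objective C)) Y V $$ (i, j) =
    - 2 * (slack C Y * V) $$ (i, j)
    - 2 * (\<Sum>l<r. (C * Y) $$ (i, l) * V $$ (i, l) + (C * V) $$ (i, l) * Y $$ (i, l)) * Y $$ (i, j)"
proof -
  have lin: "(C * (Y + t \<cdot>\<^sub>m V)) $$ (i, l) = (C * Y) $$ (i, l) + t * (C * V) $$ (i, l)" if "l < r" for t l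
  proof -
    have "C * (Y + t \<cdot>\<^sub>m V) = C * Y + t \<cdot>\<^sub>m (C * V)"
      using C Y V by (simp add: mult_add_distrib_mat[of _ n n _ r] mult_smult_distrib[of _ n n _ r])
    then show ?thesis using C Y V ij that by (simp del: index_mult_mat(1))
  qed
  have S: "dim_row (slack C X) = n" for X using C by (simp add: slack_def)
  have g: "riem_grad (objective C) (Y + t \<cdot>\<^sub>m V) $$ (i, j) =
      - 2 * ((\<Sum>l<r. ((C * Y) $$ (i, l) + t * (C * V) $$ (i, l)) * (Y $$ (i, l) + t * V $$ (i, l)))
              * (Y $$ (i, j) + t * V $$ (i, j)) - ((C * Y) $$ (i, j) + t * (C * V) $$ (i, j)))" for t
  proof -
    let ?W = "Y + t \<cdot>\<^sub>m V"
    have W: "?W \<in> carrier_mat n r" using Y V by auto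
    have "riem_grad (objective C) ?W $$ (i, j) = - 2 * (slack C ?W * ?W) $$ (i, j)"
      unfolding riem_grad_objective[OF C W] using S W V ij by (simp del: index_mult_mat(1))
    then show ?thesis
      using Y V ij by (simp add: slack_mult_index[OF C(1) W W ij] lin del: index_mult_mat(1))
  qed
  have "((\<lambda>t. riem_grad (objective C) (Y + t \<cdot>\<^sub>m V) $$ (i, j)) has_field_derivative
      - 2 * (slack C Y * V) $$ (i, j)
      - 2 * (\<Sum>l<r. (C * Y) $$ (i, l) * V $$ (i, l) + (C * V) $$ (i, l) * Y $$ (i, l)) * Y $$ (i, j)) (at 0)"
    unfolding g slack_mult_index[OF C(1) Y V ij]
    by (auto intro!: derivative_eq_intros simp: algebra_simps simp del: index_mult_mat(1))
  then show ?thesis using Y ij by (auto simp: field_deriv_def DERIV_imp_deriv)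
qed

lemma frob_riem_hess_objective:
  assumes C: "C \<in> carrier_mat n n" "C\<^sup>T = C" and Y: "Y \<in> carrier_mat n r" and V: "V \<in> tangent_space Y"
  shows "frob V (riem_hess (objective C) Y V) = - 2 * frob (slack C Y) (V * V\<^sup>T)"
proof -
  let ?D = "field_deriv (riem_grad (objective C)) Y V"
  have V': "V \<in> carrier_mat n r" "\<And>i. i < n \<Longrightarrow> (\<Sum>j<r. Y $$ (i, j) * V $$ (i, j)) = 0"
    using V by (auto simp: tangent_space_iff[OF Y])
  have D: "?D \<in> carrier_mat n r" using Y by (auto simp: field_deriv_def)
  have S: "slack C Y \<in> carrier_mat n n" using C unfolding slack_def by auto
  have "(\<Sum>j<r. V $$ (i, j) * ?D $$ (i, j)) = (\<Sum>j<r. - 2 * ((slack C Y * V) $$ (i, j) * V $$ (i, j)))"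
    if i: "i < n" for i
  proof -
    define s where "s = (\<Sum>l<r. (C * Y) $$ (i, l) * V $$ (i, l) + (C * V) $$ (i, l) * Y $$ (i, l))"
    have fd: "?D $$ (i, j) = - 2 * (slack C Y * V) $$ (i, j) - 2 * s * Y $$ (i, j)" if "j < r" for j
      unfolding s_def by (rule field_deriv_riem_grad_objective[OF C Y V'(1) i that])
    have "(\<Sum>j<r. V $$ (i, j) * ?D $$ (i, j)) =
        (\<Sum>j<r. - 2 * ((slack C Y * V) $$ (i, j) * V $$ (i, j)) - 2 * s * (Y $$ (i, j) * V $$ (i, j)))"
      by (rule sum.cong)
         (simp_all add: fd algebra_simps del: index_mult_mat(1))
    then show ?thesis using V'(2)[OF i]
      by (simp add: sum_subtractf sum_negf flip: sum_distrib_left del: index_mult_mat(1))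
  qed
  then have "frob V ?D = - 2 * frob (slack C Y * V) V"
    using S D V'(1)
    by (simp add: frob_eq_sum[of _ n r] sum_distrib_left sum_negf del: index_mult_mat(1))
  also have "frob (slack C Y * V) V = frob (slack C Y) (V * V\<^sup>T)"
    using objective_eq[OF S V'(1)] by (simp add: objective_def)
  finally show ?thesis unfolding riem_hess_def frob_tangent_proj[OF Y V D] .
qed

theorem second_order_critical_iff:
  assumes C: "C \<in> carrier_mat n n" "C\<^sup>T = C"
  shows "second_order_critical n r (objective C) Y \<longleftrightarrow>
    Y \<in> feasible n r \<and> slack C Y * Y = 0\<^sub>m n r \<and>
    (\<forall>V \<in> tangent_space Y. frob (slack C Y) (V * V\<^sup>T) \<ge> 0)"
proof (cases "Y \<in> feasible n r")
  case True
  then have Y: "Y \<in> carrier_mat n r" by (simp add: feasible_iff)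
  have S: "slack C Y * Y \<in> carrier_mat n r" using C Y by (auto simp: slack_def)
  have "(- 2 :: real) \<cdot>\<^sub>m X = 0\<^sub>m n r \<longleftrightarrow> X = 0\<^sub>m n r" if "X \<in> carrier_mat n r" for X :: "real mat"
    using that by (auto simp: mat_eq_iff)
  from this[OF S] show ?thesis using True
    by (auto simp: second_order_critical_def riem_grad_objective[OF C Y] frob_riem_hess_objective[OF C Y])
qed (simp add: second_order_critical_def)

end

theory Submission
  imports Defs "HOL-Real_Asymp.Real_Asymp"
begin

text \<open>
Put \<open>S = ddiag (C z z\<^sup>T) - C\<close>.  This matrix kills \<open>z\<close>, and the theorem holds as soon as the
quotient of its largest and smallest eigenvalues on the complement of \<open>z\<close> is less than about
\<open>r / 2\<close>.  To see this, test the second-order condition at \<open>Y\<close> with the tangent directions obtained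
by choosing one basis vector \<open>e\<^sub>k\<close> of \<open>\<real>\<^sup>r\<close>, projecting it at every row of \<open>Y\<close> to the tangent space
of the sphere there and multiplying by the label of the row.  Summed over \<open>k\<close>, the conditions say
\<open>(r - 1) \<langle>S, G\<rangle> \<le> \<langle>S, zz\<^sup>T \<circ> G \<circ> G\<rangle>\<close> for \<open>G = YY\<^sup>T\<close>, where \<open>\<circ>\<close> is the entrywise product.  With
\<open>g\<^sub>i\<^sub>j = z\<^sub>i z\<^sub>j G\<^sub>i\<^sub>j\<close>, eigenvalue bounds turn the left side into \<open>\<Sum> (1 - g\<^sub>i\<^sub>j)\<close> and the right side
into \<open>\<Sum> (1 - g\<^sub>i\<^sub>j\<^sup>2)\<close>, and the second sum is at most twice the first.  If \<open>r\<close> is large, all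
\<open>g\<^sub>i\<^sub>j\<close> equal 1, so the rows of \<open>Y\<close> agree up to the labels.

It remains to bound that quotient by a constant for a random graph with expected degrees of
order \<open>d = log n\<close>.  On the complement of \<open>z\<close>, \<open>S\<close> is the diagonal matrix of the margins
(neighbours in the own block minus neighbours in the other block) minus \<open>W = A - E A\<close>, up to terms
of order \<open>\<parallel>W\<parallel> + p\<close>.  All margins are at most \<open>O(d)\<close>, and \<open>sqrt a - sqrt b > sqrt 2\<close> is
exactly what makes them all at least a small multiple of \<open>d\<close> (a Chernoff bound with the tilt
\<open>sqrt (a / b)\<close>).  So it is enough that \<open>\<parallel>W\<parallel> \<le> \<epsilon> d\<close> for a prescribed \<open>\<epsilon> > 0\<close>.  This is weaker
than the true order \<open>sqrt d\<close> and has a short proof in the spirit of Kahn and Szemeredi: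
rounding reduces the bound to the exponentially many integer vectors \<open>m\<close> with
\<open>\<Sum> m\<^sub>i\<^sup>2 \<le> 36 n\<close>.  The coordinates with \<open>m\<^sub>i\<^sup>2\<close> at most a small multiple of \<open>d\<close> are handled by
Chernoff and a union bound.  The other coordinates are so few that, since small vertex sets span
few edges, the graph formed by the edges that touch them can be dismantled by
removing vertices of degree at most a small multiple of \<open>d\<close> one at a time; together with the bound
on all degrees this controls the form on these edges.
\<close>

section \<open>Landscape of a cost matrix with a well-conditioned certificate\<close>

definition quad_form :: "nat \<Rightarrow> (nat \<Rightarrow> nat \<Rightarrow> real) \<Rightarrow> (nat \<Rightarrow> real) \<Rightarrow> real" where
  "quad_form n M x = (\<Sum>i<n. \<Sum>j<n. M i j * (x i * x j))"

text \<open>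
The quadratic form \<open>x\<^sup>T S x\<close> of the dual certificate \<open>S = ddiag (C s s\<^sup>T) - C\<close> of the labelling \<open>s\<close>.
\<close>

definition cert_form ::
  "nat \<Rightarrow> (nat \<Rightarrow> nat \<Rightarrow> real) \<Rightarrow> (nat \<Rightarrow> real) \<Rightarrow> (nat \<Rightarrow> real) \<Rightarrow> real" where
  "cert_form n C s x = (\<Sum>i<n. (\<Sum>j<n. C i j * (s i * s j)) * (x i)\<^sup>2) - quad_form n C x"

text \<open>
The squared distance from \<open>x\<close> to the line spanned by \<open>s\<close>, if the entries of \<open>s\<close> are signs.
\<close>

definition spread :: "nat \<Rightarrow> (nat \<Rightarrow> real) \<Rightarrow> (nat \<Rightarrow> real) \<Rightarrow> real" where
  "spread n s x = (\<Sum>i<n. (x i)\<^sup>2) - (\<Sum>i<n. s i * x i)\<^sup>2 / real n"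

text \<open>
After the change of signs \<open>x\<^sub>i \<leadsto> s\<^sub>i x\<^sub>i\<close> the certificate is the Laplacian of a graph with signed weights.
In this form its invariance under \<open>x \<leadsto> x + t s\<close> is visible.
\<close>

lemma cert_form_eq_dirichlet:
  assumes C: "\<And>i j. i < n \<Longrightarrow> j < n \<Longrightarrow> C i j = C j i"
    and s: "\<And>i. i < n \<Longrightarrow> (s i)\<^sup>2 = 1"
  shows "cert_form n C s x =
    (\<Sum>i<n. \<Sum>j<n. C i j * (s i * s j) * (s i * x i - s j * x j)\<^sup>2) / 2"
proof -
  let ?D = "\<Sum>i<n. \<Sum>j<n. C i j * (s i * s j) * (x i)\<^sup>2"
  have "(\<Sum>i<n. \<Sum>j<n. C i j * (s i * s j) * (s i * x i - s j * x j)\<^sup>2) =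
      (\<Sum>i<n. \<Sum>j<n. C i j * (s i * s j) * (x i)\<^sup>2 + C j i * (s j * s i) * (x j)\<^sup>2
          - 2 * (C i j * (x i * x j)))"
  proof (intro sum.cong refl)
    fix i j assume "i \<in> {..<n}" "j \<in> {..<n}"
    then have ij: "i < n" "j < n" by auto
    have "(s i * s j) * (s i * x i - s j * x j)\<^sup>2 =
        (s i * s j) * ((s i)\<^sup>2 * (x i)\<^sup>2 + (s j)\<^sup>2 * (x j)\<^sup>2)
          - 2 * ((s i)\<^sup>2 * (s j)\<^sup>2) * (x i * x j)"
      by (simp add: power2_eq_square algebra_simps)
    also have "\<dots> = (s i * s j) * ((x i)\<^sup>2 + (x j)\<^sup>2) - 2 * (x i * x j)"
      using s ij by simp
    finally have "C i j * (s i * s j) * (s i * x i - s j * x j)\<^sup>2 =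
        C i j * ((s i * s j) * ((x i)\<^sup>2 + (x j)\<^sup>2) - 2 * (x i * x j))"
      by (simp add: mult.assoc)
    then show "C i j * (s i * s j) * (s i * x i - s j * x j)\<^sup>2 =
        C i j * (s i * s j) * (x i)\<^sup>2 + C j i * (s j * s i) * (x j)\<^sup>2 - 2 * (C i j * (x i * x j))"
      using C[OF ij] by (simp add: algebra_simps)
  qed
  also have "\<dots> = ?D + (\<Sum>i<n. \<Sum>j<n. C j i * (s j * s i) * (x j)\<^sup>2) - 2 * quad_form n C x"
    by (simp add: sum.distrib sum_subtractf sum_distrib_left quad_form_def)
  also have "(\<Sum>i<n. \<Sum>j<n. C j i * (s j * s i) * (x j)\<^sup>2) = ?D"
    by (rule sum.swap)
  finally show ?thesis unfolding cert_form_def sum_distrib_right by simp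
qed

text \<open>
Both sides do not change when a multiple of \<open>s\<close> is added to \<open>x\<close>, so bounds on the complement of
\<open>s\<close> extend to all vectors.
\<close>

lemma cert_form_bounds_by_spread:
  assumes C: "\<And>i j. i < n \<Longrightarrow> j < n \<Longrightarrow> C i j = C j i"
    and s: "\<And>i. i < n \<Longrightarrow> (s i)\<^sup>2 = 1"
    and bounds: "\<And>x. (\<Sum>i<n. s i * x i) = 0 \<Longrightarrow>
      \<mu> * (\<Sum>i<n. (x i)\<^sup>2) \<le> cert_form n C s x \<and> cert_form n C s x \<le> \<Lambda> * (\<Sum>i<n. (x i)\<^sup>2)"
  shows "\<mu> * spread n s x \<le> cert_form n C s x" "cert_form n C s x \<le> \<Lambda> * spread n s x"
proof -
  define t where "t = (\<Sum>i<n. s i * x i) / real n"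
  define y where "y = (\<lambda>i. x i - t * s i)"
  have ss: "(\<Sum>i<n. s i * s i) = real n"
    using s by (simp add: power2_eq_square)
  have tn: "t * real n = (\<Sum>i<n. s i * x i)"
    by (cases "n = 0") (simp_all add: t_def)
  have orth: "(\<Sum>i<n. s i * y i) = 0"
  proof -
    have "(\<Sum>i<n. s i * y i) = (\<Sum>i<n. s i * x i) - t * (\<Sum>i<n. s i * s i)"
      by (simp add: y_def algebra_simps sum_subtractf sum_distrib_left)
    then show ?thesis by (simp add: ss tn)
  qed
  have norm: "(\<Sum>i<n. (y i)\<^sup>2) = spread n s x"
  proof -
    have "(\<Sum>i<n. (y i)\<^sup>2) = (\<Sum>i<n. (x i)\<^sup>2) - 2 * t * (\<Sum>i<n. s i * x i) + t\<^sup>2 * (\<Sum>i<n. s i * s i)"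
      by (simp add: y_def power2_eq_square algebra_simps sum_subtractf sum.distrib sum_distrib_left)
    also have "\<dots> = (\<Sum>i<n. (x i)\<^sup>2) - t * (\<Sum>i<n. s i * x i)"
      by (simp add: ss flip: tn) (simp add: power2_eq_square algebra_simps)
    finally show ?thesis by (simp add: spread_def t_def power2_eq_square)
  qed
  have "cert_form n C s y = cert_form n C s x"
  proof -
    have "s i * y i = s i * x i - t" if "i < n" for i
      using s[OF that] by (simp add: y_def algebra_simps power2_eq_square)
    moreover have "cert_form n C s w =
        (\<Sum>i<n. \<Sum>j<n. C i j * (s i * s j) * (s i * w i - s j * w j)\<^sup>2) / 2" for w
      by (rule cert_form_eq_dirichlet) (use C s in auto)
    ultimately show ?thesis
      by (simp only:) (intro arg_cong2[where f = "(/)"] sum.cong refl; simp)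
  qed
  with bounds[OF orth] norm
  show "\<mu> * spread n s x \<le> cert_form n C s x" "cert_form n C s x \<le> \<Lambda> * spread n s x"
    by auto
qed

text \<open>
The left side is the trace of the product of the projections to the complements of two unit vectors.
\<close>

lemma sum_projection_products:
  fixes a b :: "nat \<Rightarrow> real"
  assumes "(\<Sum>k<r. (a k)\<^sup>2) = 1" "(\<Sum>k<r. (b k)\<^sup>2) = 1"
  shows "(\<Sum>k<r. \<Sum>l<r. (of_bool (k = l) - a k * a l) * (of_bool (k = l) - b k * b l)) =
    real r - 2 + (\<Sum>k<r. a k * b k)\<^sup>2"
proof -
  have "(\<Sum>k<r. \<Sum>l<r. (of_bool (k = l) - a k * a l) * (of_bool (k = l) - b k * b l)) =
      (\<Sum>k<r. \<Sum>l<r. of_bool (k = l) * (1 - (a k)\<^sup>2 - (b k)\<^sup>2) + (a k * b k) * (a l * b l))"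
    by (intro sum.cong refl) (auto simp: power2_eq_square algebra_simps)
  also have "\<dots> = (\<Sum>k<r. 1 - (a k)\<^sup>2 - (b k)\<^sup>2) + (\<Sum>k<r. \<Sum>l<r. (a k * b k) * (a l * b l))"
    by (simp add: sum.distrib of_bool_def if_distrib [where f = "\<lambda>c. c * _"] cong: if_cong)
  also have "(\<Sum>k<r. \<Sum>l<r. (a k * b k) * (a l * b l)) = (\<Sum>k<r. a k * b k)\<^sup>2"
    by (simp add: power2_eq_square sum_product)
  also have "(\<Sum>k<r. 1 - (a k)\<^sup>2 - (b k)\<^sup>2) = real r - 2"
    using assms by (simp add: sum_subtractf)
  finally show ?thesis .
qed

text \<open>
With \<open>S\<close> the certificate of \<open>s\<close>, the two differences are \<open>\<langle>S, G\<rangle>\<close> and \<open>\<langle>S, ss\<^sup>T \<circ> G \<circ> G\<rangle>\<close>.  The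
inequality is the sum of the second-order conditions for the directions that move every row \<open>i\<close>
by \<open>s\<^sub>i\<close> times the tangential part of a fixed basis vector: the rows then move in the same
direction as far as the constraints permit, which is the motion that aligns them.
\<close>

lemma second_order_averaged:
  assumes C: "C \<in> carrier_mat n n" "C\<^sup>T = C"
    and s: "\<And>i. i < n \<Longrightarrow> (s i)\<^sup>2 = (1::real)"
    and crit: "second_order_critical n r (objective C) Y"
  defines "c \<equiv> \<lambda>i j. C $$ (i, j)"
    and "G \<equiv> \<lambda>i j. \<Sum>k<r. Y $$ (i, k) * Y $$ (j, k)"
  shows "(real r - 1) * ((\<Sum>i<n. \<Sum>j<n. c i j * (s i * s j)) - (\<Sum>i<n. \<Sum>j<n. c i j * G i j)) \<le>
    (\<Sum>i<n. \<Sum>j<n. c i j * (s i * s j)) - (\<Sum>i<n. \<Sum>j<n. c i j * (s i * s j) * (G i j)\<^sup>2)"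
proof -
  have feas: "Y \<in> carrier_mat n r" "\<And>i. i < n \<Longrightarrow> (\<Sum>k<r. (Y $$ (i, k))\<^sup>2) = 1"
    and curv: "\<And>V. V \<in> tangent_space Y \<Longrightarrow> frob (slack C Y) (V * V\<^sup>T) \<ge> 0"
    using crit by (auto simp: second_order_critical_iff[OF C] feasible_iff)
  \<comment> \<open>Row \<open>i\<close> of \<open>V k\<close> is \<open>s i\<close> times the projection of the \<open>k\<close>-th basis vector to the complement of row \<open>i\<close> of \<open>Y\<close>.\<close>
  define V where "V = (\<lambda>k. mat n r (\<lambda>(i, l). s i * (of_bool (k = l) - Y $$ (i, k) * Y $$ (i, l))))"
  have V: "V k \<in> carrier_mat n r" for k by (simp add: V_def)
  have tang: "V k \<in> tangent_space Y" if k: "k < r" for k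
  proof -
    have "(\<Sum>l<r. Y $$ (i, l) * V k $$ (i, l)) = 0" if i: "i < n" for i
    proof -
      have "(\<Sum>l<r. Y $$ (i, l) * V k $$ (i, l)) =
          (\<Sum>l<r. s i * (of_bool (k = l) * Y $$ (i, k)) - s i * Y $$ (i, k) * (Y $$ (i, l))\<^sup>2)"
        by (rule sum.cong) (use i in \<open>auto simp: V_def power2_eq_square algebra_simps\<close>)
      also have "\<dots> = s i * Y $$ (i, k) - s i * Y $$ (i, k) * (\<Sum>l<r. (Y $$ (i, l))\<^sup>2)"
        using k by (simp add: sum_subtractf flip: sum_distrib_left)
      finally show ?thesis using feas i by simp
    qed
    then show ?thesis using V by (simp add: tangent_space_iff[OF feas(1)])
  qed
  have S: "slack C Y \<in> carrier_mat n n" using C unfolding slack_def by auto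
  have slack_index: "slack C Y $$ (i, j) = of_bool (i = j) * (\<Sum>m<n. c i m * G i m) - c i j"
    if ij: "i < n" "j < n" for i j
  proof -
    have CY: "C * Y \<in> carrier_mat n r" using C feas by auto
    have "(C * Y * Y\<^sup>T) $$ (i, i) = (\<Sum>l<r. (\<Sum>m<n. c i m * Y $$ (m, l)) * Y $$ (i, l))"
      unfolding mult_transpose_index[OF CY feas(1) ij(1) ij(1)]
      by (intro sum.cong refl)
        (use C feas ij in \<open>simp add: mult_mat_index[OF C(1) feas(1)] c_def del: index_mult_mat(1)\<close>)
    also have "\<dots> = (\<Sum>m<n. \<Sum>l<r. c i m * Y $$ (m, l) * Y $$ (i, l))"
      unfolding sum_distrib_right by (rule sum.swap)
    also have "\<dots> = (\<Sum>m<n. c i m * G i m)"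
      by (simp add: G_def sum_distrib_left mult_ac)
    finally have D: "(C * Y * Y\<^sup>T) $$ (i, i) = (\<Sum>m<n. c i m * G i m)" .
    have dims: "C * Y * Y\<^sup>T \<in> carrier_mat n n" using CY feas(1) by auto
    then have "slack C Y $$ (i, j) = ddiag (C * Y * Y\<^sup>T) $$ (i, j) - C $$ (i, j)"
      unfolding slack_def using C ij by (intro index_minus_mat) auto
    also have "ddiag (C * Y * Y\<^sup>T) $$ (i, j) = (if i = j then (C * Y * Y\<^sup>T) $$ (i, i) else 0)"
      using dims ij by (intro ddiag_index) auto
    finally show ?thesis using D by (auto simp: c_def simp del: index_mult_mat(1))
  qed
  have "0 \<le> (\<Sum>k<r. frob (slack C Y) (V k * (V k)\<^sup>T))"
    by (intro sum_nonneg curv tang) auto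
  also have "\<dots> = (\<Sum>k<r. \<Sum>i<n. \<Sum>j<n. slack C Y $$ (i, j) * (\<Sum>l<r. V k $$ (i, l) * V k $$ (j, l)))"
  proof (rule sum.cong[OF refl])
    fix k
    have "V k * (V k)\<^sup>T \<in> carrier_mat n n"
      using V[of k] by (intro mult_carrier_mat[of _ n r]) auto
    from frob_eq_sum[OF S this]
    show "frob (slack C Y) (V k * (V k)\<^sup>T) =
        (\<Sum>i<n. \<Sum>j<n. slack C Y $$ (i, j) * (\<Sum>l<r. V k $$ (i, l) * V k $$ (j, l)))"
      by (simp add: mult_transpose_index[OF V V] del: index_mult_mat(1))
  qed
  also have "\<dots> = (\<Sum>i<n. \<Sum>j<n. \<Sum>k<r. slack C Y $$ (i, j) * (\<Sum>l<r. V k $$ (i, l) * V k $$ (j, l)))"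
    by (subst sum.swap, rule sum.cong[OF refl], rule sum.swap)
  also have "\<dots> = (\<Sum>i<n. \<Sum>j<n. (of_bool (i = j) * (\<Sum>m<n. c i m * G i m) - c i j) *
      (s i * s j * (real r - 2 + (G i j)\<^sup>2)))"
  proof (intro sum.cong refl)
    fix i j assume "i \<in> {..<n}" "j \<in> {..<n}"
    then have ij: "i < n" "j < n" by auto
    have "(\<Sum>k<r. \<Sum>l<r. V k $$ (i, l) * V k $$ (j, l)) =
        s i * s j * (\<Sum>k<r. \<Sum>l<r. (of_bool (k = l) - Y $$ (i, k) * Y $$ (i, l)) *
          (of_bool (k = l) - Y $$ (j, k) * Y $$ (j, l)))"
      unfolding sum_distrib_left by (intro sum.cong refl) (use ij in \<open>simp add: V_def\<close>)
    also have "\<dots> = s i * s j * (real r - 2 + (G i j)\<^sup>2)"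
      unfolding G_def by (subst sum_projection_products) (use feas ij in auto)
    finally show "(\<Sum>k<r. slack C Y $$ (i, j) * (\<Sum>l<r. V k $$ (i, l) * V k $$ (j, l))) =
        (of_bool (i = j) * (\<Sum>m<n. c i m * G i m) - c i j) * (s i * s j * (real r - 2 + (G i j)\<^sup>2))"
      unfolding slack_index[OF ij] by (simp flip: sum_distrib_left)
  qed
  also have "\<dots> = (\<Sum>i<n. (\<Sum>m<n. c i m * G i m) * (real r - 1)) -
      (\<Sum>i<n. \<Sum>j<n. c i j * (s i * s j) * (real r - 2 + (G i j)\<^sup>2))"
  proof -
    have "(\<Sum>j<n. of_bool (i = j) * (\<Sum>m<n. c i m * G i m) * (s i * s j * (real r - 2 + (G i j)\<^sup>2))) =
        (\<Sum>m<n. c i m * G i m) * (real r - 1)" if i: "i < n" for i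
    proof -
      have "G i i = 1" using feas(2)[OF i] by (simp add: G_def power2_eq_square)
      then show ?thesis using i s[OF i]
        by (simp add: of_bool_def if_distrib [where f = "\<lambda>c. c * _"] power2_eq_square cong: if_cong)
    qed
    then have "(\<Sum>i<n. \<Sum>j<n. of_bool (i = j) * (\<Sum>m<n. c i m * G i m) *
        (s i * s j * (real r - 2 + (G i j)\<^sup>2))) = (\<Sum>i<n. (\<Sum>m<n. c i m * G i m) * (real r - 1))"
      by (intro sum.cong refl) (simp only: lessThan_iff)
    then show ?thesis
      unfolding left_diff_distrib sum_subtractf by (simp only: mult.assoc)
  qed
  also have "\<dots> = (real r - 1) * (\<Sum>i<n. \<Sum>j<n. c i j * G i j)
      - (real r - 2) * (\<Sum>i<n. \<Sum>j<n. c i j * (s i * s j))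
      - (\<Sum>i<n. \<Sum>j<n. c i j * (s i * s j) * (G i j)\<^sup>2)"
    unfolding distrib_left sum.distrib sum_distrib_right[symmetric] by simp
  finally show ?thesis by (simp add: algebra_simps)
qed

text \<open>
Both sides of the averaged inequality are sums of values of the form of the certificate: over the
columns of \<open>Y\<close> on the left, and over the entrywise products of two columns, with signs \<open>z\<close>, on
the right.  The bounds on this form therefore compare \<open>(r - 1) \<mu> \<Sum> (1 - g\<^sub>i\<^sub>j)\<close> with
\<open>\<Lambda> \<Sum> (1 - g\<^sub>i\<^sub>j\<^sup>2) \<le> 2 \<Lambda> \<Sum> (1 - g\<^sub>i\<^sub>j)\<close>, where \<open>g\<^sub>i\<^sub>j\<close> is the inner product of rows \<open>i\<close> and
\<open>j\<close> of \<open>Y\<close> times their labels.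
\<close>

lemma second_order_critical_rank_one:
  assumes C: "C \<in> carrier_mat n n" "C\<^sup>T = C" and n: "n > 0"
    and z: "z \<in> carrier_vec n" "\<And>i. i < n \<Longrightarrow> (z $ i)\<^sup>2 = 1"
    and bounds: "\<And>x. (\<Sum>i<n. z $ i * x i) = 0 \<Longrightarrow>
      \<mu> * (\<Sum>i<n. (x i)\<^sup>2) \<le> cert_form n (\<lambda>i j. C $$ (i, j)) (($) z) x \<and>
      cert_form n (\<lambda>i j. C $$ (i, j)) (($) z) x \<le> \<Lambda> * (\<Sum>i<n. (x i)\<^sup>2)"
    and r: "1 \<le> r" "2 * \<Lambda> < (real r - 1) * \<mu>" and \<Lambda>: "0 \<le> \<Lambda>"
    and crit: "second_order_critical n r (objective C) Y"
  shows "\<exists>u \<in> carrier_vec r. sqrt (u \<bullet> u) = 1 \<and> Y = outer z u"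
proof -
  define s where "s = ($) z"
  define c where "c = (\<lambda>i j. C $$ (i, j))"
  define G where "G = (\<lambda>i j. \<Sum>k<r. Y $$ (i, k) * Y $$ (j, k))"
  define g where "g = (\<lambda>i j. s i * s j * G i j)"
  have s: "(s i)\<^sup>2 = 1" if "i < n" for i using z that by (simp add: s_def)
  have feas: "Y \<in> carrier_mat n r" "\<And>i. i < n \<Longrightarrow> (\<Sum>k<r. (Y $$ (i, k))\<^sup>2) = 1"
    using crit by (auto simp: second_order_critical_iff[OF C] feasible_iff)
  have sym: "c i j = c j i" if "i < n" "j < n" for i j
  proof -
    have "C\<^sup>T $$ (i, j) = C $$ (j, i)" using C(1) that by simp
    then show ?thesis by (simp only: C(2) c_def)
  qed
  have lower: "\<mu> * spread n s x \<le> cert_form n c s x"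
    and upper: "cert_form n c s x \<le> \<Lambda> * spread n s x" for x
    using cert_form_bounds_by_spread[of n c s \<mu> \<Lambda>, OF sym s] bounds
    unfolding s_def c_def by blast+
  let ?T = "\<Sum>i<n. \<Sum>j<n. c i j * (s i * s j)"
  let ?X = "\<Sum>i<n. \<Sum>j<n. c i j * G i j"
  let ?Q = "\<Sum>i<n. \<Sum>j<n. c i j * (s i * s j) * (G i j)\<^sup>2"
  have Gii: "G i i = 1" if "i < n" for i
    using feas(2)[OF that] by (simp add: G_def power2_eq_square)
  \<comment> \<open>It remains to express both sides by the alignments \<open>g i j\<close>, which are at most 1 and equal 1 when rows \<open>i\<close> and \<open>j\<close> agree up to the labels.\<close>
  have avg: "(real r - 1) * (?T - ?X) \<le> ?T - ?Q"
    using second_order_averaged[OF C s crit] unfolding c_def G_def by simp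

  have form_cols: "(\<Sum>k<r. cert_form n c s (\<lambda>i. Y $$ (i, k))) = ?T - ?X"
  proof -
    have "(\<Sum>k<r. \<Sum>i<n. (\<Sum>j<n. c i j * (s i * s j)) * (Y $$ (i, k))\<^sup>2) = ?T"
      by (subst sum.swap) (simp add: feas(2) flip: sum_distrib_left)
    moreover have "(\<Sum>k<r. quad_form n c (\<lambda>i. Y $$ (i, k))) = ?X"
      unfolding quad_form_def G_def sum_distrib_left
      by (subst sum.swap, rule sum.cong[OF refl], rule sum.swap)
    ultimately show ?thesis by (simp add: cert_form_def sum_subtractf)
  qed
  have sw: "(\<Sum>k<r. \<Sum>l<r. \<Sum>i<n. f k l i) = (\<Sum>i<n. \<Sum>k<r. \<Sum>l<r. f k l i)" for f :: "nat \<Rightarrow> nat \<Rightarrow> nat \<Rightarrow> real"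
  proof -
    have "(\<Sum>k<r. \<Sum>l<r. \<Sum>i<n. f k l i) = (\<Sum>k<r. \<Sum>i<n. \<Sum>l<r. f k l i)"
      by (intro sum.cong refl sum.swap)
    also have "\<dots> = (\<Sum>i<n. \<Sum>k<r. \<Sum>l<r. f k l i)" by (rule sum.swap)
    finally show ?thesis .
  qed
  have GG: "(\<Sum>k<r. \<Sum>l<r. (Y $$ (i, k) * Y $$ (i, l)) * (Y $$ (j, k) * Y $$ (j, l))) = (G i j)\<^sup>2" for i j
    unfolding G_def power2_eq_square sum_product by (simp add: mult_ac)
  have unit_hadamard: "(\<Sum>k<r. \<Sum>l<r. (s i * (Y $$ (i, k) * Y $$ (i, l)))\<^sup>2) = 1" if "i < n" for i
    using GG[of i i] s[OF that] Gii[OF that] by (simp add: power2_eq_square mult_ac power_mult_distrib)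
      (simp add: flip: mult.assoc)
  have form_hadamard:
    "(\<Sum>k<r. \<Sum>l<r. cert_form n c s (\<lambda>i. s i * (Y $$ (i, k) * Y $$ (i, l)))) = ?T - ?Q"
  proof -
    have "(\<Sum>k<r. \<Sum>l<r. \<Sum>i<n. (\<Sum>j<n. c i j * (s i * s j)) * (s i * (Y $$ (i, k) * Y $$ (i, l)))\<^sup>2) = ?T"
      unfolding sw using unit_hadamard by (simp flip: sum_distrib_left)
    moreover have "(\<Sum>k<r. \<Sum>l<r. quad_form n c (\<lambda>i. s i * (Y $$ (i, k) * Y $$ (i, l)))) = ?Q"
      unfolding quad_form_def sw
    proof (intro sum.cong refl)
      fix i j
      have "(\<Sum>k<r. \<Sum>l<r. c i j * (s i * (Y $$ (i, k) * Y $$ (i, l)) * (s j * (Y $$ (j, k) * Y $$ (j, l))))) =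
          c i j * (s i * s j) *
            (\<Sum>k<r. \<Sum>l<r. (Y $$ (i, k) * Y $$ (i, l)) * (Y $$ (j, k) * Y $$ (j, l)))"
        unfolding sum_distrib_left by (simp add: mult_ac)
      then show "(\<Sum>k<r. \<Sum>l<r. c i j * (s i * (Y $$ (i, k) * Y $$ (i, l)) * (s j * (Y $$ (j, k) * Y $$ (j, l))))) =
          c i j * (s i * s j) * (G i j)\<^sup>2" unfolding GG .
    qed
    ultimately show ?thesis by (simp add: cert_form_def sum_subtractf)
  qed
  have spread_cols: "(\<Sum>k<r. spread n s (\<lambda>i. Y $$ (i, k))) = (\<Sum>i<n. \<Sum>j<n. 1 - g i j) / n"
  proof -
    have "(\<Sum>k<r. \<Sum>i<n. (Y $$ (i, k))\<^sup>2) = n"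
      by (subst sum.swap) (simp add: feas(2))
    moreover have "(\<Sum>k<r. (\<Sum>i<n. s i * Y $$ (i, k))\<^sup>2) = (\<Sum>i<n. \<Sum>j<n. g i j)"
    proof -
      have "(\<Sum>k<r. (\<Sum>i<n. s i * Y $$ (i, k))\<^sup>2) =
          (\<Sum>i<n. \<Sum>k<r. \<Sum>j<n. (s i * Y $$ (i, k)) * (s j * Y $$ (j, k)))"
        unfolding power2_eq_square sum_product by (rule sum.swap)
      also have "\<dots> = (\<Sum>i<n. \<Sum>j<n. \<Sum>k<r. (s i * Y $$ (i, k)) * (s j * Y $$ (j, k)))"
        by (intro sum.cong refl sum.swap)
      finally show ?thesis by (simp add: g_def G_def sum_distrib_left mult_ac)
    qed
    ultimately have "(\<Sum>k<r. spread n s (\<lambda>i. Y $$ (i, k))) = n - (\<Sum>i<n. \<Sum>j<n. g i j) / n"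
      by (simp add: spread_def sum_subtractf flip: sum_divide_distrib)
    then show ?thesis using n by (simp add: sum_subtractf field_simps)
  qed
  have spread_hadamard: "(\<Sum>k<r. \<Sum>l<r. spread n s (\<lambda>i. s i * (Y $$ (i, k) * Y $$ (i, l)))) =
      (\<Sum>i<n. \<Sum>j<n. 1 - (g i j)\<^sup>2) / n"
  proof -
    have 1: "(\<Sum>k<r. \<Sum>l<r. \<Sum>i<n. (s i * (Y $$ (i, k) * Y $$ (i, l)))\<^sup>2) = n"
      unfolding sw using unit_hadamard by simp
    have "(\<Sum>k<r. \<Sum>l<r. (\<Sum>i<n. s i * (s i * (Y $$ (i, k) * Y $$ (i, l))))\<^sup>2) =
       (\<Sum>k<r. \<Sum>l<r. (\<Sum>i<n. Y $$ (i, k) * Y $$ (i, l))\<^sup>2)"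
      using s by (simp add: power2_eq_square flip: mult.assoc)
    also have "\<dots> = (\<Sum>i<n. \<Sum>j<n. (g i j)\<^sup>2)"
      unfolding power2_eq_square sum_product sw
    proof (intro sum.cong refl)
      fix i j assume ij: "i \<in> {..<n}" "j \<in> {..<n}"
      have "g i j * g i j = (s i)\<^sup>2 * (s j)\<^sup>2 * (G i j)\<^sup>2"
        by (simp add: g_def power2_eq_square)
      then show "(\<Sum>k<r. \<Sum>l<r. Y $$ (i, k) * Y $$ (i, l) * (Y $$ (j, k) * Y $$ (j, l))) = g i j * g i j"
        unfolding GG using s ij by simp
    qed
    finally have "(\<Sum>k<r. \<Sum>l<r. spread n s (\<lambda>i. s i * (Y $$ (i, k) * Y $$ (i, l)))) =
        n - (\<Sum>i<n. \<Sum>j<n. (g i j)\<^sup>2) / n"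
      using 1 by (simp add: spread_def sum_subtractf flip: sum_divide_distrib)
    then show ?thesis using n by (simp add: sum_subtractf field_simps)
  qed
  have dist: "(\<Sum>k<r. (s i * Y $$ (i, k) - s j * Y $$ (j, k))\<^sup>2) = 2 * (1 - g i j)"
    if ij: "i < n" "j < n" for i j
  proof -
    have "(\<Sum>k<r. (s i * Y $$ (i, k) - s j * Y $$ (j, k))\<^sup>2) =
        (s i)\<^sup>2 * (\<Sum>k<r. (Y $$ (i, k))\<^sup>2) + (s j)\<^sup>2 * (\<Sum>k<r. (Y $$ (j, k))\<^sup>2) - 2 * g i j"
      by (simp add: g_def G_def power2_eq_square algebra_simps sum.distrib sum_subtractf sum_distrib_left)
    then show ?thesis using feas s ij by simp
  qed
  have g1: "0 \<le> 1 - g i j" if "i < n" "j < n" for i j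
    using dist[OF that] sum_nonneg[of "{..<r}" "\<lambda>k. (s i * Y $$ (i, k) - s j * Y $$ (j, k))\<^sup>2"] by simp
  define E where "E = (\<Sum>i<n. \<Sum>j<n. 1 - g i j)"
  have E0: "0 \<le> E" unfolding E_def by (intro sum_nonneg g1) auto
  have "(real r - 1) * (\<mu> * (E / n)) \<le> (real r - 1) * (?T - ?X)"
    unfolding form_cols[symmetric] E_def spread_cols[symmetric] sum_distrib_left
    using r(1) by (intro sum_mono mult_left_mono lower) auto
  also have "\<dots> \<le> ?T - ?Q" by (rule avg)
  also have "\<dots> \<le> \<Lambda> * ((\<Sum>i<n. \<Sum>j<n. 1 - (g i j)\<^sup>2) / n)"
    unfolding form_hadamard[symmetric] spread_hadamard[symmetric] sum_distrib_left
    by (intro sum_mono upper)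
  also have "\<dots> \<le> \<Lambda> * (2 * E / n)"
  proof -
    have "1 - x\<^sup>2 \<le> 2 * (1 - x)" for x :: real
      using zero_le_power2[of "1 - x"] by (simp add: power2_eq_square algebra_simps)
    then have "(\<Sum>i<n. \<Sum>j<n. 1 - (g i j)\<^sup>2) \<le> 2 * E"
      unfolding E_def sum_distrib_left by (intro sum_mono)
    then show ?thesis using \<Lambda> by (intro mult_left_mono divide_right_mono) auto
  qed
  finally have "((real r - 1) * \<mu> - 2 * \<Lambda>) * E / n \<le> 0"
    by (simp add: algebra_simps diff_divide_distrib add_divide_distrib)
  then have "((real r - 1) * \<mu> - 2 * \<Lambda>) * E \<le> 0"
    using n by (simp add: divide_le_0_iff)
  then have "E = 0" using r(2) E0 by (simp add: mult_le_0_iff)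
  then have "\<forall>i\<in>{..<n}. (\<Sum>j<n. 1 - g i j) = 0"
    unfolding E_def by (subst (asm) sum_nonneg_eq_0_iff) (auto intro!: sum_nonneg g1)
  then have "1 - g i j = 0" if "i < n" "j < n" for i j
    using that g1 sum_nonneg_eq_0_iff[of "{..<n}" "\<lambda>j. 1 - g i j"] by auto
  then have flat: "\<forall>k\<in>{..<r}. (s i * Y $$ (i, k) - s j * Y $$ (j, k))\<^sup>2 = 0" if "i < n" "j < n" for i j
    using dist[OF that] that by (subst sum_nonneg_eq_0_iff[symmetric]) auto
  have const: "s i * Y $$ (i, k) = s j * Y $$ (j, k)" if "i < n" "j < n" "k < r" for i j k
  proof -
    have "(s i * Y $$ (i, k) - s j * Y $$ (j, k))\<^sup>2 = 0"
      using flat[OF that(1,2)] that(3) by blast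
    then show ?thesis by simp
  qed
  define u where "u = vec r (\<lambda>k. s 0 * Y $$ (0, k))"
  have u: "u \<in> carrier_vec r" by (simp add: u_def)
  have "u \<bullet> u = (s 0)\<^sup>2 * (\<Sum>k<r. (Y $$ (0, k))\<^sup>2)"
    by (simp add: u_def scalar_prod_def sum_distrib_left power2_eq_square atLeast0LessThan mult_ac)
  then have "sqrt (u \<bullet> u) = 1" using s feas n by simp
  moreover have "Y = outer z u"
  proof (rule eq_matI)
    fix i k assume "i < dim_row (outer z u)" "k < dim_col (outer z u)"
    then have ik: "i < n" "k < r" using z u by (auto simp: outer_def)
    have "Y $$ (i, k) = (s i)\<^sup>2 * Y $$ (i, k)" using s ik by simp
    also have "\<dots> = s i * (s 0 * Y $$ (0, k))"
      using const[of i 0 k] ik n by (simp add: power2_eq_square mult.assoc)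
    finally show "Y $$ (i, k) = outer z u $$ (i, k)"
      using z u ik by (simp add: outer_def u_def s_def)
  qed (use feas z u in \<open>auto simp: outer_def\<close>)
  ultimately show ?thesis using u by blast
qed

section \<open>Bounding a quadratic form by its values at integer vectors\<close>

lemma abs_int_le_square: "\<bar>k\<bar> \<le> k\<^sup>2" for k :: int
proof (cases "k = 0")
  case False
  then have "\<bar>k\<bar> * 1 \<le> \<bar>k\<bar> * \<bar>k\<bar>" by (intro mult_left_mono) auto
  then show ?thesis by (simp add: power2_eq_square)
qed simp

lemma quad_form_scale: "quad_form n M (\<lambda>i. t * x i) = t\<^sup>2 * quad_form n M x"
  by (simp add: quad_form_def sum_distrib_left power2_eq_square mult_ac)

lemma quad_form_expand:
  assumes "\<And>i j. i < n \<Longrightarrow> j < n \<Longrightarrow> M i j = M j i"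
  shows "quad_form n M (\<lambda>i. x i + t * y i) =
    quad_form n M x + 2 * t * (\<Sum>i<n. \<Sum>j<n. M i j * (x i * y j)) + t\<^sup>2 * quad_form n M y"
proof -
  let ?b = "\<Sum>i<n. \<Sum>j<n. M i j * (x i * y j)"
  have "?b = (\<Sum>j<n. \<Sum>i<n. M i j * (x i * y j))" by (rule sum.swap)
  also have "\<dots> = (\<Sum>j<n. \<Sum>i<n. M j i * (x i * y j))"
    by (intro sum.cong refl) (use assms in auto)
  finally have b: "?b = (\<Sum>i<n. \<Sum>j<n. M i j * (y i * x j))" by (simp add: mult_ac)
  have "quad_form n M (\<lambda>i. x i + t * y i) = (\<Sum>i<n. \<Sum>j<n. M i j * (x i * x j) +
     t * (M i j * (x i * y j)) + t * (M i j * (y i * x j)) + t\<^sup>2 * (M i j * (y i * y j)))"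
    unfolding quad_form_def by (intro sum.cong refl) (simp add: algebra_simps power2_eq_square)
  also have "\<dots> = quad_form n M x + t * ?b + t * (\<Sum>i<n. \<Sum>j<n. M i j * (y i * x j)) + t\<^sup>2 * quad_form n M y"
    unfolding quad_form_def sum.distrib sum_distrib_left ..
  finally show ?thesis unfolding b[symmetric] by simp
qed

text \<open>
The integer points of the ball of squared radius \<open>36 n\<close> are a net for it: rounding towards zero stays
in the ball and moves a vector by at most \<open>sqrt n\<close>, a sixth of the radius.  If \<open>R\<close> is the
supremum of the form over the ball, then by polarisation the rounding error changes the form by at most
\<open>(2/3 + 1/36) R\<close>, so \<open>R\<close> is at most \<open>36/11\<close>, hence at most 4, times its supremum over integer points.
\<close>

lemma quad_form_bound_from_integers:
  assumes sym: "\<And>i j. i < n \<Longrightarrow> j < n \<Longrightarrow> M i j = M j i"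
    and B: "\<And>m::nat \<Rightarrow> int. (\<Sum>i<n. (m i)\<^sup>2) \<le> 36 * int n \<Longrightarrow>
      \<bar>quad_form n M (\<lambda>i. of_int (m i))\<bar> \<le> B * (36 * real n)"
  shows "\<bar>quad_form n M x\<bar> \<le> 4 * B * (\<Sum>i<n. (x i)\<^sup>2)"
proof (cases "n = 0")
  case True then show ?thesis by (simp add: quad_form_def)
next
  case False
  define N where "N = 36 * real n"
  have N: "N > 0" using False by (simp add: N_def)
  define K where "K = {x :: nat \<Rightarrow> real. (\<Sum>i<n. (x i)\<^sup>2) \<le> N}"
  define R where "R = (SUP x\<in>K. \<bar>quad_form n M x\<bar>)"
  have "bdd_above ((\<lambda>x. \<bar>quad_form n M x\<bar>) ` K)"
  proof (rule bdd_aboveI2)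
    fix x assume x: "x \<in> K"
    have sq: "(x i)\<^sup>2 \<le> N" if "i < n" for i
      using x member_le_sum[of i "{..<n}" "\<lambda>i. (x i)\<^sup>2"] that by (auto simp: K_def)
    have "\<bar>x i * x j\<bar> \<le> N" if "i < n" "j < n" for i j
      using sq[OF that(1)] sq[OF that(2)] sum_squares_bound[of "\<bar>x i\<bar>" "\<bar>x j\<bar>"] by (simp add: abs_mult)
    then show "\<bar>quad_form n M x\<bar> \<le> (\<Sum>i<n. \<Sum>j<n. \<bar>M i j\<bar> * N)"
      unfolding quad_form_def
      by (intro order.trans[OF sum_abs] sum_mono) (auto simp: abs_mult intro!: mult_left_mono)
  qed
  then have le_R: "\<bar>quad_form n M x\<bar> \<le> R" if "x \<in> K" for x
    unfolding R_def using that by (rule cSUP_upper[rotated])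
  have zeroK: "(\<lambda>_. 0) \<in> K" using N by (simp add: K_def)
  have R0: "0 \<le> R" using le_R[OF zeroK] by linarith
  have step: "\<bar>quad_form n M x\<bar> \<le> B * N + 25 / 36 * R" if x: "x \<in> K" for x
  proof -
    define m where "m = (\<lambda>i. if x i \<ge> 0 then \<lfloor>x i\<rfloor> else - \<lfloor>- x i\<rfloor>)"
    \<comment> \<open>The rounding error, enlarged to fill the ball.\<close>
    define f where "f = (\<lambda>i. 6 * (x i - of_int (m i)))"
    have m_le: "\<bar>of_int (m i)\<bar> \<le> \<bar>x i\<bar>" for i
    proof (cases "x i \<ge> 0")
      case False
      then have "0 \<le> \<lfloor>- x i\<rfloor>" by simp
      then have "\<bar>of_int (m i)\<bar> = (of_int \<lfloor>- x i\<rfloor> :: real)"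
        using False by (simp add: m_def)
      then show ?thesis using False of_int_floor_le[of "- x i"] by linarith
    qed (simp add: m_def)
    have "(\<Sum>i<n. (of_int (m i) :: real)\<^sup>2) \<le> (\<Sum>i<n. (x i)\<^sup>2)"
      by (intro sum_mono) (use m_le in \<open>simp add: abs_le_square_iff\<close>)
    also have "\<dots> \<le> N" using x by (simp add: K_def)
    finally have m_norm: "(\<Sum>i<n. (of_int (m i) :: real)\<^sup>2) \<le> N" .
    then have "of_int (\<Sum>i<n. (m i)\<^sup>2) \<le> (of_int (36 * int n) :: real)" by (simp add: N_def)
    then have m_int: "(\<Sum>i<n. (m i)\<^sup>2) \<le> 36 * int n" by (simp only: of_int_le_iff)
    have f_le: "\<bar>f i\<bar> \<le> 6" for i
    proof -
      have "\<bar>x i - of_int (m i)\<bar> \<le> 1"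
        using floor_correct[of "x i"] floor_correct[of "- x i"]
        by (cases "x i \<ge> 0") (simp_all add: m_def, linarith+)
      then show ?thesis unfolding f_def abs_mult by simp
    qed
    have "(f i)\<^sup>2 \<le> 36" for i using f_le[of i] abs_le_square_iff[of "f i" 6] by simp
    then have "(\<Sum>i<n. (f i)\<^sup>2) \<le> (\<Sum>i<n. 36)" by (intro sum_mono)
    then have f_norm: "(\<Sum>i<n. (f i)\<^sup>2) \<le> N" by (simp add: N_def)
    define b where "b = (\<Sum>i<n. \<Sum>j<n. M i j * (of_int (m i) * f j))"
    have half: "\<bar>quad_form n M (\<lambda>i. of_int (m i) + \<sigma> * f i)\<bar> \<le> 4 * R" if \<sigma>: "\<sigma>\<^sup>2 = 1" for \<sigma>
    proof -
      let ?h = "\<lambda>i. 1 / 2 * (of_int (m i) + \<sigma> * f i)"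
      have "(?h i)\<^sup>2 \<le> ((of_int (m i))\<^sup>2 + (f i)\<^sup>2) / 2" for i
      proof -
        have "(of_int (m i) + \<sigma> * f i)\<^sup>2 + (of_int (m i) - \<sigma> * f i)\<^sup>2 =
            2 * (of_int (m i))\<^sup>2 + 2 * (\<sigma>\<^sup>2 * (f i)\<^sup>2)"
          by (simp add: power2_eq_square algebra_simps)
        then have "(of_int (m i) + \<sigma> * f i)\<^sup>2 \<le> 2 * (of_int (m i))\<^sup>2 + 2 * (f i)\<^sup>2"
          unfolding \<sigma> mult_1_left using zero_le_power2[of "of_int (m i) - \<sigma> * f i"] by linarith
        then show ?thesis unfolding power_mult_distrib by (simp add: power2_eq_square)
      qed
      then have "(\<Sum>i<n. (?h i)\<^sup>2) \<le> (\<Sum>i<n. ((of_int (m i))\<^sup>2 + (f i)\<^sup>2) / 2)" by (intro sum_mono)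
      also have "\<dots> \<le> N" using m_norm f_norm by (simp add: sum.distrib flip: sum_divide_distrib)
      finally have "?h \<in> K" by (simp add: K_def)
      from le_R[OF this] show ?thesis unfolding quad_form_scale by (simp add: abs_mult power2_eq_square)
    qed
    have ex: "quad_form n M (\<lambda>i. of_int (m i) + t * f i) =
        quad_form n M (\<lambda>i. of_int (m i)) + 2 * t * b + t\<^sup>2 * quad_form n M f" for t
      unfolding b_def by (rule quad_form_expand[OF sym])
    have "\<bar>4 * b\<bar> \<le> 8 * R"
      using half[of 1] half[of "-1"] ex[of 1] ex[of "-1"] by simp
    moreover have "x = (\<lambda>i. of_int (m i) + 1 / 6 * f i)" by (rule ext) (simp add: f_def diff_divide_distrib)
    then have "quad_form n M x = quad_form n M (\<lambda>i. of_int (m i)) + b / 3 + quad_form n M f / 36"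
      using ex[of "1 / 6"] by (simp add: power2_eq_square)
    moreover have "\<bar>quad_form n M f\<bar> \<le> R" using f_norm by (intro le_R) (simp add: K_def)
    moreover have "\<bar>quad_form n M (\<lambda>i. of_int (m i))\<bar> \<le> B * N" using B[OF m_int] by (simp add: N_def)
    ultimately show ?thesis by linarith
  qed
  have "R \<le> B * N + 25 / 36 * R"
    unfolding R_def[of] by (rule cSUP_least) (use zeroK step in \<open>auto simp: R_def\<close>)
  then have R4: "R \<le> 4 * B * N" using R0 by linarith
  define S where "S = (\<Sum>i<n. (x i)\<^sup>2)"
  show ?thesis
  proof (cases "S = 0")
    case True
    then have "x i = 0" if "i < n" for i
      using that unfolding S_def by (subst (asm) sum_nonneg_eq_0_iff) auto
    then have "quad_form n M x = 0" by (simp add: quad_form_def)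
    then show ?thesis using True by (simp add: S_def)
  next
    case False
    then have S: "S > 0" using sum_nonneg[of "{..<n}" "\<lambda>i. (x i)\<^sup>2"] by (simp add: S_def)
    define t where "t = sqrt (N / S)"
    have t2: "t\<^sup>2 = N / S" using S N by (simp add: t_def)
    have "(\<Sum>i<n. (t * x i)\<^sup>2) = t\<^sup>2 * S" by (simp add: power_mult_distrib S_def sum_distrib_left)
    then have "(\<lambda>i. t * x i) \<in> K" using S t2 by (simp add: K_def)
    from le_R[OF this] have "N / S * \<bar>quad_form n M x\<bar> \<le> R"
      using N S by (simp add: quad_form_scale t2 abs_mult)
    then have "N * \<bar>quad_form n M x\<bar> \<le> R * S" using S by (simp add: field_simps)
    also have "\<dots> \<le> (4 * B * N) * S" using R4 S by (intro mult_right_mono) auto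
    finally have "N * \<bar>quad_form n M x\<bar> \<le> N * (4 * B * S)" by (simp add: mult_ac)
    then show ?thesis using N unfolding S_def[symmetric] by (simp only: mult_le_cancel_left_pos)
  qed
qed

section \<open>Forms of degenerate graphs\<close>

text \<open>
A graph whose vertices can be removed one at a time, each having degree at most \<open>\<kappa>\<close> when it is
removed, has an orientation with out-degrees at most \<open>\<kappa>\<close>.  Weighing the two ends of each edge by
\<open>2 |x\<^sub>i x\<^sub>j| \<le> \<omega> x\<^sub>i\<^sup>2 + x\<^sub>j\<^sup>2 / \<omega>\<close> along this orientation then bounds the form by the geometric mean of
\<open>\<kappa>\<close> and the maximal degree \<open>\<Delta>\<close>, up to a factor, for the best choice of \<open>\<omega>\<close>.
\<close>

lemma quad_form_bound_by_peeling:
  assumes H: "\<And>i j. i \<in> V \<Longrightarrow> j \<in> V \<Longrightarrow> H i j = H j i"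
      "\<And>i j. i \<in> V \<Longrightarrow> j \<in> V \<Longrightarrow> 0 \<le> H i j" "\<And>i. i \<in> V \<Longrightarrow> H i i = (0::real)"
    and V: "finite V"
    and degenerate: "\<And>T. T \<subseteq> V \<Longrightarrow> T \<noteq> {} \<Longrightarrow> \<exists>v\<in>T. (\<Sum>j\<in>T. H v j) \<le> \<kappa>"
    and deg: "\<And>i. i \<in> V \<Longrightarrow> (\<Sum>j\<in>V. H i j) \<le> \<Delta>"
    and \<omega>: "\<omega> > 0"
  shows "(\<Sum>i\<in>V. \<Sum>j\<in>V. H i j * \<bar>x i * x j\<bar>) \<le> (\<omega> * \<kappa> + \<Delta> / \<omega>) * (\<Sum>i\<in>V. (x i)\<^sup>2)"
proof -
  \<comment> \<open>The term with the degree inside \<open>T\<close> is what makes the induction close: each removed vertex pays for its neighbours.\<close>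
  have main: "(\<Sum>i\<in>T. \<Sum>j\<in>T. H i j * \<bar>x i * x j\<bar>) \<le>
      (\<Sum>i\<in>T. (\<omega> * \<kappa> + (\<Sum>j\<in>T. H i j) / \<omega>) * (x i)\<^sup>2)" if "T \<subseteq> V" for T
    using finite_subset[OF that V] that
  proof (induction T rule: finite_remove_induct)
    case empty then show ?case by simp
  next
    case (remove T)
    obtain v where v: "v \<in> T" and dv: "(\<Sum>j\<in>T. H v j) \<le> \<kappa>" using degenerate[of T] remove by auto
    define U where "U = T - {v}"
    have T: "T = insert v U" "v \<notin> U" "finite U" using v remove by (auto simp: U_def)
    have sub: "v \<in> V" "U \<subseteq> V" using remove.prems T by auto
    have Hvv: "H v v = 0" using H(3) sub by simp
    have sym: "H i v = H v i" if "i \<in> U" for i using H(1) sub that by auto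
    have "(\<Sum>i\<in>T. \<Sum>j\<in>T. H i j * \<bar>x i * x j\<bar>) =
        (\<Sum>i\<in>U. \<Sum>j\<in>U. H i j * \<bar>x i * x j\<bar>) + (\<Sum>j\<in>U. H v j * (2 * \<bar>x v * x j\<bar>))"
    proof -
      have "(\<Sum>i\<in>U. H i v * \<bar>x i * x v\<bar>) = (\<Sum>j\<in>U. H v j * \<bar>x v * x j\<bar>)"
        by (intro sum.cong refl) (simp add: sym mult.commute)
      moreover have "(\<Sum>j\<in>U. H v j * (2 * \<bar>x v * x j\<bar>)) =
          (\<Sum>j\<in>U. H v j * \<bar>x v * x j\<bar>) + (\<Sum>j\<in>U. H v j * \<bar>x v * x j\<bar>)"
        unfolding sum.distrib[symmetric] by (intro sum.cong refl) (simp only: mult_2 distrib_left)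
      ultimately show ?thesis unfolding T(1) sum.insert[OF T(3,2)] Hvv sum.distrib by simp
    qed
    also have "(\<Sum>i\<in>U. \<Sum>j\<in>U. H i j * \<bar>x i * x j\<bar>) \<le> (\<Sum>i\<in>U. (\<omega> * \<kappa> + (\<Sum>j\<in>U. H i j) / \<omega>) * (x i)\<^sup>2)"
      using remove.IH[OF v] sub by (simp add: U_def)
    also have "(\<Sum>j\<in>U. H v j * (2 * \<bar>x v * x j\<bar>)) \<le> (\<Sum>j\<in>U. H v j * (\<omega> * (x v)\<^sup>2 + (x j)\<^sup>2 / \<omega>))"
    proof (intro sum_mono mult_left_mono)
      fix j assume "j \<in> U"
      have "0 \<le> (\<omega> * \<bar>x v\<bar> - \<bar>x j\<bar>)\<^sup>2" by simp
      then have "2 * \<omega> * \<bar>x v * x j\<bar> \<le> \<omega>\<^sup>2 * (x v)\<^sup>2 + (x j)\<^sup>2"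
        by (simp add: power2_diff power_mult_distrib abs_mult mult_ac)
      then show "2 * \<bar>x v * x j\<bar> \<le> \<omega> * (x v)\<^sup>2 + (x j)\<^sup>2 / \<omega>"
        using \<omega> by (simp add: field_simps power2_eq_square)
    qed (use H sub in auto)
    also have "\<dots> = \<omega> * (\<Sum>j\<in>T. H v j) * (x v)\<^sup>2 + (\<Sum>i\<in>U. H i v / \<omega> * (x i)\<^sup>2)"
      using T by (simp add: Hvv sym distrib_left sum.distrib sum_distrib_left sum_distrib_right mult_ac)
    also have "\<omega> * (\<Sum>j\<in>T. H v j) * (x v)\<^sup>2 \<le> (\<omega> * \<kappa> + (\<Sum>j\<in>T. H v j) / \<omega>) * (x v)\<^sup>2"
    proof (rule mult_right_mono)
      have "0 \<le> (\<Sum>j\<in>T. H v j) / \<omega>"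
        using \<omega> H(2)[OF sub(1)] remove.prems by (intro divide_nonneg_pos sum_nonneg) auto
      then show "\<omega> * (\<Sum>j\<in>T. H v j) \<le> \<omega> * \<kappa> + (\<Sum>j\<in>T. H v j) / \<omega>"
        using mult_left_mono[OF dv, of \<omega>] \<omega> by linarith
    qed simp
    also have "(\<Sum>i\<in>U. (\<omega> * \<kappa> + (\<Sum>j\<in>U. H i j) / \<omega>) * (x i)\<^sup>2) +
        ((\<omega> * \<kappa> + (\<Sum>j\<in>T. H v j) / \<omega>) * (x v)\<^sup>2 + (\<Sum>i\<in>U. H i v / \<omega> * (x i)\<^sup>2)) =
        (\<Sum>i\<in>T. (\<omega> * \<kappa> + (\<Sum>j\<in>T. H i j) / \<omega>) * (x i)\<^sup>2)"
      using T by (simp add: add_divide_distrib distrib_right sum.distrib)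
    finally show ?case by simp
  qed
  have "(\<Sum>i\<in>V. (\<omega> * \<kappa> + (\<Sum>j\<in>V. H i j) / \<omega>) * (x i)\<^sup>2) \<le> (\<Sum>i\<in>V. (\<omega> * \<kappa> + \<Delta> / \<omega>) * (x i)\<^sup>2)"
    using deg \<omega> by (intro sum_mono mult_right_mono add_left_mono divide_right_mono) auto
  with main[OF order.refl] show ?thesis by (simp add: sum_distrib_left)
qed

text \<open>
If small sets span few edges, then the edges that meet a small set \<open>S\<close> form a degenerate graph, even
though their other ends may be anywhere.  Otherwise, in some \<open>T\<close>, every vertex outside \<open>S\<close> would
have many neighbours in \<open>S\<close>.  If \<open>T - S\<close> is at least as large as \<open>T \<inter> S\<close>, then equally many vertices
of both kinds span too many edges; if it is smaller, then \<open>T\<close> itself is small and spans too many.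
\<close>

lemma touching_graph_degenerate:
  fixes A :: "'a \<Rightarrow> 'a \<Rightarrow> real"
  assumes A: "\<And>i j. i \<in> V \<Longrightarrow> j \<in> V \<Longrightarrow> A i j = A j i"
      "\<And>i j. i \<in> V \<Longrightarrow> j \<in> V \<Longrightarrow> 0 \<le> A i j"
    and V: "finite V" and S: "S \<subseteq> V" "real (card S) * \<theta> \<le> N" and \<kappa>: "(0::real) \<le> \<kappa>" and \<theta>: "0 \<le> \<theta>"
    and sparse: "\<And>T. T \<subseteq> V \<Longrightarrow> T \<noteq> {} \<Longrightarrow> real (card T) * \<theta> \<le> 2 * N \<Longrightarrow>
      (\<Sum>i\<in>T. \<Sum>j\<in>T. A i j) \<le> 2 * \<kappa> * card T"
    and T: "T \<subseteq> V" "T \<noteq> {}"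
  shows "\<exists>v\<in>T. (\<Sum>j\<in>T. if v \<in> S \<or> j \<in> S then A v j else 0) \<le> 4 * \<kappa>"
proof (rule ccontr)
  assume "\<not> ?thesis"
  then have big: "(\<Sum>j\<in>T. if v \<in> S \<or> j \<in> S then A v j else 0) > 4 * \<kappa>" if "v \<in> T" for v
    using that by (auto simp: not_le)
  define S' where "S' = T \<inter> S"
  define R where "R = T - S"
  have fin: "finite T" "finite S'" "finite R"
    using finite_subset[OF T(1) V] by (auto simp: S'_def R_def)
  have sub: "S' \<subseteq> V" "R \<subseteq> V" using T by (auto simp: S'_def R_def)
  have cS': "real (card S') * \<theta> \<le> N"
  proof -
    have "card S' \<le> card S"
      using S(1) V by (intro card_mono) (auto simp: S'_def intro: finite_subset)
    then show ?thesis using S(2) \<theta> by (meson mult_right_mono of_nat_mono order_trans)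
  qed
  have R_big: "(\<Sum>j\<in>S'. A v j) > 4 * \<kappa>" if v: "v \<in> R" for v
  proof -
    have "(\<Sum>j\<in>T. if v \<in> S \<or> j \<in> S then A v j else 0) = (\<Sum>j\<in>S'. A v j)"
      unfolding S'_def using v fin(1) by (subst sum.inter_restrict) (auto simp: R_def)
    then show ?thesis using big[of v] v by (simp add: R_def)
  qed
  show False
  proof (cases "card S' \<le> card R")
    case True
    have "S' \<noteq> {}"
    proof
      assume "S' = {}"
      then have "R = T" by (auto simp: S'_def R_def)
      then obtain v where "v \<in> R" using T by auto
      from R_big[OF this] \<open>S' = {}\<close> \<kappa> show False by simp
    qed
    then have c0: "card S' > 0" using fin by (simp add: card_gt_0_iff)
    from True obtain R' where R': "R' \<subseteq> R" "card R' = card S'"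
      by (meson obtain_subset_with_card_n)
    have finR': "finite R'" using R' fin by (auto intro: finite_subset)
    have disj: "S' \<inter> R' = {}" using R' by (auto simp: S'_def R_def)
    have card: "card (S' \<union> R') = 2 * card S'"
      using R' finR' fin disj by (simp add: card_Un_disjoint)
    have subU: "S' \<union> R' \<subseteq> V" using sub R' by auto
    have "8 * \<kappa> * card S' = 2 * (\<Sum>v\<in>R'. 4 * \<kappa>)" using R' by simp
    also have "\<dots> < 2 * (\<Sum>v\<in>R'. \<Sum>j\<in>S'. A v j)"
    proof -
      have "(\<Sum>v\<in>R'. 4 * \<kappa>) < (\<Sum>v\<in>R'. \<Sum>j\<in>S'. A v j)"
        using R' R_big c0 finR' by (intro sum_strict_mono) auto
      then show ?thesis by linarith
    qed
    also have "\<dots> = (\<Sum>v\<in>R'. \<Sum>j\<in>S'. A v j) + (\<Sum>j\<in>S'. \<Sum>v\<in>R'. A j v)"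
    proof -
      have "(\<Sum>v\<in>R'. \<Sum>j\<in>S'. A v j) = (\<Sum>j\<in>S'. \<Sum>v\<in>R'. A v j)" by (rule sum.swap)
      also have "\<dots> = (\<Sum>j\<in>S'. \<Sum>v\<in>R'. A j v)"
        by (intro sum.cong refl A) (use subU in auto)
      finally show ?thesis by simp
    qed
    also have "\<dots> \<le> (\<Sum>v\<in>S' \<union> R'. \<Sum>j\<in>S' \<union> R'. A v j)"
    proof -
      have nn: "0 \<le> (\<Sum>v\<in>X. \<Sum>j\<in>Z. A v j)" if "X \<subseteq> V" "Z \<subseteq> V" for X Z
        using that A(2) by (intro sum_nonneg) auto
      have "(\<Sum>v\<in>S' \<union> R'. \<Sum>j\<in>S' \<union> R'. A v j) =
          (\<Sum>v\<in>S'. \<Sum>j\<in>S'. A v j) + (\<Sum>v\<in>S'. \<Sum>j\<in>R'. A v j) +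
          ((\<Sum>v\<in>R'. \<Sum>j\<in>S'. A v j) + (\<Sum>v\<in>R'. \<Sum>j\<in>R'. A v j))"
        by (simp add: sum.union_disjoint[OF fin(2) finR' disj] sum.distrib)
      moreover have "0 \<le> (\<Sum>v\<in>S'. \<Sum>j\<in>S'. A v j)" "0 \<le> (\<Sum>v\<in>R'. \<Sum>j\<in>R'. A v j)"
        using subU by (auto intro!: nn)
      ultimately show ?thesis by linarith
    qed
    also have "\<dots> \<le> 2 * \<kappa> * card (S' \<union> R')"
    proof (rule sparse[OF subU])
      show "S' \<union> R' \<noteq> {}" using \<open>S' \<noteq> {}\<close> by simp
      show "real (card (S' \<union> R')) * \<theta> \<le> 2 * N" using cS' by (simp add: card)
    qed
    also have "\<dots> \<le> 8 * \<kappa> * card S'" using \<kappa> by (simp add: card)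
    finally show False by simp
  next
    case False
    have "card T = card S' + card R"
      using card_Un_disjoint[OF fin(2,3)] by (simp add: S'_def R_def Int_Diff Un_Diff_Int Un_commute)
        (metis Int_Diff Diff_disjoint Int_Diff_Un inf.commute inf_bot_right)
    then have "real (card T) \<le> 2 * real (card S')" using False by simp
    then have "real (card T) * \<theta> \<le> 2 * N"
      using mult_right_mono[of "real (card T)" "2 * real (card S')" \<theta>] cS' \<theta> by linarith
    from sparse[OF T this] have "(\<Sum>v\<in>T. \<Sum>j\<in>T. A v j) \<le> 2 * \<kappa> * card T" .
    moreover have "(\<Sum>v\<in>T. 4 * \<kappa>) < (\<Sum>v\<in>T. \<Sum>j\<in>T. A v j)"
    proof (rule sum_strict_mono[OF fin(1) T(2)])
      fix v assume v: "v \<in> T"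
      have "(\<Sum>j\<in>T. if v \<in> S \<or> j \<in> S then A v j else 0) \<le> (\<Sum>j\<in>T. A v j)"
        using A(2) T v by (intro sum_mono) (auto simp: subset_iff)
      with big[OF v] show "4 * \<kappa> < (\<Sum>j\<in>T. A v j)" by linarith
    qed
    moreover have "(\<Sum>v\<in>T. 4 * \<kappa>) = 2 * (2 * \<kappa> * card T)" "0 \<le> 2 * \<kappa> * card T"
      using \<kappa> by simp_all
    ultimately show False by linarith
  qed
qed

section \<open>The spectrum of the certificate of a typical graph\<close>

text \<open>
Only vectors with small entries need probability (the assumption \<open>flat\<close>).  An integer vector \<open>m\<close>
in the ball has at most \<open>n / \<theta>\<close> entries with \<open>m\<^sub>i\<^sup>2 > 36 \<theta>\<close>, so the entries of \<open>A\<close> that involve one of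
these form a degenerate graph, and the matching entries of the mean \<open>P\<close> contribute little because
the sum of these \<open>|m\<^sub>i|\<close> is at most \<open>6 n / sqrt \<theta>\<close>.
\<close>

lemma centered_form_bound_on_integers:
  fixes A P :: "nat \<Rightarrow> nat \<Rightarrow> real" and \<theta> \<kappa> \<omega> \<beta> :: real and m :: "nat \<Rightarrow> int"
  assumes A: "\<And>i j. A i j = A j i" "\<And>i j. 0 \<le> A i j" "\<And>i. A i i = 0"
    and P: "\<And>i j. 0 \<le> P i j" "\<And>i j. P i j \<le> (pm::real)"
    and deg: "\<And>i. i < n \<Longrightarrow> (\<Sum>j<n. A i j) \<le> \<Delta>"
    and sparse: "\<And>T. T \<subseteq> {..<n} \<Longrightarrow> T \<noteq> {} \<Longrightarrow> real (card T) * \<theta> \<le> 2 * real n \<Longrightarrow>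
      (\<Sum>i\<in>T. \<Sum>j\<in>T. A i j) \<le> 2 * \<kappa> * card T"
    and flat: "\<And>m::nat \<Rightarrow> int. (\<Sum>i<n. (m i)\<^sup>2) \<le> 36 * int n \<Longrightarrow>
      (\<forall>i<n. of_int ((m i)\<^sup>2) \<le> 36 * \<theta>) \<Longrightarrow>
      \<bar>quad_form n (\<lambda>i j. A i j - P i j) (\<lambda>i. of_int (m i))\<bar> \<le> \<beta> * (36 * real n)"
    and pos: "\<theta> > 0" "\<omega> > 0" "(0::real) \<le> \<kappa>"
    and m: "(\<Sum>i<n. (m i)\<^sup>2) \<le> 36 * int n"
  shows "\<bar>quad_form n (\<lambda>i j. A i j - P i j) (\<lambda>i. of_int (m i))\<bar> \<le>
    (\<beta> + (4 * \<omega> * \<kappa> + \<Delta> / \<omega>) + 12 * pm * real n / sqrt \<theta>) * (36 * real n)"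
proof -
  define x where "x = (\<lambda>i. of_int (m i) :: real)"
  define S where "S = {i. i < n \<and> (x i)\<^sup>2 > 36 * \<theta>}"
  define m' where "m' = (\<lambda>i. if i \<in> S then 0 else m i)"
  define H where "H = (\<lambda>i j. if i \<in> S \<or> j \<in> S then A i j else 0)"
  define Q where "Q = (\<lambda>i j. if i \<in> S \<or> j \<in> S then P i j else 0)"
  have S: "S \<subseteq> {..<n}" "finite S" by (auto simp: S_def)
  have "of_int (\<Sum>i<n. (m i)\<^sup>2) \<le> (of_int (36 * int n) :: real)" using m by (simp only: of_int_le_iff)
  then have x_norm: "(\<Sum>i<n. (x i)\<^sup>2) \<le> 36 * real n" by (simp add: x_def)
  have S_norm: "(\<Sum>i\<in>S. (x i)\<^sup>2) \<le> 36 * real n"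
    using sum_mono2[of "{..<n}" S "\<lambda>i. (x i)\<^sup>2"] S x_norm by auto
  have "real (card S) * (36 * \<theta>) \<le> (\<Sum>i\<in>S. (x i)\<^sup>2)"
    unfolding of_nat_mult[symmetric] sum_constant[symmetric] by (intro sum_mono) (auto simp: S_def)
  then have card_S: "real (card S) * \<theta> \<le> real n" using S_norm by simp

  have split: "quad_form n (\<lambda>i j. A i j - P i j) x =
      quad_form n (\<lambda>i j. A i j - P i j) (\<lambda>i. of_int (m' i)) +
      (\<Sum>i<n. \<Sum>j<n. H i j * (x i * x j)) - (\<Sum>i<n. \<Sum>j<n. Q i j * (x i * x j))"
    unfolding quad_form_def sum.distrib[symmetric] sum_subtractf[symmetric]
    by (intro sum.cong refl) (auto simp: m'_def H_def Q_def x_def algebra_simps)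
  have "\<bar>quad_form n (\<lambda>i j. A i j - P i j) (\<lambda>i. of_int (m' i))\<bar> \<le> \<beta> * (36 * real n)"
  proof (rule flat)
    have "(\<Sum>i<n. (m' i)\<^sup>2) \<le> (\<Sum>i<n. (m i)\<^sup>2)" by (intro sum_mono) (auto simp: m'_def)
    then show "(\<Sum>i<n. (m' i)\<^sup>2) \<le> 36 * int n" using m by linarith
    show "\<forall>i<n. of_int ((m' i)\<^sup>2) \<le> 36 * \<theta>"
      using pos by (auto simp: m'_def S_def x_def not_less)
  qed
  moreover have "\<bar>\<Sum>i<n. \<Sum>j<n. H i j * (x i * x j)\<bar> \<le> (4 * \<omega> * \<kappa> + \<Delta> / \<omega>) * (36 * real n)"
  proof -
    have "\<bar>\<Sum>i<n. \<Sum>j<n. H i j * (x i * x j)\<bar> \<le> (\<Sum>i<n. \<Sum>j<n. H i j * \<bar>x i * x j\<bar>)"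
    proof (intro order.trans[OF sum_abs] sum_mono)
      fix i j
      show "\<bar>H i j * (x i * x j)\<bar> \<le> H i j * \<bar>x i * x j\<bar>"
        using A(2)[of i j] by (simp add: H_def abs_mult)
    qed
    also have "\<dots> \<le> (\<omega> * (4 * \<kappa>) + \<Delta> / \<omega>) * (\<Sum>i<n. (x i)\<^sup>2)"
    proof (rule quad_form_bound_by_peeling)
      show "H i j = H j i" "0 \<le> H i j" for i j using A by (auto simp: H_def)
      show "H i i = 0" for i using A by (auto simp: H_def)
      show "\<exists>v\<in>T. (\<Sum>j\<in>T. H v j) \<le> 4 * \<kappa>" if "T \<subseteq> {..<n}" "T \<noteq> {}" for T
        unfolding H_def
        by (rule touching_graph_degenerate[of "{..<n}" A S \<theta> "real n" \<kappa> T])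
          (use A S card_S pos sparse that in auto)
      show "(\<Sum>j<n. H i j) \<le> \<Delta>" if "i \<in> {..<n}" for i
        using deg[of i] that sum_mono[of "{..<n}" "H i" "A i"] A(2) by (force simp: H_def)
    qed (use pos in auto)
    also have "\<dots> \<le> (\<omega> * (4 * \<kappa>) + \<Delta> / \<omega>) * (36 * real n)"
    proof (cases "n = 0")
      case False
      have "0 \<le> (\<Sum>j<n. A 0 j)" using A by (intro sum_nonneg) auto
      then have "0 \<le> \<Delta>" using deg[of 0] False by simp
      then show ?thesis using x_norm pos by (intro mult_left_mono) auto
    qed simp
    finally show ?thesis by (simp add: mult_ac)
  qed
  moreover have "\<bar>\<Sum>i<n. \<Sum>j<n. Q i j * (x i * x j)\<bar> \<le> 12 * pm * real n / sqrt \<theta> * (36 * real n)"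
  proof -
    have pm: "0 \<le> pm" using P[of 0 0] by linarith
    have x1: "\<bar>x i\<bar> \<le> (x i)\<^sup>2" for i
    proof -
      have "(of_int \<bar>m i\<bar> :: real) \<le> of_int ((m i)\<^sup>2)" by (simp only: of_int_le_iff abs_int_le_square)
      then show ?thesis by (simp add: x_def)
    qed
    have x2: "\<bar>x i\<bar> \<le> (x i)\<^sup>2 / (6 * sqrt \<theta>)" if "i \<in> S" for i
    proof -
      have "(6 * sqrt \<theta>)\<^sup>2 \<le> \<bar>x i\<bar>\<^sup>2" using that pos by (simp add: S_def power_mult_distrib)
      then have "6 * sqrt \<theta> \<le> \<bar>x i\<bar>" by (rule power2_le_imp_le) simp
      then have "6 * sqrt \<theta> * \<bar>x i\<bar> \<le> \<bar>x i\<bar> * \<bar>x i\<bar>" by (intro mult_right_mono) auto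
      then show ?thesis using pos by (simp add: field_simps power2_eq_square)
    qed
    have l1: "(\<Sum>i<n. \<bar>x i\<bar>) \<le> 36 * real n"
      using sum_mono[of "{..<n}" "\<lambda>i. \<bar>x i\<bar>" "\<lambda>i. (x i)\<^sup>2"] x1 x_norm by auto
    have "(\<Sum>i\<in>S. \<bar>x i\<bar>) \<le> (\<Sum>i\<in>S. (x i)\<^sup>2) / (6 * sqrt \<theta>)"
      unfolding sum_divide_distrib by (intro sum_mono x2)
    also have "\<dots> \<le> 36 * real n / (6 * sqrt \<theta>)"
      using S_norm pos by (intro divide_right_mono) auto
    finally have lS: "(\<Sum>i\<in>S. \<bar>x i\<bar>) \<le> 6 * real n / sqrt \<theta>" by simp
    have "\<bar>\<Sum>i<n. \<Sum>j<n. Q i j * (x i * x j)\<bar> \<le>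
        (\<Sum>i<n. \<Sum>j<n. pm * (of_bool (i \<in> S) * \<bar>x i\<bar> * \<bar>x j\<bar>) + pm * (of_bool (j \<in> S) * \<bar>x j\<bar> * \<bar>x i\<bar>))"
    proof (intro order.trans[OF sum_abs] sum_mono)
      fix i j
      have "Q i j \<le> of_bool (i \<in> S) * pm + of_bool (j \<in> S) * pm" "0 \<le> Q i j"
        using P[of i j] pm by (auto simp: Q_def)
      then have "Q i j * \<bar>x i * x j\<bar> \<le> (of_bool (i \<in> S) * pm + of_bool (j \<in> S) * pm) * \<bar>x i * x j\<bar>"
        by (intro mult_right_mono) auto
      then show "\<bar>Q i j * (x i * x j)\<bar> \<le>
          pm * (of_bool (i \<in> S) * \<bar>x i\<bar> * \<bar>x j\<bar>) + pm * (of_bool (j \<in> S) * \<bar>x j\<bar> * \<bar>x i\<bar>)"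
        using \<open>0 \<le> Q i j\<close> by (simp add: abs_mult algebra_simps)
    qed
    also have "\<dots> = 2 * pm * ((\<Sum>i\<in>S. \<bar>x i\<bar>) * (\<Sum>j<n. \<bar>x j\<bar>))"
    proof -
      have SS: "(\<Sum>i\<in>S. \<bar>x i\<bar>) = (\<Sum>i<n. of_bool (i \<in> S) * \<bar>x i\<bar>)"
        using S by (intro sum.mono_neutral_cong_left) auto
      have "(\<Sum>i<n. \<Sum>j<n. of_bool (i \<in> S) * \<bar>x i\<bar> * \<bar>x j\<bar>) = (\<Sum>i\<in>S. \<bar>x i\<bar>) * (\<Sum>j<n. \<bar>x j\<bar>)"
        unfolding SS sum_product ..
      moreover have "(\<Sum>i<n. \<Sum>j<n. of_bool (j \<in> S) * \<bar>x j\<bar> * \<bar>x i\<bar>) =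
          (\<Sum>i\<in>S. \<bar>x i\<bar>) * (\<Sum>j<n. \<bar>x j\<bar>)"
        unfolding SS sum_product by (rule sum.swap)
      ultimately show ?thesis unfolding sum.distrib sum_distrib_left[symmetric] by simp
    qed
    also have "\<dots> \<le> 2 * pm * (6 * real n / sqrt \<theta> * (36 * real n))"
      using lS l1 pm pos by (intro mult_left_mono mult_mono) (auto intro: sum_nonneg)
    finally show ?thesis by simp
  qed
  ultimately show ?thesis
    unfolding x_def[symmetric] split by (simp add: distrib_right)
qed

text \<open>
The mean of the adjacency matrix is \<open>(p + q)/2 J + (p - q)/2 s s\<^sup>T - p I\<close>, with \<open>J\<close> the all-ones matrix.
\<close>

lemma block_form:
  assumes s: "\<And>i. i < n \<Longrightarrow> s i = 1 \<or> s i = (-1::real)"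
  shows "quad_form n (\<lambda>i j. if i = j then 0 else if s i = s j then p else q) x =
    (p + q) / 2 * (\<Sum>i<n. x i)\<^sup>2 + (p - q) / 2 * (\<Sum>i<n. s i * x i)\<^sup>2 - p * (\<Sum>i<n. (x i)\<^sup>2)"
proof -
  have sq: "(\<Sum>i<n. \<Sum>j<n. c * (f i * f j)) = c * (\<Sum>i<n. f i)\<^sup>2" for c :: real and f
    unfolding power2_eq_square sum_product by (simp only: sum_distrib_left)
  have "quad_form n (\<lambda>i j. if i = j then 0 else if s i = s j then p else q) x =
      (\<Sum>i<n. \<Sum>j<n. (p + q) / 2 * (x i * x j) + (p - q) / 2 * ((s i * x i) * (s j * x j))
         - (if i = j then p * (x j)\<^sup>2 else 0))"
    unfolding quad_form_def
  proof (intro sum.cong refl)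
    fix i j assume "i \<in> {..<n}" "j \<in> {..<n}"
    then have "s i = 1 \<or> s i = -1" "s j = 1 \<or> s j = -1" using s by auto
    then show "(if i = j then 0 else if s i = s j then p else q) * (x i * x j) =
        (p + q) / 2 * (x i * x j) + (p - q) / 2 * ((s i * x i) * (s j * x j))
         - (if i = j then p * (x j)\<^sup>2 else 0)"
      by (auto simp: field_simps power2_eq_square)
  qed
  also have "\<dots> = (p + q) / 2 * (\<Sum>i<n. x i)\<^sup>2 + (p - q) / 2 * (\<Sum>i<n. s i * x i)\<^sup>2 - p * (\<Sum>i<n. (x i)\<^sup>2)"
    unfolding sum.distrib sum_subtractf sq[of "(p + q) / 2" x] sq[of "(p - q) / 2" "\<lambda>i. s i * x i"]
    by (simp flip: sum_distrib_left)
  finally show ?thesis .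
qed

text \<open>
On the complement of \<open>s\<close> the term \<open>s s\<^sup>T\<close> of the mean disappears.  The other choice of the shift
\<open>t\<close>, the empirical mean of \<open>A\<close>, differs from \<open>(p + q)/2\<close> by at most \<open>(p + \<beta>) / n\<close>,
because this difference is read off from the centred form at the all-ones vector.
The shift leaves the diagonal of the certificate unchanged since the blocks have equal size.
\<close>

lemma cert_form_bounds:
  fixes p q t :: real and A :: "nat \<Rightarrow> nat \<Rightarrow> real"
  assumes s: "\<And>i. i < n \<Longrightarrow> s i = 1 \<or> s i = (-1::real)" "(\<Sum>i<n. s i) = 0" and n: "n > 0"
  defines "P \<equiv> \<lambda>i j. if i = j then 0 else if s i = s j then p else q"
  assumes W: "\<And>x. \<bar>quad_form n (\<lambda>i j. A i j - P i j) x\<bar> \<le> \<beta> * (\<Sum>i<n. (x i)\<^sup>2)"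
    and D: "\<And>i. i < n \<Longrightarrow> \<delta> \<le> (\<Sum>j<n. A i j * (s i * s j))"
           "\<And>i. i < n \<Longrightarrow> (\<Sum>j<n. A i j * (s i * s j)) \<le> \<Delta>"
    and p: "0 \<le> p" and t: "t = (p + q) / 2 \<or> t = (\<Sum>i<n. \<Sum>j<n. A i j) / (real n)\<^sup>2"
    and x: "(\<Sum>i<n. s i * x i) = 0"
  shows "(\<delta> - 2 * \<beta>) * (\<Sum>i<n. (x i)\<^sup>2) \<le> cert_form n (\<lambda>i j. A i j - t) s x \<and>
    cert_form n (\<lambda>i j. A i j - t) s x \<le> (\<Delta> + 2 * \<beta> + 2 * p) * (\<Sum>i<n. (x i)\<^sup>2)"
proof -
  let ?N = "\<Sum>i<n. (x i)\<^sup>2"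
  have W1: "\<bar>quad_form n (\<lambda>i j. A i j - P i j) (\<lambda>_. 1)\<bar> \<le> \<beta> * n" using W[of "\<lambda>_. 1"] by simp
  have A_eq: "quad_form n A y = quad_form n (\<lambda>i j. A i j - P i j) y + quad_form n P y" for y
    by (simp add: quad_form_def sum_subtractf algebra_simps)
  have P_form: "quad_form n P y =
    (p + q) / 2 * (\<Sum>i<n. y i)\<^sup>2 + (p - q) / 2 * (\<Sum>i<n. s i * y i)\<^sup>2 - p * (\<Sum>i<n. (y i)\<^sup>2)" for y
    unfolding P_def by (rule block_form[OF s(1)])
  have "\<beta> * n \<ge> 0" using W1 by linarith
  then have \<beta>: "\<beta> \<ge> 0" using n by (simp add: zero_le_mult_iff)
  have off: "\<bar>(p + q) / 2 - t\<bar> * n \<le> p + \<beta>"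
    using t
  proof
    assume "t = (\<Sum>i<n. \<Sum>j<n. A i j) / (real n)\<^sup>2"
    moreover have "(\<Sum>i<n. \<Sum>j<n. A i j) = quad_form n A (\<lambda>_. 1)" by (simp add: quad_form_def)
    ultimately have "t = (quad_form n (\<lambda>i j. A i j - P i j) (\<lambda>_. 1) + (p + q) / 2 * (real n)\<^sup>2 - p * n) / (real n)\<^sup>2"
      unfolding A_eq P_form using s by simp
    then have "((p + q) / 2 - t) * n = p - quad_form n (\<lambda>i j. A i j - P i j) (\<lambda>_. 1) / n"
      using n by (simp add: field_simps power2_eq_square)
    moreover have "\<bar>quad_form n (\<lambda>i j. A i j - P i j) (\<lambda>_. 1) / n\<bar> \<le> \<beta>"
      using W1 n by (simp add: field_simps)
    ultimately have "\<bar>((p + q) / 2 - t) * n\<bar> \<le> p + \<beta>" using p by linarith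
    then show ?thesis by (simp add: abs_mult)
  next
    assume "t = (p + q) / 2"
    then have "(p + q) / 2 - t = 0" by simp
    then show ?thesis using p \<beta> by simp
  qed
  have "(\<Sum>i<n. x i)\<^sup>2 \<le> n * ?N"
    using sum_squared_le_sum_of_squares[of x "{..<n}"] by (simp add: mult.commute)
  have diag: "(\<Sum>j<n. (A i j - t) * (s i * s j)) = (\<Sum>j<n. A i j * (s i * s j))" for i
  proof -
    have "(\<Sum>j<n. (A i j - t) * (s i * s j)) = (\<Sum>j<n. A i j * (s i * s j)) - t * s i * (\<Sum>j<n. s j)"
      by (simp add: left_diff_distrib sum_subtractf sum_distrib_left mult.assoc)
    then show ?thesis using s(2) by simp
  qed
  have "quad_form n (\<lambda>i j. A i j - t) x = quad_form n A x - t * (\<Sum>i<n. x i)\<^sup>2"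
  proof -
    have "(\<Sum>i<n. \<Sum>j<n. t * (x i * x j)) = t * (\<Sum>i<n. x i)\<^sup>2"
      unfolding power2_eq_square sum_product by (simp only: sum_distrib_left)
    then show ?thesis by (simp add: quad_form_def left_diff_distrib sum_subtractf)
  qed
  then have form: "cert_form n (\<lambda>i j. A i j - t) s x =
      (\<Sum>i<n. (\<Sum>j<n. A i j * (s i * s j)) * (x i)\<^sup>2) - quad_form n (\<lambda>i j. A i j - P i j) x
      - ((p + q) / 2 - t) * (\<Sum>i<n. x i)\<^sup>2 + p * ?N"
    unfolding cert_form_def diag A_eq P_form x by (simp add: left_diff_distrib)
  have "\<bar>((p + q) / 2 - t) * (\<Sum>i<n. x i)\<^sup>2\<bar> \<le> \<bar>(p + q) / 2 - t\<bar> * (n * ?N)"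
    unfolding abs_mult using \<open>(\<Sum>i<n. x i)\<^sup>2 \<le> n * ?N\<close> by (intro mult_left_mono) auto
  also have "\<dots> \<le> (p + \<beta>) * ?N"
    using mult_right_mono[OF off, of ?N] by (simp add: sum_nonneg mult_ac)
  finally have "\<bar>((p + q) / 2 - t) * (\<Sum>i<n. x i)\<^sup>2\<bar> \<le> p * ?N + \<beta> * ?N" by (simp add: distrib_right)
  moreover have "\<delta> * ?N \<le> (\<Sum>i<n. (\<Sum>j<n. A i j * (s i * s j)) * (x i)\<^sup>2)"
    unfolding sum_distrib_left using D by (intro sum_mono mult_right_mono) auto
  moreover have "(\<Sum>i<n. (\<Sum>j<n. A i j * (s i * s j)) * (x i)\<^sup>2) \<le> \<Delta> * ?N"
    unfolding sum_distrib_left using D by (intro sum_mono mult_right_mono) auto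
  ultimately show ?thesis
    using W[of x] unfolding form by (simp add: distrib_right left_diff_distrib) linarith
qed

section \<open>Large deviations of the random graph\<close>

text \<open>
The entries of the mean of the adjacency matrix.
\<close>

definition edge_prob :: "(nat \<Rightarrow> real) \<Rightarrow> real \<Rightarrow> real \<Rightarrow> nat \<Rightarrow> nat \<Rightarrow> real" where
  "edge_prob s p q i j = (if i = j then 0 else if s i = s j then p else q)"

definition edge_coins :: "nat \<Rightarrow> (nat \<Rightarrow> real) \<Rightarrow> real \<Rightarrow> real \<Rightarrow> (nat \<times> nat \<Rightarrow> bool) pmf" where
  "edge_coins n s p q =
    Pi_pmf (edge_slots n) False (\<lambda>(i, j). bernoulli_pmf (if s i = s j then p else q))"

definition edge :: "(nat \<times> nat \<Rightarrow> bool) \<Rightarrow> nat \<Rightarrow> nat \<Rightarrow> real" where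
  "edge e i j = of_bool (i \<noteq> j \<and> e (min i j, max i j))"

lemma edge_sym: "edge e i j = edge e j i"
  by (auto simp: edge_def min.commute max.commute)

lemma edge_nonneg: "0 \<le> edge e i j" and edge_diag: "edge e i i = 0"
  by (simp_all add: edge_def)

lemma finite_edge_slots: "finite (edge_slots n)"
  by (rule finite_subset[of _ "{..<n} \<times> {..<n}"]) (auto simp: edge_slots_def)

text \<open>
The moment generating function of independent coins, Markov's inequality and \<open>1 + x \<le> exp x\<close>.
The usual optimisation parameter is absorbed into \<open>c\<close> and \<open>t\<close>.
\<close>

lemma chernoff_bernoulli_product:
  fixes c \<pi> :: "'a \<Rightarrow> real"
  assumes E: "finite E" and \<pi>: "\<And>x. x \<in> E \<Longrightarrow> 0 \<le> \<pi> x" "\<And>x. x \<in> E \<Longrightarrow> \<pi> x \<le> 1"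
  shows "measure_pmf.prob (Pi_pmf E False (\<lambda>x. bernoulli_pmf (\<pi> x)))
      {e. t \<le> (\<Sum>x\<in>E. c x * of_bool (e x))} \<le> exp ((\<Sum>x\<in>E. \<pi> x * (exp (c x) - 1)) - t)"
proof -
  let ?M = "Pi_pmf E False (\<lambda>x. bernoulli_pmf (\<pi> x))"
  define X where "X = (\<lambda>e. \<Sum>x\<in>E. c x * of_bool (e x))"
  have X_le: "X e \<le> (\<Sum>x\<in>E. \<bar>c x\<bar>)" for e
    unfolding X_def by (intro sum_mono) auto
  have int: "integrable ?M (\<lambda>e. exp (X e))"
    by (rule measure_pmf.integrable_const_bound[where B = "exp (\<Sum>x\<in>E. \<bar>c x\<bar>)"])
      (use X_le in auto)
  have "measure_pmf.prob ?M {e. t \<le> X e} = measure_pmf.expectation ?M (indicator {e. t \<le> X e})"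
    by simp
  also have "\<dots> \<le> measure_pmf.expectation ?M (\<lambda>e. exp (X e) * exp (- t))"
  proof (rule integral_mono)
    show "integrable ?M (\<lambda>e. exp (X e) * exp (- t))" using int by simp
    show "indicator {e. t \<le> X e} e \<le> exp (X e) * exp (- t)" for e
      by (auto simp: indicator_def simp flip: exp_add)
  qed (auto intro: measure_pmf.integrable_const_bound[where B = 1])
  also have "\<dots> = measure_pmf.expectation ?M (\<lambda>e. exp (X e)) * exp (- t)"
    by simp
  also have "measure_pmf.expectation ?M (\<lambda>e. exp (X e)) =
      measure_pmf.expectation ?M (\<lambda>e. \<Prod>x\<in>E. exp (c x * of_bool (e x)))"
    by (simp add: X_def exp_sum[OF E])
  also have "\<dots> = (\<Prod>x\<in>E. measure_pmf.expectation (bernoulli_pmf (\<pi> x)) (\<lambda>b. exp (c x * of_bool b)))"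
    by (rule expectation_prod_Pi_pmf[OF E]) (auto intro: integrable_measure_pmf_finite)
  also have "\<dots> = (\<Prod>x\<in>E. 1 + \<pi> x * (exp (c x) - 1))"
    by (intro prod.cong refl) (use \<pi> in \<open>auto simp: algebra_simps\<close>)
  also have "\<dots> \<le> (\<Prod>x\<in>E. exp (\<pi> x * (exp (c x) - 1)))"
  proof (intro prod_mono conjI)
    fix x assume x: "x \<in> E"
    have "0 \<le> (1 - \<pi> x) + \<pi> x * exp (c x)" using \<pi>[OF x] by simp
    then show "0 \<le> 1 + \<pi> x * (exp (c x) - 1)" by (simp add: algebra_simps)
    show "1 + \<pi> x * (exp (c x) - 1) \<le> exp (\<pi> x * (exp (c x) - 1))" by (rule exp_ge_add_one_self)
  qed
  also have "\<dots> = exp (\<Sum>x\<in>E. \<pi> x * (exp (c x) - 1))" by (simp add: exp_sum[OF E])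
  finally show ?thesis unfolding X_def by (simp add: exp_diff exp_minus divide_inverse mult_ac)
qed

lemma sum_edge_slots:
  fixes F :: "nat \<Rightarrow> nat \<Rightarrow> real"
  assumes sym: "\<And>i j. i < n \<Longrightarrow> j < n \<Longrightarrow> F i j = F j i" and diag: "\<And>i. i < n \<Longrightarrow> F i i = 0"
  shows "(\<Sum>i<n. \<Sum>j<n. F i j) = 2 * (\<Sum>(i, j)\<in>edge_slots n. F i j)"
proof -
  let ?E = "edge_slots n"
  have sub: "?E \<union> prod.swap ` ?E \<subseteq> {..<n} \<times> {..<n}" by (auto simp: edge_slots_def)
  have off: "x \<in> {..<n} \<times> {..<n} - (?E \<union> prod.swap ` ?E) \<Longrightarrow> fst x = snd x" for x
    by (cases x) (force simp: edge_slots_def image_iff)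
  have "(\<Sum>i<n. \<Sum>j<n. F i j) = (\<Sum>(i, j)\<in>{..<n} \<times> {..<n}. F i j)"
    by (simp add: sum.cartesian_product)
  also have "\<dots> = (\<Sum>(i, j)\<in>?E \<union> prod.swap ` ?E. F i j)"
    by (rule sum.mono_neutral_right[OF _ sub]) (use off diag in \<open>fastforce+\<close>)
  also have "\<dots> = (\<Sum>(i, j)\<in>?E. F i j) + (\<Sum>(i, j)\<in>prod.swap ` ?E. F i j)"
    by (rule sum.union_disjoint) (auto simp: finite_edge_slots, auto simp: edge_slots_def)
  also have "(\<Sum>(i, j)\<in>prod.swap ` ?E. F i j) = (\<Sum>(i, j)\<in>?E. F j i)"
    by (subst sum.reindex) (auto simp: case_prod_unfold)
  also have "\<dots> = (\<Sum>(i, j)\<in>?E. F i j)"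
    by (intro sum.cong refl) (auto simp: edge_slots_def intro: sym)
  finally show ?thesis by simp
qed

text \<open>
The same inequality for sums over ordered pairs.  Each edge is counted twice, which accounts for
\<open>2 c\<close> in the exponential and for the halved sum.
\<close>

lemma chernoff_edge_coins:
  assumes pq: "0 \<le> p" "p \<le> 1" "0 \<le> q" "q \<le> 1"
    and c: "\<And>i j. i < n \<Longrightarrow> j < n \<Longrightarrow> c i j = c j i"
  shows "measure_pmf.prob (edge_coins n s p q) {e. t \<le> (\<Sum>i<n. \<Sum>j<n. c i j * edge e i j)} \<le>
    exp ((\<Sum>i<n. \<Sum>j<n. edge_prob s p q i j * (exp (2 * c i j) - 1)) / 2 - t)"
proof -
  let ?\<pi> = "\<lambda>(i, j). if s i = s j then p else q"
  have 1: "(\<Sum>i<n. \<Sum>j<n. c i j * edge e i j) =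
      (\<Sum>x\<in>edge_slots n. (case x of (i, j) \<Rightarrow> 2 * c i j) * of_bool (e x))" for e
  proof -
    have "(\<Sum>i<n. \<Sum>j<n. c i j * edge e i j) = 2 * (\<Sum>(i, j)\<in>edge_slots n. c i j * edge e i j)"
      by (rule sum_edge_slots) (auto simp: c edge_sym edge_diag)
    also have "\<dots> = (\<Sum>x\<in>edge_slots n. (case x of (i, j) \<Rightarrow> 2 * c i j) * of_bool (e x))"
      unfolding sum_distrib_left by (intro sum.cong refl) (auto simp: edge_slots_def edge_def)
    finally show ?thesis .
  qed
  have 2: "(\<Sum>i<n. \<Sum>j<n. edge_prob s p q i j * (exp (2 * c i j) - 1)) / 2 =
      (\<Sum>x\<in>edge_slots n. ?\<pi> x * (exp (case x of (i, j) \<Rightarrow> 2 * c i j) - 1))"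
  proof -
    have "(\<Sum>i<n. \<Sum>j<n. edge_prob s p q i j * (exp (2 * c i j) - 1)) =
        2 * (\<Sum>(i, j)\<in>edge_slots n. edge_prob s p q i j * (exp (2 * c i j) - 1))"
      by (rule sum_edge_slots) (auto simp: c edge_prob_def)
    also have "(\<Sum>(i, j)\<in>edge_slots n. edge_prob s p q i j * (exp (2 * c i j) - 1)) =
        (\<Sum>x\<in>edge_slots n. ?\<pi> x * (exp (case x of (i, j) \<Rightarrow> 2 * c i j) - 1))"
      by (intro sum.cong refl) (auto simp: edge_slots_def edge_prob_def)
    finally show ?thesis by simp
  qed
  have "edge_coins n s p q = Pi_pmf (edge_slots n) False (\<lambda>x. bernoulli_pmf (?\<pi> x))"
    unfolding edge_coins_def by (intro arg_cong[where f = "Pi_pmf _ _"]) (auto simp: fun_eq_iff)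
  then show ?thesis
    unfolding 1 2 by (simp only:) (rule chernoff_bernoulli_product[OF finite_edge_slots]; use pq in auto)
qed

lemma edge_prob_bounds:
  assumes "0 \<le> p" "0 \<le> q" "q \<le> p"
  shows "0 \<le> edge_prob s p q i j" "edge_prob s p q i j \<le> p"
  using assms by (auto simp: edge_prob_def)

text \<open>
The edges at one vertex, obtained from the weights supported on one row and the matching column.
\<close>

lemma chernoff_star:
  assumes pq: "0 \<le> p" "p \<le> 1" "0 \<le> q" "q \<le> 1" and i: "i < n"
  shows "measure_pmf.prob (edge_coins n s p q) {e. t \<le> (\<Sum>j<n. c j * edge e i j)} \<le>
    exp ((\<Sum>j<n. edge_prob s p q i j * (exp (c j) - 1)) - t)"
proof -
  define c' where "c' = (\<lambda>k l. (if k = i then c l else if l = i then c k else 0) / 2)"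
  have star: "(\<Sum>k<n. \<Sum>l<n. if k = i then g l else if l = i then g k else 0) = 2 * (\<Sum>l<n. g l)"
    if "g i = 0" for g :: "nat \<Rightarrow> real"
  proof -
    have "(\<Sum>l<n. if k = i then g l else if l = i then g k else 0) =
        (if k = i then (\<Sum>l<n. g l) else 0) + g k" for k
      using i that by (cases "k = i") auto
    then show ?thesis using i by (simp add: sum.distrib)
  qed
  have 1: "(\<Sum>k<n. \<Sum>l<n. c' k l * edge e k l) = (\<Sum>j<n. c j * edge e i j)" for e
  proof -
    have "(\<Sum>k<n. \<Sum>l<n. c' k l * edge e k l) = (\<Sum>k<n. \<Sum>l<n. if k = i then c l * edge e i l / 2
        else if l = i then c k * edge e i k / 2 else 0)"
      by (intro sum.cong refl) (auto simp: c'_def edge_sym[of e _ i])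
    also have "\<dots> = 2 * (\<Sum>l<n. c l * edge e i l / 2)" by (rule star) (simp add: edge_diag)
    finally show ?thesis by (simp flip: sum_divide_distrib)
  qed
  have 2: "(\<Sum>k<n. \<Sum>l<n. edge_prob s p q k l * (exp (2 * c' k l) - 1)) / 2 =
      (\<Sum>j<n. edge_prob s p q i j * (exp (c j) - 1))"
  proof -
    have sym: "edge_prob s p q k i = edge_prob s p q i k" for k by (auto simp: edge_prob_def)
    have "(\<Sum>k<n. \<Sum>l<n. edge_prob s p q k l * (exp (2 * c' k l) - 1)) =
        (\<Sum>k<n. \<Sum>l<n. if k = i then edge_prob s p q i l * (exp (c l) - 1)
          else if l = i then edge_prob s p q i k * (exp (c k) - 1) else 0)"
      by (intro sum.cong refl) (auto simp: c'_def sym)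
    also have "\<dots> = 2 * (\<Sum>l<n. edge_prob s p q i l * (exp (c l) - 1))"
      by (rule star) (simp add: edge_prob_def)
    finally show ?thesis by simp
  qed
  show ?thesis
    using chernoff_edge_coins[OF pq, of n c' s t] unfolding 1 2 by (force simp: c'_def)
qed

lemma prob_large_degree:
  assumes pq: "0 \<le> p" "p \<le> 1" "0 \<le> q" "q \<le> p" and i: "i < n"
  shows "measure_pmf.prob (edge_coins n s p q) {e. t \<le> (\<Sum>j<n. edge e i j)} \<le> exp (2 * real n * p - t)"
proof -
  have "(\<Sum>j<n. edge_prob s p q i j * (exp 1 - 1)) \<le> (\<Sum>j<n. p * 2)"
    using exp_le edge_prob_bounds[OF pq(1,3,4)] pq by (intro sum_mono mult_mono) auto
  then show ?thesis
    using chernoff_star[of p q i n s t "\<lambda>_. 1"] pq i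
    by (auto elim!: order.trans)
qed

text \<open>
The Chernoff bound with the tilt \<open>\<tau>\<close> against edges inside the own block and in favour of edges to
the other block.  The additional \<open>p\<close> appears since a vertex has only \<open>n/2 - 1\<close> possible neighbours in
its own block.
\<close>

lemma prob_small_margin:
  assumes pq: "0 \<le> p" "p \<le> 1" "0 \<le> q" "q \<le> 1" and i: "i < n"
    and s: "\<And>i. i < n \<Longrightarrow> s i = 1 \<or> s i = -1" "(\<Sum>i<n. s i) = 0"
    and \<tau>: "0 < \<tau>"
  shows "measure_pmf.prob (edge_coins n s p q) {e. (\<Sum>j<n. edge e i j * (s i * s j)) \<le> \<delta>} \<le>
    exp (real n / 2 * (p * (exp (- \<tau>) - 1) + q * (exp \<tau> - 1)) + p + \<tau> * \<delta>)"
proof -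
  have "(\<Sum>j<n. edge_prob s p q i j * (exp (- \<tau> * (s i * s j)) - 1)) =
      (\<Sum>j<n. (p * (exp (- \<tau>) - 1) + q * (exp \<tau> - 1)) / 2
         + (p * (exp (- \<tau>) - 1) - q * (exp \<tau> - 1)) / 2 * s i * s j
         - (if j = i then p * (exp (- \<tau>) - 1) else 0))"
  proof (intro sum.cong refl)
    fix j assume "j \<in> {..<n}"
    then have "s i = 1 \<or> s i = -1" "s j = 1 \<or> s j = -1" using s i by auto
    then show "edge_prob s p q i j * (exp (- \<tau> * (s i * s j)) - 1) =
        (p * (exp (- \<tau>) - 1) + q * (exp \<tau> - 1)) / 2
         + (p * (exp (- \<tau>) - 1) - q * (exp \<tau> - 1)) / 2 * s i * s j
         - (if j = i then p * (exp (- \<tau>) - 1) else 0)"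
      by (auto simp: edge_prob_def field_simps)
  qed
  also have "\<dots> = real n / 2 * (p * (exp (- \<tau>) - 1) + q * (exp \<tau> - 1)) + p * (1 - exp (- \<tau>))"
    unfolding sum.distrib sum_subtractf sum_distrib_left[symmetric] s(2) using i
    by (simp add: field_simps)
  also have "\<dots> \<le> real n / 2 * (p * (exp (- \<tau>) - 1) + q * (exp \<tau> - 1)) + p"
    using pq by (simp add: mult_left_le)
  finally have le: "(\<Sum>j<n. edge_prob s p q i j * (exp (- \<tau> * (s i * s j)) - 1)) \<le> \<dots>" .
  have "{e. (\<Sum>j<n. edge e i j * (s i * s j)) \<le> \<delta>} =
      {e. - \<tau> * \<delta> \<le> (\<Sum>j<n. - \<tau> * (s i * s j) * edge e i j)}"
  proof -
    have "(\<Sum>j<n. - \<tau> * (s i * s j) * edge e i j) = - \<tau> * (\<Sum>j<n. edge e i j * (s i * s j))" for e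
      by (simp add: sum_distrib_left mult_ac)
    then show ?thesis using \<tau> by simp
  qed
  then show ?thesis
    using chernoff_star[OF pq i, of s "- \<tau> * \<delta>" "\<lambda>j. - \<tau> * (s i * s j)"] le
    by (simp only:) (erule order.trans, simp)
qed

lemma prob_dense_subset:
  assumes pq: "0 \<le> p" "p \<le> 1" "0 \<le> q" "q \<le> p" and T: "T \<subseteq> {..<n}" and \<tau>: "0 < \<tau>"
  shows "measure_pmf.prob (edge_coins n s p q) {e. 2 * t \<le> (\<Sum>i\<in>T. \<Sum>j\<in>T. edge e i j)} \<le>
    exp ((real (card T))\<^sup>2 * p * exp \<tau> / 2 - \<tau> * t)"
proof -
  define c where "c = (\<lambda>i j. of_bool (i \<in> T) * (of_bool (j \<in> T) * (\<tau> / 2)))"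
  have inT: "(\<Sum>i<n. of_bool (i \<in> T) * f i) = (\<Sum>i\<in>T. f i)" for f :: "nat \<Rightarrow> real"
    using T by (intro sum.mono_neutral_cong_right) auto
  have "(\<Sum>i<n. \<Sum>j<n. c i j * edge e i j) = \<tau> / 2 * (\<Sum>i\<in>T. \<Sum>j\<in>T. edge e i j)" for e
  proof -
    have "(\<Sum>i<n. \<Sum>j<n. c i j * edge e i j) =
        (\<Sum>i<n. of_bool (i \<in> T) * (\<Sum>j<n. of_bool (j \<in> T) * (\<tau> / 2 * edge e i j)))"
      unfolding c_def sum_distrib_left by (simp add: mult_ac)
    then show ?thesis unfolding inT by (simp add: sum_distrib_left)
  qed
  moreover have "2 * t \<le> w \<longleftrightarrow> \<tau> * t \<le> \<tau> / 2 * w" for w using \<tau> by (simp add: field_simps)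
  ultimately have ev: "{e. 2 * t \<le> (\<Sum>i\<in>T. \<Sum>j\<in>T. edge e i j)} = {e. \<tau> * t \<le> (\<Sum>i<n. \<Sum>j<n. c i j * edge e i j)}"
    by (simp only:)
  have "(\<Sum>i<n. \<Sum>j<n. edge_prob s p q i j * (exp (2 * c i j) - 1)) \<le>
      (\<Sum>i<n. \<Sum>j<n. of_bool (i \<in> T) * (of_bool (j \<in> T) * (p * exp \<tau>)))"
  proof (intro sum_mono)
    fix i j
    have "edge_prob s p q i j * (exp \<tau> - 1) \<le> p * exp \<tau>"
      using edge_prob_bounds[OF pq(1,3,4), of s i j] \<tau> pq by (intro mult_mono) auto
    then show "edge_prob s p q i j * (exp (2 * c i j) - 1) \<le>
        of_bool (i \<in> T) * (of_bool (j \<in> T) * (p * exp \<tau>))"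
      by (auto simp: c_def)
  qed
  also have "\<dots> = (real (card T))\<^sup>2 * p * exp \<tau>"
    unfolding sum_distrib_left[symmetric] inT by (simp add: power2_eq_square)
  finally have "(\<Sum>i<n. \<Sum>j<n. edge_prob s p q i j * (exp (2 * c i j) - 1)) / 2 - \<tau> * t \<le>
      (real (card T))\<^sup>2 * p * exp \<tau> / 2 - \<tau> * t" by simp
  then show ?thesis
    unfolding ev using chernoff_edge_coins[of p q n c s "\<tau> * t"] pq
    by (auto simp: c_def elim!: order.trans)
qed

lemma exp_le_quadratic: "exp x \<le> 1 + x + x\<^sup>2" if "\<bar>x\<bar> \<le> 1" for x :: real
proof (cases "0 \<le> x")
  case True then show ?thesis using that by (intro exp_bound) auto
next
  case False
  define y where "y = - x"
  have y: "0 \<le> y" "y \<le> 1" using False that by (auto simp: y_def)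
  have pos: "0 < 1 - y + y\<^sup>2" using y zero_le_power2[of "y - 1/2"] by (auto simp: power2_eq_square algebra_simps)
  have "1 \<le> (1 - y + y\<^sup>2) * (1 + y + y\<^sup>2 / 2)"
  proof -
    have "(1 - y + y\<^sup>2) * (1 + y + y\<^sup>2 / 2) = 1 + y\<^sup>2 / 2 + y ^ 3 / 2 + y ^ 4 / 2"
      by (simp add: power2_eq_square power3_eq_cube power4_eq_xxxx algebra_simps
        add_divide_distrib diff_divide_distrib)
    then show ?thesis using y by simp
  qed
  also have "\<dots> \<le> (1 - y + y\<^sup>2) * exp y"
    using exp_lower_Taylor_quadratic[OF y(1)] pos by (intro mult_left_mono) auto
  finally have "exp (- y) \<le> 1 - y + y\<^sup>2" by (simp add: exp_minus field_simps)
  then show ?thesis by (simp add: y_def)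
qed

text \<open>
The exponential moment is taken at \<open>h = 1 / (72 \<theta>)\<close>, the largest value for which the weight
\<open>2 h x\<^sub>i x\<^sub>j\<close> of each edge stays at most 1, so that \<open>exp\<close> can be bounded quadratically.  For \<open>\<theta>\<close>
of order \<open>d\<close>, \<open>\<beta>\<close> of the same order and \<open>p\<close> of order \<open>d / n\<close>, the first term in the exponent
is \<open>O(n / d)\<close> and the second is of order \<open>n\<close>; a small ratio of \<open>\<theta>\<close> to \<open>\<beta>\<close> therefore beats the
number of integer vectors in the ball.
\<close>

lemma prob_flat_form:
  assumes pq: "0 \<le> p" "p \<le> 1" "0 \<le> q" "q \<le> p"
    and m: "(\<Sum>i<n. (x i)\<^sup>2) \<le> 36 * real n" "\<And>i. i < n \<Longrightarrow> (x i)\<^sup>2 \<le> 36 * \<theta>"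
    and \<theta>: "0 < \<theta>" and \<sigma>: "\<sigma>\<^sup>2 = 1"
  shows "measure_pmf.prob (edge_coins n s p q)
      {e. \<beta> * (36 * real n) \<le> \<sigma> * quad_form n (\<lambda>i j. edge e i j - edge_prob s p q i j) x} \<le>
    exp (p * (real n)\<^sup>2 / (2 * \<theta>\<^sup>2) - \<beta> * real n / (2 * \<theta>))"
proof -
  define h where "h = 1 / (72 * \<theta>)"
  define c where "c = (\<lambda>i j. h * \<sigma> * (x i * x j))"
  let ?P = "edge_prob s p q"
  define u where "u = h * (\<beta> * (36 * real n))"
  have h: "h > 0" using \<theta> by (simp add: h_def)
  have "h * (\<sigma> * quad_form n (\<lambda>i j. edge e i j - ?P i j) x) =
      (\<Sum>i<n. \<Sum>j<n. c i j * edge e i j) - (\<Sum>i<n. \<Sum>j<n. c i j * ?P i j)" for e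
    unfolding quad_form_def sum_distrib_left sum_subtractf[symmetric]
    by (intro sum.cong refl) (simp add: c_def algebra_simps)
  moreover have "\<beta> * (36 * real n) \<le> w \<longleftrightarrow> u \<le> h * w" for w
    unfolding u_def using h by simp
  ultimately have ev: "{e. \<beta> * (36 * real n) \<le> \<sigma> * quad_form n (\<lambda>i j. edge e i j - ?P i j) x} =
      {e. u + (\<Sum>i<n. \<Sum>j<n. c i j * ?P i j) \<le> (\<Sum>i<n. \<Sum>j<n. c i j * edge e i j)}"
    by (simp add: le_diff_eq)
  have "\<bar>\<sigma>\<bar> = 1" using \<sigma> by (auto simp: power2_eq_1_iff)
  have c_le: "\<bar>2 * c i j\<bar> \<le> 1" if "i < n" "j < n" for i j
  proof -
    have "\<bar>x i * x j\<bar> \<le> 36 * \<theta>"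
      using m(2)[OF that(1)] m(2)[OF that(2)] sum_squares_bound[of "\<bar>x i\<bar>" "\<bar>x j\<bar>"] by (simp add: abs_mult)
    then show ?thesis using \<open>\<bar>\<sigma>\<bar> = 1\<close> \<theta> by (simp add: c_def h_def abs_mult)
  qed
  have "(\<Sum>i<n. \<Sum>j<n. ?P i j * (exp (2 * c i j) - 1)) \<le>
      (\<Sum>i<n. \<Sum>j<n. 2 * (c i j * ?P i j) + 4 * p * h\<^sup>2 * ((x i)\<^sup>2 * (x j)\<^sup>2))"
  proof (intro sum_mono)
    fix i j assume "i \<in> {..<n}" "j \<in> {..<n}"
    then have "exp (2 * c i j) - 1 \<le> 2 * c i j + (2 * c i j)\<^sup>2"
      using exp_le_quadratic[OF c_le[of i j]] by simp
    then have "?P i j * (exp (2 * c i j) - 1) \<le> ?P i j * (2 * c i j + (2 * c i j)\<^sup>2)"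
      using edge_prob_bounds[OF pq(1,3,4)] by (intro mult_left_mono)
    also have "\<dots> \<le> 2 * (c i j * ?P i j) + p * (2 * c i j)\<^sup>2"
      using edge_prob_bounds[OF pq(1,3,4), of s i j] by (simp add: distrib_left mult_right_mono)
    also have "(2 * c i j)\<^sup>2 = 4 * h\<^sup>2 * ((x i)\<^sup>2 * (x j)\<^sup>2)"
      using \<sigma> by (simp add: c_def power_mult_distrib)
    finally show "?P i j * (exp (2 * c i j) - 1) \<le> 2 * (c i j * ?P i j) + 4 * p * h\<^sup>2 * ((x i)\<^sup>2 * (x j)\<^sup>2)"
      by (simp add: mult_ac)
  qed
  also have "\<dots> = 2 * (\<Sum>i<n. \<Sum>j<n. c i j * ?P i j) + 4 * p * h\<^sup>2 * (\<Sum>i<n. (x i)\<^sup>2)\<^sup>2"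
  proof -
    have "(\<Sum>i<n. \<Sum>j<n. 4 * p * h\<^sup>2 * ((x i)\<^sup>2 * (x j)\<^sup>2)) = 4 * p * h\<^sup>2 * (\<Sum>i<n. (x i)\<^sup>2)\<^sup>2"
      unfolding power2_eq_square[of "sum _ _"] sum_product by (simp only: sum_distrib_left)
    moreover have "(\<Sum>i<n. \<Sum>j<n. 2 * (c i j * ?P i j)) = 2 * (\<Sum>i<n. \<Sum>j<n. c i j * ?P i j)"
      by (simp only: sum_distrib_left)
    ultimately show ?thesis by (simp only: sum.distrib)
  qed
  also have "\<dots> \<le> 2 * (\<Sum>i<n. \<Sum>j<n. c i j * ?P i j) + 4 * p * h\<^sup>2 * (36 * real n)\<^sup>2"
    using m(1) pq by (intro add_left_mono mult_left_mono power_mono) (auto intro: sum_nonneg)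
  also have "4 * p * h\<^sup>2 * (36 * real n)\<^sup>2 = 2 * (p * (real n)\<^sup>2 / (2 * \<theta>\<^sup>2))"
    using \<theta> by (simp add: h_def field_simps power2_eq_square)
  finally have "(\<Sum>i<n. \<Sum>j<n. ?P i j * (exp (2 * c i j) - 1)) / 2 - (u + (\<Sum>i<n. \<Sum>j<n. c i j * ?P i j)) \<le>
      p * (real n)\<^sup>2 / (2 * \<theta>\<^sup>2) - u" by linarith
  moreover have "u = \<beta> * real n / (2 * \<theta>)" using \<theta> by (simp add: u_def h_def)
  ultimately show ?thesis
    unfolding ev using chernoff_edge_coins[of p q n c s "u + (\<Sum>i<n. \<Sum>j<n. c i j * ?P i j)"] pq
    by (auto simp: c_def mult_ac elim!: order.trans)
qed

text \<open>
Since \<open>|k| \<le> k\<^sup>2\<close> for integers, each point of the ball has weight at least 1 under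
\<open>2^L * (\<Prod>i<n. 2^(- |m i|))\<close>, and the total weight factors into sums that are at most 3.
\<close>

lemma card_integer_ball:
  "finite {m \<in> {..<n} \<rightarrow>\<^sub>E {- int L..int L}. (\<Sum>i<n. (m i)\<^sup>2) \<le> int L}"
  "real (card {m \<in> {..<n} \<rightarrow>\<^sub>E {- int L..int L}. (\<Sum>i<n. (m i)\<^sup>2) \<le> int L}) \<le> 2 ^ L * 3 ^ n"
proof -
  let ?B = "{- int L..int L}"
  let ?G = "{m \<in> {..<n} \<rightarrow>\<^sub>E ?B. (\<Sum>i<n. (m i)\<^sup>2) \<le> int L}"
  have fin: "finite ({..<n} \<rightarrow>\<^sub>E ?B)" by (intro finite_PiE) auto
  then show "finite ?G" by simp
  have geo: "(\<Sum>k\<in>?B. (1 / 2 :: real) ^ nat \<bar>k\<bar>) \<le> 3"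
  proof -
    have "(\<Sum>k\<in>?B. (1 / 2 :: real) ^ nat \<bar>k\<bar>) = 3 - 2 * (1 / 2) ^ L"
    proof (induction L)
      case (Suc L)
      have "{- int (Suc L)..int (Suc L)} = insert (- int (Suc L)) (insert (int (Suc L)) {- int L..int L})"
        by auto
      then show ?case using Suc by (simp add: nat_add_distrib)
    qed simp
    then show ?thesis by simp
  qed
  have "real (card ?G) = (\<Sum>m\<in>?G. 1)" by simp
  also have "\<dots> \<le> (\<Sum>m\<in>?G. 2 ^ L * (\<Prod>i<n. (1 / 2) ^ nat \<bar>m i\<bar>))"
  proof (rule sum_mono)
    fix m assume m: "m \<in> ?G"
    have "int (\<Sum>i<n. nat \<bar>m i\<bar>) \<le> (\<Sum>i<n. (m i)\<^sup>2)"
      unfolding of_nat_sum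
      by (intro sum_mono) (simp add: abs_int_le_square)
    also have "\<dots> \<le> int L" using m by simp
    finally have "(\<Sum>i<n. nat \<bar>m i\<bar>) \<le> L" by (simp only: of_nat_le_iff)
    then have "(1 / 2 :: real) ^ L \<le> (1 / 2) ^ (\<Sum>i<n. nat \<bar>m i\<bar>)" by (intro power_decreasing) auto
    then have "2 ^ L * (1 / 2 :: real) ^ L \<le> 2 ^ L * (\<Prod>i<n. (1 / 2) ^ nat \<bar>m i\<bar>)"
      unfolding power_sum by (intro mult_left_mono) auto
    then show "(1 :: real) \<le> 2 ^ L * (\<Prod>i<n. (1 / 2) ^ nat \<bar>m i\<bar>)" by (simp flip: power_mult_distrib)
  qed
  also have "\<dots> \<le> (\<Sum>m\<in>{..<n} \<rightarrow>\<^sub>E ?B. 2 ^ L * (\<Prod>i<n. (1 / 2) ^ nat \<bar>m i\<bar>))"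
  proof (rule sum_mono2[OF fin])
    show "?G \<subseteq> {..<n} \<rightarrow>\<^sub>E ?B" by blast
    show "0 \<le> (2 :: real) ^ L * (\<Prod>i<n. (1 / 2) ^ nat \<bar>m i\<bar>)" for m :: "nat \<Rightarrow> int"
      by (intro mult_nonneg_nonneg prod_nonneg) auto
  qed
  also have "\<dots> = 2 ^ L * (\<Prod>i<n. \<Sum>k\<in>?B. (1 / 2) ^ nat \<bar>k\<bar>)"
    unfolding sum_distrib_left[symmetric] by (subst prod_sum_PiE) auto
  also have "\<dots> \<le> 2 ^ L * (\<Prod>i<n. 3)"
    by (intro mult_left_mono prod_mono conjI geo sum_nonneg) auto
  finally show "real (card ?G) \<le> 2 ^ L * 3 ^ n" by simp
qed

lemma sum_power_card_Pow:
  assumes "finite V"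
  shows "(\<Sum>T\<in>Pow V. x ^ card T) = (1 + x :: real) ^ card V"
proof -
  have "(\<Prod>v\<in>V. x + 1) = (\<Sum>T\<in>Pow V. x ^ card T)"
    using assms by (subst prod_add) auto
  then show ?thesis by (simp add: add.commute)
qed

section \<open>Typical graphs\<close>

text \<open>
All that the spectral bound needs from the randomness.  The sums over \<open>T\<close> count every edge inside \<open>T\<close>
twice, which explains the factor 2 next to \<open>\<kappa>\<close>.  The constant 36 is the squared radius, per vertex, of
the ball whose integer points serve as a net.
\<close>

definition typical_graph ::
  "nat \<Rightarrow> (nat \<Rightarrow> real) \<Rightarrow> real \<Rightarrow> real \<Rightarrow> real \<Rightarrow> real \<Rightarrow> real \<Rightarrow> real \<Rightarrow> real \<Rightarrow>
    (nat \<times> nat \<Rightarrow> bool) \<Rightarrow> bool" where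
  "typical_graph n s p q \<delta> \<Delta> \<theta> \<kappa> \<beta> e \<longleftrightarrow>
    (\<forall>i<n. \<delta> \<le> (\<Sum>j<n. edge e i j * (s i * s j))) \<and>
    (\<forall>i<n. (\<Sum>j<n. edge e i j) \<le> \<Delta>) \<and>
    (\<forall>T. T \<subseteq> {..<n} \<longrightarrow> T \<noteq> {} \<longrightarrow> real (card T) * \<theta> \<le> 2 * real n \<longrightarrow>
      (\<Sum>i\<in>T. \<Sum>j\<in>T. edge e i j) \<le> 2 * \<kappa> * card T) \<and>
    (\<forall>m::nat \<Rightarrow> int. (\<Sum>i<n. (m i)\<^sup>2) \<le> 36 * int n \<longrightarrow> (\<forall>i<n. of_int ((m i)\<^sup>2) \<le> 36 * \<theta>) \<longrightarrow>
      \<bar>quad_form n (\<lambda>i j. edge e i j - edge_prob s p q i j) (\<lambda>i. of_int (m i))\<bar> \<le> \<beta> * (36 * real n))"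

text \<open>
A union bound, with one summand for each of the four properties.  In the third summand the
failure probability for a set \<open>T\<close> is at most \<open>y ^ card T\<close> with a fixed \<open>y\<close>; these add up to \<open>(1 + y) ^ n - 1\<close>
over all nonempty \<open>T\<close>.
\<close>

lemma prob_not_typical:
  assumes pq: "0 \<le> p" "p \<le> 1" "0 \<le> q" "q \<le> p"
    and s: "\<And>i. i < n \<Longrightarrow> s i = 1 \<or> s i = -1" "(\<Sum>i<n. s i) = 0"
    and pos: "0 < \<tau>" "0 < \<tau>'" "0 < \<theta>"
  shows "measure_pmf.prob (edge_coins n s p q) {e. \<not> typical_graph n s p q \<delta> \<Delta> \<theta> \<kappa> \<beta> e} \<le>
    real n * exp (real n / 2 * (p * (exp (- \<tau>) - 1) + q * (exp \<tau> - 1)) + p + \<tau> * \<delta>) +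
    real n * exp (2 * real n * p - \<Delta>) +
    ((1 + exp (p * real n * exp \<tau>' / \<theta> - \<tau>' * \<kappa>)) ^ n - 1) +
    2 * (2 ^ (36 * n) * 3 ^ n) * exp (p * (real n)\<^sup>2 / (2 * \<theta>\<^sup>2) - \<beta> * real n / (2 * \<theta>))"
proof -
  let ?M = "edge_coins n s p q"
  let ?pr = "measure_pmf.prob ?M"
  let ?q = "\<lambda>e. quad_form n (\<lambda>i j. edge e i j - edge_prob s p q i j)"
  have q1: "q \<le> 1" using pq by linarith
  define G where "G = {m \<in> {..<n} \<rightarrow>\<^sub>E {- int (36 * n)..int (36 * n)}. (\<Sum>i<n. (m i)\<^sup>2) \<le> int (36 * n)}"
  define G' where "G' = {m \<in> G. \<forall>i<n. real_of_int ((m i)\<^sup>2) \<le> 36 * \<theta>}"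
  define \<T> where "\<T> = {T. T \<subseteq> {..<n} \<and> T \<noteq> {} \<and> real (card T) * \<theta> \<le> 2 * real n}"
  define B1 where "B1 = (\<lambda>i. {e. (\<Sum>j<n. edge e i j * (s i * s j)) \<le> \<delta>})"
  define B2 where "B2 = (\<lambda>i. {e. \<Delta> \<le> (\<Sum>j<n. edge e i j)})"
  define B3 where "B3 = (\<lambda>T. {e. 2 * (\<kappa> * card T) \<le> (\<Sum>i\<in>T. \<Sum>j\<in>T. edge e i j)})"
  define B4 where "B4 = (\<lambda>(m, \<sigma>). {e. \<beta> * (36 * real n) \<le> \<sigma> * ?q e (\<lambda>i. of_int (m i :: int))})"
  have "finite G" unfolding G_def by (rule card_integer_ball(1))
  then have finG: "finite G" "finite G'" by (auto simp: G'_def)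
  have finT: "finite \<T>" unfolding \<T>_def by (rule finite_subset[of _ "Pow {..<n}"]) auto
  have union: "{e. \<not> typical_graph n s p q \<delta> \<Delta> \<theta> \<kappa> \<beta> e} \<subseteq>
      ((\<Union>i\<in>{..<n}. B1 i) \<union> (\<Union>i\<in>{..<n}. B2 i)) \<union> ((\<Union>T\<in>\<T>. B3 T) \<union> (\<Union>x\<in>G' \<times> {1, -1}. B4 x))"
    (is "_ \<subseteq> ?U")
  proof (rule subsetI, rule ccontr)
    fix e assume e: "e \<in> {e. \<not> typical_graph n s p q \<delta> \<Delta> \<theta> \<kappa> \<beta> e}" and no: "e \<notin> ?U"
    have "typical_graph n s p q \<delta> \<Delta> \<theta> \<kappa> \<beta> e"
      unfolding typical_graph_def
    proof (intro conjI allI impI)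
      fix i assume "i < n"
      then have "e \<notin> B1 i" "e \<notin> B2 i" using no by auto
      then show "\<delta> \<le> (\<Sum>j<n. edge e i j * (s i * s j))" "(\<Sum>j<n. edge e i j) \<le> \<Delta>"
        by (auto simp: B1_def B2_def)
    next
      fix T assume "T \<subseteq> {..<n}" "T \<noteq> {}" "real (card T) * \<theta> \<le> 2 * real n"
      then have "T \<in> \<T>" by (simp add: \<T>_def)
      then have "e \<notin> B3 T" using no by auto
      then show "(\<Sum>i\<in>T. \<Sum>j\<in>T. edge e i j) \<le> 2 * \<kappa> * card T" by (simp add: B3_def not_le mult.assoc)
    next
      fix m :: "nat \<Rightarrow> int"
      assume m: "(\<Sum>i<n. (m i)\<^sup>2) \<le> 36 * int n" "\<forall>i<n. of_int ((m i)\<^sup>2) \<le> 36 * \<theta>"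
      define m' where "m' = restrict m {..<n}"
      have eq: "m' i = m i" if "i < n" for i using that by (simp add: m'_def)
      have "m i \<in> {- int (36 * n)..int (36 * n)}" if "i < n" for i
      proof -
        have "\<bar>m i\<bar> \<le> (m i)\<^sup>2" by (rule abs_int_le_square)
        also have "\<dots> \<le> (\<Sum>i<n. (m i)\<^sup>2)" using that by (intro member_le_sum) auto
        finally show ?thesis using m(1) by auto
      qed
      then have "m' \<in> G'" using m eq by (auto simp: G'_def G_def m'_def)
      then have "e \<notin> B4 (m', 1)" "e \<notin> B4 (m', -1)" using no by auto
      then have "\<bar>?q e (\<lambda>i. of_int (m' i))\<bar> \<le> \<beta> * (36 * real n)"
        by (auto simp: B4_def)
      moreover have "?q e (\<lambda>i. of_int (m' i)) = ?q e (\<lambda>i. of_int (m i))"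
        unfolding quad_form_def by (intro sum.cong refl) (simp add: eq)
      ultimately show "\<bar>?q e (\<lambda>i. of_int (m i))\<bar> \<le> \<beta> * (36 * real n)" by simp
    qed
    then show False using e by simp
  qed
  have "?pr {e. \<not> typical_graph n s p q \<delta> \<Delta> \<theta> \<kappa> \<beta> e} \<le> ?pr ?U"
    by (intro measure_pmf.finite_measure_mono union) auto
  also have "\<dots> \<le> (?pr (\<Union>i\<in>{..<n}. B1 i) + ?pr (\<Union>i\<in>{..<n}. B2 i)) +
      (?pr (\<Union>T\<in>\<T>. B3 T) + ?pr (\<Union>x\<in>G' \<times> {1, -1}. B4 x))"
    by (intro order.trans[OF measure_Un_le] add_mono order.refl) auto
  also have "?pr (\<Union>i\<in>{..<n}. B1 i) \<le>
      real n * exp (real n / 2 * (p * (exp (- \<tau>) - 1) + q * (exp \<tau> - 1)) + p + \<tau> * \<delta>)"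
  proof -
    have "?pr (\<Union>i\<in>{..<n}. B1 i) \<le> (\<Sum>i\<in>{..<n}. ?pr (B1 i))" by (rule measure_UNION_le) auto
    also have "\<dots> \<le> (\<Sum>i\<in>{..<n}. exp (real n / 2 * (p * (exp (- \<tau>) - 1) + q * (exp \<tau> - 1)) + p + \<tau> * \<delta>))"
      unfolding B1_def by (intro sum_mono prob_small_margin) (use pq q1 s pos in auto)
    finally show ?thesis by simp
  qed
  also have "?pr (\<Union>i\<in>{..<n}. B2 i) \<le> real n * exp (2 * real n * p - \<Delta>)"
  proof -
    have "?pr (\<Union>i\<in>{..<n}. B2 i) \<le> (\<Sum>i\<in>{..<n}. ?pr (B2 i))" by (rule measure_UNION_le) auto
    also have "\<dots> \<le> (\<Sum>i\<in>{..<n}. exp (2 * real n * p - \<Delta>))"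
      unfolding B2_def by (intro sum_mono prob_large_degree) (use pq in auto)
    finally show ?thesis by simp
  qed
  also have "?pr (\<Union>T\<in>\<T>. B3 T) \<le> (1 + exp (p * real n * exp \<tau>' / \<theta> - \<tau>' * \<kappa>)) ^ n - 1"
  proof -
    let ?y = "p * real n * exp \<tau>' / \<theta> - \<tau>' * \<kappa>"
    have "?pr (\<Union>T\<in>\<T>. B3 T) \<le> (\<Sum>T\<in>\<T>. ?pr (B3 T))" by (rule measure_UNION_le[OF finT]) auto
    also have "\<dots> \<le> (\<Sum>T\<in>\<T>. exp ?y ^ card T)"
    proof (rule sum_mono)
      fix T assume T: "T \<in> \<T>"
      have "?pr (B3 T) \<le> exp ((real (card T))\<^sup>2 * p * exp \<tau>' / 2 - \<tau>' * (\<kappa> * card T))"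
        unfolding B3_def by (rule prob_dense_subset) (use pq T pos in \<open>auto simp: \<T>_def\<close>)
      also have "(real (card T))\<^sup>2 * p * exp \<tau>' / 2 - \<tau>' * (\<kappa> * card T) \<le> card T * ?y"
      proof -
        have "real (card T) \<le> 2 * real n / \<theta>" using T pos by (simp add: \<T>_def field_simps)
        then have "real (card T) * (real (card T) * (p * exp \<tau>' / 2)) \<le>
            real (card T) * (2 * real n / \<theta> * (p * exp \<tau>' / 2))"
          using pq by (intro mult_left_mono mult_right_mono) auto
        then show ?thesis by (simp add: power2_eq_square algebra_simps)
      qed
      finally show "?pr (B3 T) \<le> exp ?y ^ card T" by (simp add: exp_of_nat_mult)
    qed
    also have "\<dots> \<le> (\<Sum>T\<in>Pow {..<n} - {{}}. exp ?y ^ card T)"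
      by (rule sum_mono2) (auto simp: \<T>_def)
    also have "\<dots> = (1 + exp ?y) ^ n - 1"
      using sum_power_card_Pow[of "{..<n}" "exp ?y"] by (subst sum_diff) auto
    finally show ?thesis .
  qed
  also have "?pr (\<Union>x\<in>G' \<times> {1, -1}. B4 x) \<le>
      2 * (2 ^ (36 * n) * 3 ^ n) * exp (p * (real n)\<^sup>2 / (2 * \<theta>\<^sup>2) - \<beta> * real n / (2 * \<theta>))"
  proof -
    let ?E = "exp (p * (real n)\<^sup>2 / (2 * \<theta>\<^sup>2) - \<beta> * real n / (2 * \<theta>))"
    have "?pr (\<Union>x\<in>G' \<times> {1, -1}. B4 x) \<le> (\<Sum>x\<in>G' \<times> {1, -1}. ?pr (B4 x))"
      by (rule measure_UNION_le) (use finG in auto)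
    also have "\<dots> \<le> (\<Sum>x\<in>G' \<times> {1, -1 :: real}. ?E)"
    proof (rule sum_mono)
      fix x assume "x \<in> G' \<times> {1, -1 :: real}"
      then obtain m \<sigma> where x: "x = (m, \<sigma>)" "m \<in> G'" "\<sigma>\<^sup>2 = 1" by (cases x) auto
      have "of_int (\<Sum>i<n. (m i)\<^sup>2) \<le> (of_int (36 * int n) :: real)"
        using x(2) by (simp only: of_int_le_iff) (simp add: G'_def G_def)
      then have "(\<Sum>i<n. (real_of_int (m i))\<^sup>2) \<le> 36 * real n" by simp
      then show "?pr (B4 x) \<le> ?E"
        unfolding x(1) B4_def prod.case
        by (intro prob_flat_form) (use pq pos x in \<open>auto simp: G'_def\<close>)
    qed
    also have "\<dots> = real (card G' * 2) * ?E" using finG by (simp add: card_cartesian_product)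
    also have "\<dots> \<le> 2 * (2 ^ (36 * n) * 3 ^ n) * ?E"
    proof (rule mult_right_mono)
      have "card G' \<le> card G" using finG by (intro card_mono) (auto simp: G'_def)
      moreover have "real (card G) \<le> 2 ^ (36 * n) * 3 ^ n"
        unfolding G_def by (rule card_integer_ball(2))
      ultimately show "real (card G' * 2) \<le> 2 * (2 ^ (36 * n) * 3 ^ n)" by linarith
    qed simp
    finally show ?thesis .
  qed
  finally show ?thesis by linarith
qed

lemma adjacency_edge:
  assumes "i < n" "j < n"
  shows "adjacency n e $$ (i, j) = edge e i j"
  using assms by (simp add: adjacency_def edge_def)

text \<open>
The centred form is at most \<open>\<epsilon>\<close> and the margins are at least \<open>4 \<epsilon>\<close>, so the certificate is at least
\<open>2 \<epsilon>\<close> on the complement of \<open>z\<close>, and at most \<open>\<Delta> + 2 \<epsilon> + 2 p\<close>.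
\<close>

lemma typical_graph_benign:
  assumes n: "n > 0" and z: "z \<in> carrier_vec n" "\<And>i. i < n \<Longrightarrow> z $ i = 1 \<or> z $ i = -1" "(\<Sum>i<n. z $ i) = 0"
    and typi: "typical_graph n (($) z) p q (4 * \<epsilon>) \<Delta> \<theta> \<kappa> \<beta> e"
    and pq: "0 \<le> q" "q \<le> p"
    and \<epsilon>: "4 * (\<beta> + (4 * \<omega> * \<kappa> + \<Delta> / \<omega>) + 12 * p * real n / sqrt \<theta>) \<le> \<epsilon>"
    and pos: "0 < \<epsilon>" "0 < \<theta>" "0 < \<omega>" "0 \<le> \<kappa>"
    and r: "1 \<le> r" "\<Delta> + 2 * \<epsilon> + 2 * p < (real r - 1) * \<epsilon>"
  defines "J \<equiv> outer (ones_vec n) (ones_vec n)"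
  assumes C: "C = adjacency n e - (1 / (real n)\<^sup>2 * frob (adjacency n e) J) \<cdot>\<^sub>m J \<or>
      C = adjacency n e - ((p + q) / 2) \<cdot>\<^sub>m J"
    and crit: "second_order_critical n r (objective C) Y"
  shows "\<exists>u \<in> carrier_vec r. sqrt (u \<bullet> u) = 1 \<and> Y = outer z u"
proof -
  let ?s = "($) z"
  have J: "J \<in> carrier_mat n n" by (simp add: J_def outer_def ones_vec_def)
  have J1: "J $$ (i, j) = 1" if "i < n" "j < n" for i j
    using that by (simp add: J_def outer_def ones_vec_def)
  have A: "adjacency n e \<in> carrier_mat n n" by (simp add: adjacency_def)
  have "frob (adjacency n e) J = (\<Sum>i<n. \<Sum>j<n. edge e i j)"
    unfolding frob_eq_sum[OF A J] by (intro sum.cong refl) (simp add: adjacency_edge J1)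
  then obtain t where t: "C = adjacency n e - t \<cdot>\<^sub>m J"
    "t = (p + q) / 2 \<or> t = (\<Sum>i<n. \<Sum>j<n. edge e i j) / (real n)\<^sup>2"
    using C by auto
  have C_car: "C \<in> carrier_mat n n" using A J t by auto
  have C_index: "C $$ (i, j) = edge e i j - t" if "i < n" "j < n" for i j
    using that A J by (simp add: t(1) adjacency_edge J1)
  have C_sym: "C\<^sup>T = C"
    by (rule eq_matI) (use C_car in \<open>auto simp: C_index edge_sym\<close>)
  have typi': "\<And>i. i < n \<Longrightarrow> 4 * \<epsilon> \<le> (\<Sum>j<n. edge e i j * (z $ i * z $ j))"
    "\<And>i. i < n \<Longrightarrow> (\<Sum>j<n. edge e i j) \<le> \<Delta>"
    "\<And>T. T \<subseteq> {..<n} \<Longrightarrow> T \<noteq> {} \<Longrightarrow> real (card T) * \<theta> \<le> 2 * real n \<Longrightarrow>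
      (\<Sum>i\<in>T. \<Sum>j\<in>T. edge e i j) \<le> 2 * \<kappa> * card T"
    "\<And>m::nat \<Rightarrow> int. (\<Sum>i<n. (m i)\<^sup>2) \<le> 36 * int n \<Longrightarrow> (\<forall>i<n. of_int ((m i)\<^sup>2) \<le> 36 * \<theta>) \<Longrightarrow>
      \<bar>quad_form n (\<lambda>i j. edge e i j - edge_prob ?s p q i j) (\<lambda>i. of_int (m i))\<bar> \<le> \<beta> * (36 * real n)"
    using typi unfolding typical_graph_def by blast+
  define W where "W = (\<lambda>i j. edge e i j - edge_prob ?s p q i j)"
  have W: "\<bar>quad_form n W x\<bar> \<le> \<epsilon> * (\<Sum>i<n. (x i)\<^sup>2)" for x
  proof -
    have "\<bar>quad_form n W x\<bar> \<le>
        4 * (\<beta> + (4 * \<omega> * \<kappa> + \<Delta> / \<omega>) + 12 * p * real n / sqrt \<theta>) * (\<Sum>i<n. (x i)\<^sup>2)"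
    proof (rule quad_form_bound_from_integers)
      show "W i j = W j i" for i j
        using edge_sym[of e i j] by (auto simp: W_def edge_prob_def)
      show "\<bar>quad_form n W (\<lambda>i. of_int (m i))\<bar> \<le>
          (\<beta> + (4 * \<omega> * \<kappa> + \<Delta> / \<omega>) + 12 * p * real n / sqrt \<theta>) * (36 * real n)"
        if "(\<Sum>i<n. (m i)\<^sup>2) \<le> 36 * int n" for m :: "nat \<Rightarrow> int"
        unfolding W_def
        by (rule centered_form_bound_on_integers)
          (use typi' that pos pq edge_prob_bounds[of p q] in \<open>auto simp: edge_nonneg edge_diag intro: edge_sym\<close>)
    qed
    also have "\<dots> \<le> \<epsilon> * (\<Sum>i<n. (x i)\<^sup>2)"
      using \<epsilon> by (intro mult_right_mono) (auto intro: sum_nonneg)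
    finally show ?thesis .
  qed
  have margin_le: "(\<Sum>j<n. edge e i j * (z $ i * z $ j)) \<le> \<Delta>" if "i < n" for i
  proof -
    have "(\<Sum>j<n. edge e i j * (z $ i * z $ j)) \<le> (\<Sum>j<n. edge e i j)"
    proof (rule sum_mono)
      fix j assume "j \<in> {..<n}"
      then have "z $ i * z $ j \<le> 1" using z(2)[of i] z(2)[of j] that by auto
      then show "edge e i j * (z $ i * z $ j) \<le> edge e i j"
        using edge_nonneg[of e i j] by (simp add: mult_left_le)
    qed
    then show ?thesis using typi'(2)[OF that] by linarith
  qed
  show ?thesis
  proof (rule second_order_critical_rank_one[OF C_car C_sym n z(1) _ _ r(1) _ _ crit])
    show "(z $ i)\<^sup>2 = 1" if "i < n" for i using z(2)[OF that] by auto
    fix x assume x: "(\<Sum>i<n. z $ i * x i) = 0"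
    have "cert_form n (\<lambda>i j. C $$ (i, j)) ?s x = cert_form n (\<lambda>i j. edge e i j - t) ?s x"
      unfolding cert_form_def quad_form_def
      by (intro arg_cong2[where f = "(-)"] sum.cong refl arg_cong2[where f = "(*)"]) (simp_all add: C_index)
    then show "(2 * \<epsilon>) * (\<Sum>i<n. (x i)\<^sup>2) \<le> cert_form n (\<lambda>i j. C $$ (i, j)) ?s x \<and>
        cert_form n (\<lambda>i j. C $$ (i, j)) ?s x \<le> (\<Delta> + 2 * \<epsilon> + 2 * p) * (\<Sum>i<n. (x i)\<^sup>2)"
      using cert_form_bounds[of n ?s "edge e" p q \<epsilon> "4 * \<epsilon>" \<Delta> t x, OF z(2,3) n W[unfolded W_def edge_prob_def]
         typi'(1) margin_le _ t(2) x] pq by simp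
  next
    have "0 \<le> \<Delta>"
      using typi'(2)[OF n] sum_nonneg[of "{..<n}" "edge e 0"] by (auto simp: edge_nonneg)
    then show "0 \<le> \<Delta> + 2 * \<epsilon> + 2 * p" using pos pq by simp
    show "2 * (\<Delta> + 2 * \<epsilon> + 2 * p) < (real r - 1) * (2 * \<epsilon>)" using mult_strict_left_mono[OF r(2), of 2] by (simp add: mult_ac)
  qed
qed

section \<open>The regime of logarithmic degrees\<close>

text \<open>
The left side of the inequality is minimal at \<open>exp \<tau> = sqrt (a / b)\<close>, where it equals
\<open>- (sqrt a - sqrt b)\<^sup>2 / 2\<close>.  This is where the threshold for exact recovery enters: a
value below \<open>-1\<close> makes the failure probability at one vertex \<open>o(1 / n)\<close>.  To include \<open>b = 0\<close>,
\<open>sqrt b\<close> is replaced by a slightly larger positive \<open>v\<close>.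
\<close>

lemma exact_recovery_tilt:
  fixes a b :: real
  assumes "0 \<le> a" "0 \<le> b" "sqrt a - sqrt b > sqrt 2"
  obtains \<tau> where "0 < \<tau>" "(a * (exp (- \<tau>) - 1) + b * (exp \<tau> - 1)) / 2 < - 1"
proof -
  define \<zeta> where "\<zeta> = (sqrt a - sqrt b - sqrt 2) / 2"
  define v where "v = sqrt b + \<zeta>"
  have \<zeta>: "\<zeta> > 0" using assms by (simp add: \<zeta>_def)
  have v: "0 < v" "sqrt a - v = sqrt 2 + \<zeta>"
    using \<zeta> assms(2) by (simp_all add: v_def add_nonneg_pos) (simp add: \<zeta>_def field_simps)
  have va: "v < sqrt a" using v \<zeta> by (smt (verit) real_sqrt_gt_zero)
  have b_le: "b \<le> v\<^sup>2"
  proof -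
    have "(sqrt b)\<^sup>2 \<le> v\<^sup>2" using \<zeta> assms by (intro power_mono) (auto simp: v_def)
    then show ?thesis using assms by simp
  qed
  define \<tau> where "\<tau> = ln (sqrt a / v)"
  have "1 < sqrt a / v" using v va by simp
  then have \<tau>: "\<tau> > 0" "exp \<tau> = sqrt a / v" by (simp_all add: \<tau>_def)
  then have exp_neg: "exp (- \<tau>) = v / sqrt a" by (simp add: exp_minus)
  have sa: "sqrt a > 0" using va v by linarith
  have "a * exp (- \<tau>) = sqrt a * v"
  proof -
    have "w * w * (v / w) = w * v" if "w > 0" for w :: real using that by simp
    from this[OF sa] show ?thesis using assms(1) by (simp add: exp_neg)
  qed
  moreover have "b * (exp \<tau> - 1) \<le> v\<^sup>2 * (exp \<tau> - 1)" using b_le \<tau>(1) by (intro mult_right_mono) auto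
  moreover have "v\<^sup>2 * exp \<tau> = sqrt a * v" using \<tau> v by (simp add: power2_eq_square)
  ultimately have "a * (exp (- \<tau>) - 1) + b * (exp \<tau> - 1) \<le> 2 * (sqrt a * v) - a - v\<^sup>2"
    by (simp add: algebra_simps)
  also have "\<dots> = - (sqrt a - v)\<^sup>2" using assms by (simp add: power2_diff)
  also have "\<dots> < - 2"
  proof -
    have "(sqrt 2)\<^sup>2 < (sqrt 2 + \<zeta>)\<^sup>2" using \<zeta> by (intro power_strict_mono) auto
    then show ?thesis using v by simp
  qed
  finally show ?thesis using \<tau> that by simp
qed

theorem corollary3:
  fixes a b :: real
  assumes "a \<ge> 0" and "b \<ge> 0" and "sqrt a - sqrt b > sqrt 2"
  defines "p \<equiv> \<lambda>n::nat. a * ln (real n) / real n"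
    and "q \<equiv> \<lambda>n::nat. b * ln (real n) / real n"
  shows "\<exists>r\<^sub>0::nat. \<forall>z :: nat \<Rightarrow> real vec.
    (\<forall>n. even n \<longrightarrow>
       z n \<in> carrier_vec n \<and> (\<forall>i<n. z n $ i \<in> {1, -1}) \<and> z n \<bullet> ones_vec n = 0) \<longrightarrow>
    ((\<lambda>n. measure_pmf.prob (sbm n (p n) (q n) (z n))
        {A. let J = outer (ones_vec n) (ones_vec n) in
            \<forall>C \<in> {A - (1 / (real n)\<^sup>2 * frob A J) \<cdot>\<^sub>m J, A - ((p n + q n) / 2) \<cdot>\<^sub>m J}.
            \<forall>r \<ge> r\<^sub>0. \<forall>Y.
              second_order_critical n r (objective C) Y \<longrightarrow>
              (\<exists>u \<in> carrier_vec r. sqrt (u \<bullet> u) = 1 \<and> Y = outer (z n) u)})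
      \<longlongrightarrow> 1) (inf sequentially (principal {n. even n}))"
proof -
  obtain \<tau> where \<tau>: "0 < \<tau>" "(a * (exp (- \<tau>) - 1) + b * (exp \<tau> - 1)) / 2 < - 1"
    using exact_recovery_tilt[OF assms(1-3)] .
  have ab: "b < a" "0 < a"
  proof -
    have "sqrt b < sqrt a" using assms(3) real_sqrt_gt_zero[of 2] by linarith
    then show "b < a" by simp
    then show "0 < a" using assms(2) by linarith
  qed
  \<comment> \<open>The excess \<open>M\<close> over the threshold sets all scales.  Half of it is spent on requiring margins \<open>64 \<rho> d\<close> instead of 0.\<close>
  define M where "M = - 1 - (a * (exp (- \<tau>) - 1) + b * (exp \<tau> - 1)) / 2"
  define \<rho> where "\<rho> = M / (128 * \<tau>)"
  \<comment> \<open>The expected degrees are at most \<open>a d\<close>; \<open>K\<close> makes the failure probability at one vertex \<open>exp (- 2 d) = 1 / n\<^sup>2\<close>.\<close>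
  define K where "K = 2 * a + 2"
  \<comment> \<open>The factor 100 gives the exponent \<open>- 50 n\<close>, against at most \<open>exp (38 n)\<close> integer vectors.\<close>
  define \<eta> where "\<eta> = \<rho> / 100"
  \<comment> \<open>With these choices the two terms \<open>4 \<omega> \<gamma> d\<close> and \<open>K d / \<omega>\<close> of the bound by peeling both equal \<open>\<rho> d\<close>.\<close>
  define \<gamma> where "\<gamma> = \<rho>\<^sup>2 / (4 * K)"
  define \<omega> where "\<omega> = K / \<rho>"
  \<comment> \<open>With the tilt \<open>2 / \<gamma>\<close> a set \<open>T\<close> spans too many edges with probability at most \<open>(exp c / n\<^sup>2) ^ card T\<close>.\<close>
  define c where "c = a * exp (2 / \<gamma>) / \<eta>"
  have M: "M > 0" using \<tau> by (simp add: M_def)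
  have pos: "\<rho> > 0" "K > 0" "\<eta> > 0" "\<gamma> > 0" "\<omega> > 0"
    using M \<tau> ab by (auto simp: \<rho>_def K_def \<eta>_def \<gamma>_def \<omega>_def intro!: divide_pos_pos add_pos_pos)
  define r0 where "r0 = nat \<lceil>(K + 32 * \<rho> + 2 * a) / (16 * \<rho>)\<rceil> + 2"
  have r0: "K + 32 * \<rho> + 2 * a < (real r - 1) * (16 * \<rho>)" if "r0 \<le> r" for r
  proof -
    have "(K + 32 * \<rho> + 2 * a) / (16 * \<rho>) \<le> real (nat \<lceil>(K + 32 * \<rho> + 2 * a) / (16 * \<rho>)\<rceil>)"
      by (rule real_nat_ceiling_ge)
    also have "\<dots> < real r - 1" using that by (simp add: r0_def)
    finally show ?thesis using pos by (simp add: field_simps)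
  qed
  define fail where "fail = (\<lambda>n::nat. exp (1 - M / 2 * ln (real n)) + exp (- ln (real n)) +
    (exp (exp c / real n) - 1) + 2 * exp (- 11 * real n))"
  have fail: "fail \<longlonglongrightarrow> 0"
  proof -
    have "(\<lambda>n. exp (1 - M / 2 * ln (real n))) \<longlonglongrightarrow> 0" using M by real_asymp
    moreover have "(\<lambda>n. exp (- ln (real n))) \<longlonglongrightarrow> 0" by real_asymp
    moreover have "(\<lambda>n. exp (exp c / real n) - 1) \<longlonglongrightarrow> exp 0 - 1"
      by (intro tendsto_intros lim_const_over_n)
    moreover have "(\<lambda>n. 2 * exp (- 11 * real n)) \<longlonglongrightarrow> 0" by real_asymp
    ultimately have "fail \<longlonglongrightarrow> 0 + 0 + (exp 0 - 1) + 0" unfolding fail_def by (intro tendsto_add)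
    then show ?thesis by simp
  qed
  have large: "\<forall>\<^sub>F n::nat in sequentially. x \<le> ln (real n)" for x
    using filterlim_compose[OF ln_at_top filterlim_real_sequentially] by (auto simp: filterlim_at_top)
  have p_small: "\<forall>\<^sub>F n::nat in sequentially. p n \<le> 1"
    unfolding p_def by real_asymp
  show ?thesis
  proof (intro exI[of _ r0] allI impI)
    fix z :: "nat \<Rightarrow> real vec"
    assume z: "\<forall>n. even n \<longrightarrow>
       z n \<in> carrier_vec n \<and> (\<forall>i<n. z n $ i \<in> {1, -1}) \<and> z n \<bullet> ones_vec n = 0"
    let ?S = "\<lambda>n. {A. let J = outer (ones_vec n) (ones_vec n) in
            \<forall>C \<in> {A - (1 / (real n)\<^sup>2 * frob A J) \<cdot>\<^sub>m J, A - ((p n + q n) / 2) \<cdot>\<^sub>m J}.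
            \<forall>r \<ge> r0. \<forall>Y.
              second_order_critical n r (objective C) Y \<longrightarrow>
              (\<exists>u \<in> carrier_vec r. sqrt (u \<bullet> u) = 1 \<and> Y = outer (z n) u)}"
    let ?pr = "\<lambda>n. measure_pmf.prob (sbm n (p n) (q n) (z n)) (?S n)"
    have lower: "1 - fail n \<le> ?pr n"
      if even: "even n" and n: "n > 0" and p1: "p n \<le> 1"
        and d: "1 \<le> ln (real n)" "a / (2 * \<eta>\<^sup>2) \<le> ln (real n)" "(12 * a / \<rho>)\<^sup>2 / \<eta> \<le> ln (real n)" for n
    proof -
      define d where "d = ln (real n)"
      let ?s = "($) (z n)"
      have d1: "1 \<le> d" "a / (2 * \<eta>\<^sup>2) \<le> d" "(12 * a / \<rho>)\<^sup>2 / \<eta> \<le> d" using d by (auto simp: d_def)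
      have expd: "exp d = real n" using n by (simp add: d_def)
      have pn: "p n * real n = a * d" and qn: "q n * real n = b * d"
        using n by (simp_all add: p_def q_def d_def)
      have pq: "0 \<le> p n" "0 \<le> q n" "q n \<le> p n"
        using ab assms d1 n by (auto simp: p_def q_def simp flip: d_def intro!: divide_right_mono mult_right_mono)
      have zn: "z n \<in> carrier_vec n" "\<And>i. i < n \<Longrightarrow> z n $ i = 1 \<or> z n $ i = -1" "(\<Sum>i<n. z n $ i) = 0"
        using z even by (auto simp: scalar_prod_def ones_vec_def atLeast0LessThan)
      let ?typ = "typical_graph n ?s (p n) (q n) (4 * (16 * \<rho> * d)) (K * d) (\<eta> * d) (\<gamma> * d) (\<rho> * d)"
      have coins: "sbm n (p n) (q n) (z n) = map_pmf (adjacency n) (edge_coins n ?s (p n) (q n))"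
        by (simp add: sbm_def edge_coins_def)
      have "measure_pmf.prob (edge_coins n ?s (p n) (q n)) {e. \<not> ?typ e} \<le> fail n"
      proof -
        have "measure_pmf.prob (edge_coins n ?s (p n) (q n)) {e. \<not> ?typ e} \<le>
          real n * exp (real n / 2 * (p n * (exp (- \<tau>) - 1) + q n * (exp \<tau> - 1)) + p n + \<tau> * (4 * (16 * \<rho> * d))) +
          real n * exp (2 * real n * p n - K * d) +
          ((1 + exp (p n * real n * exp (2 / \<gamma>) / (\<eta> * d) - 2 / \<gamma> * (\<gamma> * d))) ^ n - 1) +
          2 * (2 ^ (36 * n) * 3 ^ n) * exp (p n * (real n)\<^sup>2 / (2 * (\<eta> * d)\<^sup>2) - \<rho> * d * real n / (2 * (\<eta> * d)))"
          by (rule prob_not_typical) (use pq p1 zn \<tau> pos d1 in auto)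
        also have "real n * exp (real n / 2 * (p n * (exp (- \<tau>) - 1) + q n * (exp \<tau> - 1)) + p n + \<tau> * (4 * (16 * \<rho> * d)))
            \<le> exp (1 - M / 2 * d)"
        proof -
          have "real n / 2 * (p n * (exp (- \<tau>) - 1) + q n * (exp \<tau> - 1)) =
              ((p n * real n) * (exp (- \<tau>) - 1) + (q n * real n) * (exp \<tau> - 1)) / 2"
            by (simp add: algebra_simps)
          also have "\<dots> = - (1 + M) * d" unfolding pn qn by (simp add: M_def field_simps)
          finally have "real n / 2 * (p n * (exp (- \<tau>) - 1) + q n * (exp \<tau> - 1)) = - (1 + M) * d" .
          moreover have "\<tau> * (4 * (16 * \<rho> * d)) = M / 2 * d" using \<tau> by (simp add: \<rho>_def)
          ultimately have "d + (real n / 2 * (p n * (exp (- \<tau>) - 1) + q n * (exp \<tau> - 1)) + p n + \<tau> * (4 * (16 * \<rho> * d)))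
              = p n - M / 2 * d" by (simp only:) (simp add: algebra_simps)
          then have "d + (real n / 2 * (p n * (exp (- \<tau>) - 1) + q n * (exp \<tau> - 1)) + p n + \<tau> * (4 * (16 * \<rho> * d)))
              \<le> 1 - M / 2 * d" using p1 by linarith
          then show ?thesis unfolding expd[symmetric] exp_add[symmetric] by (simp add: expd)
        qed
        also have "real n * exp (2 * real n * p n - K * d) = exp (- d)"
        proof -
          have "2 * real n * p n - K * d = - d - d" using pn by (simp add: K_def algebra_simps)
          then show ?thesis unfolding expd[symmetric] exp_add[symmetric] by simp
        qed
        also have "(1 + exp (p n * real n * exp (2 / \<gamma>) / (\<eta> * d) - 2 / \<gamma> * (\<gamma> * d))) ^ n \<le> exp (exp c / n)"
        proof -
          have "p n * real n * exp (2 / \<gamma>) / (\<eta> * d) - 2 / \<gamma> * (\<gamma> * d) = c - (d + d)"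
            unfolding pn using pos d1 by (simp add: c_def)
          then have "exp (p n * real n * exp (2 / \<gamma>) / (\<eta> * d) - 2 / \<gamma> * (\<gamma> * d)) = exp c / (real n * real n)"
            by (simp only: exp_diff exp_add expd)
          moreover have "(1 + exp c / (real n * real n)) ^ n \<le> exp (exp c / (real n * real n)) ^ n"
            by (intro power_mono exp_ge_add_one_self) auto
          moreover have "exp (exp c / (real n * real n)) ^ n = exp (exp c / n)"
            using n by (simp flip: exp_of_nat_mult)
          ultimately show ?thesis by simp
        qed
        also have "2 * (2 ^ (36 * n) * 3 ^ n) * exp (p n * (real n)\<^sup>2 / (2 * (\<eta> * d)\<^sup>2) - \<rho> * d * real n / (2 * (\<eta> * d)))
            \<le> 2 * exp (- 11 * real n)"
        proof -
          have "(2 :: real) ^ (36 * n) \<le> exp 1 ^ (36 * n)"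
            using exp_ge_add_one_self[of 1] by (intro power_mono) auto
          moreover have "(3 :: real) ^ n \<le> exp 2 ^ n"
            using exp_ge_add_one_self[of 2] by (intro power_mono) auto
          ultimately have "(2 :: real) ^ (36 * n) * 3 ^ n \<le> exp 1 ^ (36 * n) * exp 2 ^ n"
            by (intro mult_mono) auto
          also have "\<dots> = exp (38 * real n)" by (simp flip: exp_of_nat_mult exp_add)
          finally have grid: "(2 :: real) ^ (36 * n) * 3 ^ n \<le> exp (38 * real n)" .
          have "p n * (real n)\<^sup>2 / (2 * (\<eta> * d)\<^sup>2) = a / (2 * \<eta>\<^sup>2) / d * real n"
          proof -
            have "p n * (real n)\<^sup>2 = a * d * real n" using pn by (simp add: power2_eq_square mult_ac)
            then show ?thesis using d1 pos by (simp add: power2_eq_square field_simps)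
          qed
          also have "\<dots> \<le> 1 * real n"
            by (intro mult_right_mono, subst divide_le_eq_1_pos) (use d1(1,2) in linarith, rule d1(2), simp)
          finally have "p n * (real n)\<^sup>2 / (2 * (\<eta> * d)\<^sup>2) \<le> real n" by simp
          moreover have "\<rho> * d * real n / (2 * (\<eta> * d)) = 50 * real n"
            using d1 pos by (simp add: \<eta>_def)
          ultimately have "exp (p n * (real n)\<^sup>2 / (2 * (\<eta> * d)\<^sup>2) - \<rho> * d * real n / (2 * (\<eta> * d))) \<le>
              exp (- 49 * real n)" by simp
          with grid have "(2 ^ (36 * n) * 3 ^ n) * exp (p n * (real n)\<^sup>2 / (2 * (\<eta> * d)\<^sup>2) - \<rho> * d * real n / (2 * (\<eta> * d)))
              \<le> exp (38 * real n) * exp (- 49 * real n)"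
            by (intro mult_mono) auto
          also have "\<dots> = exp (- 11 * real n)" by (simp flip: exp_add)
          finally show ?thesis by simp
        qed
        finally show ?thesis by (simp add: fail_def d_def)
      qed
      moreover have "measure_pmf.prob (edge_coins n ?s (p n) (q n)) {e. ?typ e} =
          1 - measure_pmf.prob (edge_coins n ?s (p n) (q n)) {e. \<not> ?typ e}"
        using measure_pmf.prob_compl[of "{e. \<not> ?typ e}" "edge_coins n ?s (p n) (q n)"]
        by (simp add: Compl_eq_Diff_UNIV[symmetric] Collect_neg_eq[symmetric])
      moreover have "{e. ?typ e} \<subseteq> adjacency n -` ?S n"
      proof (rule subsetI)
        fix e assume "e \<in> {e. ?typ e}"
        then have typi: "?typ e" by simp
        have "\<exists>u \<in> carrier_vec r. sqrt (u \<bullet> u) = 1 \<and> Y = outer (z n) u"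
          if "C = adjacency n e - (1 / (real n)\<^sup>2 * frob (adjacency n e) (outer (ones_vec n) (ones_vec n))) \<cdot>\<^sub>m
                outer (ones_vec n) (ones_vec n) \<or>
              C = adjacency n e - ((p n + q n) / 2) \<cdot>\<^sub>m outer (ones_vec n) (ones_vec n)"
            and r: "r0 \<le> r" and crit: "second_order_critical n r (objective C) Y" for C r Y
        proof (rule typical_graph_benign[OF n zn typi pq(2,3) _ _ _ _ _ _ _ that(1) crit, where \<omega> = \<omega>])
          have "4 * \<omega> * (\<gamma> * d) = \<rho> * d" "K * d / \<omega> = \<rho> * d"
            using pos by (simp_all add: \<omega>_def \<gamma>_def power2_eq_square)
          moreover have "12 * p n * real n / sqrt (\<eta> * d) \<le> \<rho> * d"
          proof -
            have "(12 * a / \<rho>)\<^sup>2 \<le> \<eta> * d" using d1(3) pos by (simp add: field_simps)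
            then have "12 * a / \<rho> \<le> sqrt (\<eta> * d)" by (rule real_le_rsqrt)
            then have "12 * a * d \<le> \<rho> * d * sqrt (\<eta> * d)"
              using pos d1 by (simp add: field_simps)
            then show ?thesis using pos d1 pn by (simp add: divide_le_eq mult.assoc)
          qed
          moreover have "4 * (x + (y + v) + w) \<le> 16 * x" if "y = x" "v = x" "w \<le> x" for x y v w :: real
            using that by simp
          ultimately have "4 * (\<rho> * d + (4 * \<omega> * (\<gamma> * d) + K * d / \<omega>) + 12 * p n * real n / sqrt (\<eta> * d)) \<le>
              16 * (\<rho> * d)" by blast
          then show "4 * (\<rho> * d + (4 * \<omega> * (\<gamma> * d) + K * d / \<omega>) + 12 * p n * real n / sqrt (\<eta> * d)) \<le> 16 * \<rho> * d"
            by (simp only: mult.assoc)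
          show "0 < 16 * \<rho> * d" "0 < \<eta> * d" "0 < \<omega>" "0 \<le> \<gamma> * d" using pos d1 by auto
          show "1 \<le> r" using r by (simp add: r0_def)
          have "p n \<le> a * d"
          proof -
            have "p n * 1 \<le> p n * real n" using pq n by (intro mult_left_mono) auto
            then show ?thesis using pn by simp
          qed
          moreover have "(K + 32 * \<rho> + 2 * a) * d < (real r - 1) * (16 * \<rho>) * d"
            using r0[OF r] d1 by (intro mult_strict_right_mono) auto
          ultimately show "K * d + 2 * (16 * \<rho> * d) + 2 * p n < (real r - 1) * (16 * \<rho> * d)"
            by (simp add: algebra_simps)
        qed
        then show "e \<in> adjacency n -` ?S n" by (auto simp: Let_def)
      qed
      then have "measure_pmf.prob (edge_coins n ?s (p n) (q n)) {e. ?typ e} \<le> ?pr n"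
        unfolding coins measure_map_pmf by (intro measure_pmf.finite_measure_mono) auto
      ultimately show ?thesis by linarith
    qed
    show "(?pr \<longlongrightarrow> 1) (inf sequentially (principal {n. even n}))"
    proof (rule tendsto_sandwich)
      have "\<forall>\<^sub>F n in sequentially. even n \<longrightarrow> 1 - fail n \<le> ?pr n"
        using large[of 1] large[of "a / (2 * \<eta>\<^sup>2)"] large[of "(12 * a / \<rho>)\<^sup>2 / \<eta>"] p_small
          eventually_gt_at_top[of 0]
        by eventually_elim (use lower in blast)
      then show "\<forall>\<^sub>F n in inf sequentially (principal {n. even n}). 1 - fail n \<le> ?pr n"
        by (simp add: eventually_inf_principal)
      show "\<forall>\<^sub>F n in inf sequentially (principal {n. even n}). ?pr n \<le> 1"
        by simp
      have "(\<lambda>n. 1 - fail n) \<longlonglongrightarrow> 1" using tendsto_diff[OF tendsto_const fail, of 1] by simp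
      then show "((\<lambda>n. 1 - fail n) \<longlongrightarrow> 1) (inf sequentially (principal {n. even n}))"
        by (rule tendsto_mono[OF inf_le1])
    qed simp
  qed
qed

end
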